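(* Let $m$ and $d$ be positive integers and let $h$ be a positive real number. Put $$\ell=\left\lfloor \tfrac m2\right\rfloor,\qquad n_1=\tfrac12\Big(\tfrac16 e^{h}\Big)^{d^2+d},\qquad n_2=\tfrac12\Big(\tfrac16 e^{\frac12 h-\frac12\log 2}\Big)^{d-\sqrt d}.$$ If $n_1\ge \ell$ and $n_2\ge 1$, then there exist algebraic numbers $\alpha_1,\ldots,\alpha_m,\beta_1,\ldots,\beta_m$, all of degree at most $d$ over $\mathbb{Q}$ and of Weil height at most $h$, such that $\lambda=\beta_1e^{\alpha_1}+\cdots+\beta_me^{\alpha_m}$ is nonzero and $$\log|\lambda|\le -\tfrac12\,\ell\log\frac{n_1n_2}{\ell}+\log m+\log\sqrt2+2.$$
   Context: $\log$ denotes the natural logarithm. The Weil height is the absolute logarithmic height: for an algebraic number $\alpha$ of degree $n$ whose defining polynomial (the integer polynomial of least degree with coprime coefficients vanishing at $\alpha$) is $a_n\prod_{i=1}^n(x-\alpha^{(i)})$, it equals $\frac1n\log\big(|a_n|\prod_{i=1}^n\max\{1,|\alpha^{(i)}|\}\big)$. When $m=1$ (so $\ell=0$) the term $\ell\log\frac{n_1n_2}{\ell}$ is understood as $0$, its limit as $\ell\to0$. *)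

theory Defs
  imports Complex_Main "HOL-Computational_Algebra.Computational_Algebra"
begin

definition is_defining_poly :: "int poly \<Rightarrow> complex \<Rightarrow> bool" where
  "is_defining_poly p x \<longleftrightarrow>
     p \<noteq> 0 \<and> content p = 1 \<and> poly (map_poly of_int p) x = 0 \<and>
     (\<forall>q :: int poly. q \<noteq> 0 \<longrightarrow> poly (map_poly of_int q) x = 0 \<longrightarrow> degree p \<le> degree q)"

text \<open>
  The defining polynomial of an algebraic number is unique only up to sign; neither the
  degree nor the height below depends on the sign. For transcendental arguments the
  values are unspecified.
\<close>

definition defining_poly :: "complex \<Rightarrow> int poly" where
  "defining_poly x = (SOME p. is_defining_poly p x)"

definition alg_degree :: "complex \<Rightarrow> nat" where
  "alg_degree x = degree (defining_poly x)"

definition weil_height :: "complex \<Rightarrow> real" where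
  "weil_height x =
     1 / real (alg_degree x) *
     ln (\<bar>real_of_int (lead_coeff (defining_poly x))\<bar> *
         (\<Prod>y\<in>#proots (map_poly of_int (defining_poly x) :: complex poly). max 1 (cmod y)))"

end

theory Submission
  imports Defs
    "HOL-Combinatorics.Permutations"
    "HOL-Analysis.Complex_Transcendental"
    "Jordan_Normal_Form.Char_Poly"
    "Berlekamp_Zassenhaus.Mahler_Measure"
begin

text \<open>
  By pigeonhole, among the sums of \<open>l\<close> terms \<open>\<beta> * exp \<alpha>\<close>, with distinct \<open>\<alpha>\<close> from a
  large set \<open>S\<close> and \<open>\<beta>\<close> from a large set \<open>T\<close>, two are close to each other, and their
  difference has at most \<open>2 * l\<close> terms. It is nonzero by the Lindemann--Weierstrass theorem.
  For \<open>S\<close> take roots in the unit disc of primitive polynomials of degree \<open>d\<close> that satisfy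
  Eisenstein's criterion at 2; for \<open>T\<close> take the numbers \<open>(\<Sum>i<d. c i * \<theta> ^ i) / q\<close> with
  \<open>\<theta> ^ d = 2\<close> and small positive integers \<open>c i\<close>, because then differences of elements of \<open>T\<close>
  still have degree at most \<open>d\<close> and height at most \<open>ln q\<close>. There are fewer elements of
  \<open>T\<close> than \<open>n2\<close> may require, but the surplus in \<open>S\<close> over \<open>n1\<close> compensates for this.

  For the Lindemann--Weierstrass theorem, a vanishing linear form is multiplied by its conjugates,
  so that the power sums of the resulting relation become integers up to a fixed denominator.
  Hermite's functional \<open>f \<mapsto> \<Sum>\<phi>. B \<phi> * (\<Sum>j. (pderiv ^^ j) f (A \<phi>))\<close> takes values on
  \<open>x ^ n * Q ^ k\<close> that are divisible by \<open>fact k\<close> but grow only geometrically, so it vanishes on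
  the ideal generated by a power of \<open>Q\<close>, and then everywhere; but its
  underlying form does not vanish on a polynomial that isolates the leading exponent.
\<close>

text \<open>The coefficients of the final form are differences, and in general the height of a
  difference is only bounded by the sum of the two heights plus log 2; the exponent h/2 - (log 2)/2
  in \<open>n2\<close> leaves room for exactly that. A common field, a common denominator and
  positive numerators keep all differences in one box instead, so no height is lost. The condition
  \<open>n2 \<ge> 1\<close> excludes d = 1, where the exponent d - sqrt d is 0 and \<open>n2\<close>
  is 1/2, and forces exp(h/2) to be at least 8, which gives the counting its room. Since the
  exponents lie in the unit disc, every sum of l terms has modulus at most l e. There are at least
  (n1 n2 / l)^l such sums, because (N choose l) is at least (N/l)^l, and a square grid finds two of
  them within 4 sqrt 2 l e (n1 n2 / l)^(-l/2). From 2 l \<le> m and 2 \<le> e one gets 4 l e \<le> m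
  e^2; this is the origin of log m + log sqrt 2 + 2. On the transcendence side integrality is needed
  only up to a fixed denominator, so averaging over all permutations, at the price of a factor N!,
  can replace the fundamental theorem on symmetric polynomials.\<close>

hide_const (open) module.smult up_ring.coeff up_ring.monom Coset.order

section \<open>Symmetric functions with integral power sums\<close>

definition inj_lists :: "nat \<Rightarrow> nat \<Rightarrow> nat list set" where
  "inj_lists N k = {js. length js = k \<and> distinct js \<and> set js \<subseteq> {..<N}}"

lemma finite_inj_lists [simp]: "finite (inj_lists N k)"
  by (rule finite_subset[OF _ finite_lists_length_eq[of "{..<N}" k]]) (auto simp: inj_lists_def)

lemma sum_inj_lists_Suc:
  "(\<Sum>js\<in>inj_lists N (Suc k). f js) = (\<Sum>js\<in>inj_lists N k. \<Sum>j\<in>{..<N} - set js. f (j # js))"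
proof -
  have "(\<Sum>js\<in>inj_lists N k. \<Sum>j\<in>{..<N} - set js. f (j # js)) =
      (\<Sum>(js, j)\<in>(SIGMA js:inj_lists N k. {..<N} - set js). f (j # js))"
    by (rule sum.Sigma) auto
  also have "\<dots> = (\<Sum>js\<in>inj_lists N (Suc k). f js)"
    by (rule sum.reindex_bij_witness[of _ "\<lambda>js. (tl js, hd js)" "\<lambda>(js, j). j # js"])
       (auto simp: inj_lists_def length_Suc_conv)
  finally show ?thesis ..
qed

definition monomial_at :: "(nat \<Rightarrow> complex) \<Rightarrow> nat list \<Rightarrow> nat list \<Rightarrow> complex" where
  "monomial_at y es js = (\<Prod>i<length es. y (js ! i) ^ (es ! i))"

lemma monomial_at_Cons: "monomial_at y (e # es) (j # js) = y j ^ e * monomial_at y es js"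
  by (simp add: monomial_at_def prod.lessThan_Suc_shift del: prod.lessThan_Suc)

lemma monomial_at_update:
  assumes "i < length es"
  shows "monomial_at y (es[i := es ! i + e]) js = y (js ! i) ^ e * monomial_at y es js"
proof -
  have "monomial_at y (es[i := es ! i + e]) js =
      (\<Prod>k<length es. (if k = i then y (js ! i) ^ e else 1) * y (js ! k) ^ (es ! k))"
    unfolding monomial_at_def length_list_update
    by (rule prod.cong) (auto simp: nth_list_update power_add mult.commute)
  also have "\<dots> = y (js ! i) ^ e * monomial_at y es js"
    using assms by (simp add: prod.distrib monomial_at_def)
  finally show ?thesis .
qed

text \<open>Summing out the first index costs a power sum, up to the terms in which it collides
  with a later one, and those are monomial sums of shorter length.\<close>

lemma monomial_sum_Ints:
  fixes y :: "nat \<Rightarrow> complex"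
  assumes "\<And>k. (\<Sum>i<N. y i ^ k) \<in> \<int>"
  shows "(\<Sum>js\<in>inj_lists N (length es). monomial_at y es js) \<in> \<int>"
proof (induction "length es" arbitrary: es)
  case 0
  then show ?case by (auto simp: monomial_at_def inj_lists_def)
next
  case (Suc k)
  then obtain e es' where es: "es = e # es'" and k: "k = length es'"
    by (cases es) auto
  have "(\<Sum>js\<in>inj_lists N (length es). monomial_at y es js) =
      (\<Sum>js\<in>inj_lists N k. \<Sum>j\<in>{..<N} - set js. y j ^ e * monomial_at y es' js)"
    by (simp add: es k sum_inj_lists_Suc monomial_at_Cons)
  also have "\<dots> = (\<Sum>js\<in>inj_lists N k. (\<Sum>j<N. y j ^ e) * monomial_at y es' js
      - (\<Sum>i<k. monomial_at y (es'[i := es' ! i + e]) js))"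
  proof (rule sum.cong[OF refl])
    fix js assume js: "js \<in> inj_lists N k"
    then have d: "distinct js" "set js \<subseteq> {..<N}" "length js = k"
      by (auto simp: inj_lists_def)
    have "(\<Sum>j\<in>{..<N} - set js. y j ^ e) = (\<Sum>j<N. y j ^ e) - (\<Sum>j\<in>set js. y j ^ e)"
      using d by (simp add: sum_diff)
    also have "(\<Sum>j\<in>set js. y j ^ e) = (\<Sum>i<k. y (js ! i) ^ e)"
      using d by (intro sum.reindex_bij_betw[OF bij_betw_nth, symmetric]) auto
    finally have "(\<Sum>j\<in>{..<N} - set js. y j ^ e * monomial_at y es' js) =
        ((\<Sum>j<N. y j ^ e) - (\<Sum>i<k. y (js ! i) ^ e)) * monomial_at y es' js"
      by (simp flip: sum_distrib_right)
    then show "(\<Sum>j\<in>{..<N} - set js. y j ^ e * monomial_at y es' js) =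
      (\<Sum>j<N. y j ^ e) * monomial_at y es' js
      - (\<Sum>i<k. monomial_at y (es'[i := es' ! i + e]) js)"
      by (simp add: left_diff_distrib sum_distrib_right monomial_at_update k)
  qed
  also have "\<dots> = (\<Sum>j<N. y j ^ e) * (\<Sum>js\<in>inj_lists N k. monomial_at y es' js)
      - (\<Sum>i<k. \<Sum>js\<in>inj_lists N k. monomial_at y (es'[i := es' ! i + e]) js)"
    by (subst sum.swap) (simp add: sum_subtractf sum_distrib_left)
  also have "\<dots> \<in> \<int>"
    using Suc.hyps(1)[of es'] Suc.hyps(1)[of "es'[_ := _]"] assms
    by (intro Ints_diff Ints_mult Ints_sum[where A = "{..<k}"]) (auto simp: k)
  finally show ?case .
qed

text \<open>Listing its values identifies a permutation of \<open>{..<N}\<close> with an injective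
  list of full length \<open>N\<close>, so this is an instance of
  \<open>monomial_sum_Ints\<close>.\<close>

lemma permuted_monomial_sum_Ints:
  fixes y :: "nat \<Rightarrow> complex"
  assumes "\<And>k. (\<Sum>i<N. y i ^ k) \<in> \<int>"
  shows "(\<Sum>\<pi> | \<pi> permutes {..<N}. \<Prod>i<N. y (\<pi> i) ^ e i) \<in> \<int>"
proof -
  let ?es = "map e [0..<N]"
  have "(\<Sum>js\<in>inj_lists N N. monomial_at y ?es js) =
      (\<Sum>\<pi> | \<pi> permutes {..<N}. \<Prod>i<N. y (\<pi> i) ^ e i)"
  proof (rule sum.reindex_bij_witness[of _ "\<lambda>\<pi>. map \<pi> [0..<N]"
        "\<lambda>js i. if i < N then js ! i else i"])
    fix js assume js: "js \<in> inj_lists N N"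
    show "map (\<lambda>i. if i < N then js ! i else i) [0..<N] = js"
      using js by (auto simp: inj_lists_def list_eq_iff_nth_eq)
    have inj: "inj_on (\<lambda>i. if i < N then js ! i else i) {..<N}"
      using js by (auto simp: inj_lists_def inj_on_def nth_eq_iff_index_eq)
    have img: "(\<lambda>i. if i < N then js ! i else i) ` {..<N} \<subseteq> {..<N}"
      using js by (auto simp: inj_lists_def) (metis lessThan_iff nth_mem subset_iff)
    have "(\<lambda>i. if i < N then js ! i else i) ` {..<N} = {..<N}"
      by (rule card_subset_eq[OF finite_lessThan img card_image[OF inj]])
    then have "bij_betw (\<lambda>i. if i < N then js ! i else i) {..<N} {..<N}"
      using inj by (auto simp: bij_betw_def)
    then show "(\<lambda>i. if i < N then js ! i else i) \<in> {\<pi>. \<pi> permutes {..<N}}"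
      
      unfolding mem_Collect_eq by (rule bij_imp_permutes) auto
    show "(\<Prod>i<N. y (if i < N then js ! i else i) ^ e i) = monomial_at y ?es js"
      by (auto simp: monomial_at_def intro!: prod.cong)
  next
    fix \<pi> assume "\<pi> \<in> {\<pi>. \<pi> permutes {..<N}}"
    then have p: "\<pi> permutes {..<N}" by simp
    show "(\<lambda>i. if i < N then map \<pi> [0..<N] ! i else i) = \<pi>"
      using p by (auto simp: permutes_def fun_eq_iff)
    show "map \<pi> [0..<N] \<in> inj_lists N N"
      using p permutes_inj_on[OF p] permutes_in_image[OF p]
      by (auto simp: inj_lists_def distinct_map inj_on_def)
  qed
  moreover have "(\<Sum>js\<in>inj_lists N N. monomial_at y ?es js) \<in> \<int>"
    using monomial_sum_Ints[OF assms, of ?es] by simp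
  ultimately show ?thesis by simp
qed

text \<open>Integer polynomials in \<open>y 0\<close>, ..., \<open>y (N - 1)\<close>, taken as
  functions: only closure under ring operations and the values at one point and its permutations
  matter.\<close>

inductive_set int_poly_funs :: "nat \<Rightarrow> ((nat \<Rightarrow> complex) \<Rightarrow> complex) set" for N where
  zero: "(\<lambda>_. 0) \<in> int_poly_funs N"
| add_monomial: "F \<in> int_poly_funs N \<Longrightarrow> c \<in> \<int> \<Longrightarrow>
    (\<lambda>y. c * (\<Prod>i<N. y i ^ e i) + F y) \<in> int_poly_funs N"

lemma int_poly_funs_monomial: "c \<in> \<int> \<Longrightarrow> (\<lambda>y. c * (\<Prod>i<N. y i ^ e i)) \<in> int_poly_funs N"
  using int_poly_funs.add_monomial[OF int_poly_funs.zero] by simp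

lemma int_poly_funs_const: "c \<in> \<int> \<Longrightarrow> (\<lambda>_. c) \<in> int_poly_funs N"
  using int_poly_funs_monomial[where e = "\<lambda>_. 0"] by simp

lemma int_poly_funs_var:
  assumes "k < N"
  shows "(\<lambda>y. y k) \<in> int_poly_funs N"
proof -
  have "(\<lambda>y :: nat \<Rightarrow> complex. 1 * (\<Prod>i<N. y i ^ (if i = k then 1 else 0))) = (\<lambda>y. y k)"
    using assms by (simp add: if_distrib[of "\<lambda>e. _ ^ e"] prod.delta cong: if_cong)
  moreover have "(\<lambda>y. 1 * (\<Prod>i<N. y i ^ (if i = k then 1 else 0))) \<in> int_poly_funs N"
    by (rule int_poly_funs_monomial) simp
  ultimately show ?thesis by (simp only:)
qed

lemma int_poly_funs_add:
  assumes "F \<in> int_poly_funs N" "G \<in> int_poly_funs N"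
  shows "(\<lambda>y. F y + G y) \<in> int_poly_funs N"
  using assms(1)
proof induction
  case zero
  then show ?case using assms(2) by simp
next
  case (add_monomial F c e)
  then show ?case
    using int_poly_funs.add_monomial[of "\<lambda>y. F y + G y" N c e] by (simp add: add.assoc)
qed

lemma int_poly_funs_mult_monomial:
  assumes "G \<in> int_poly_funs N" "c \<in> \<int>"
  shows "(\<lambda>y. c * (\<Prod>i<N. y i ^ e i) * G y) \<in> int_poly_funs N"
  using assms(1)
proof induction
  case zero
  then show ?case using int_poly_funs.zero by simp
next
  case (add_monomial F c' e')
  have "(\<lambda>y. (c * c') * (\<Prod>i<N. y i ^ (e i + e' i)) + c * (\<Prod>i<N. y i ^ e i) * F y)
      \<in> int_poly_funs N"
    using add_monomial assms(2) by (intro int_poly_funs.add_monomial) auto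
  then show ?case
    by (simp add: power_add prod.distrib algebra_simps)
qed

lemma int_poly_funs_mult:
  assumes "F \<in> int_poly_funs N" "G \<in> int_poly_funs N"
  shows "(\<lambda>y. F y * G y) \<in> int_poly_funs N"
  using assms(1)
proof induction
  case zero
  then show ?case using int_poly_funs.zero by simp
next
  case (add_monomial F c e)
  have "(\<lambda>y. c * (\<Prod>i<N. y i ^ e i) * G y + F y * G y) \<in> int_poly_funs N"
    using add_monomial assms(2) by (intro int_poly_funs_add int_poly_funs_mult_monomial)
  then show ?case by (simp add: distrib_right)
qed

lemma int_poly_funs_uminus: "F \<in> int_poly_funs N \<Longrightarrow> (\<lambda>y. - F y) \<in> int_poly_funs N"
  using int_poly_funs_mult[OF int_poly_funs_const[where c = "- 1"], where G = F] by simp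

lemma int_poly_funs_sum:
  "(\<And>a. a \<in> S \<Longrightarrow> F a \<in> int_poly_funs N) \<Longrightarrow> (\<lambda>y. \<Sum>a\<in>S. F a y) \<in> int_poly_funs N"
  by (induction S rule: infinite_finite_induct)
     (simp_all add: int_poly_funs_add int_poly_funs.zero)

lemma int_poly_funs_prod:
  assumes "finite S" "\<And>a. a \<in> S \<Longrightarrow> F a \<in> int_poly_funs N"
  shows "(\<lambda>y. \<Prod>a\<in>S. F a y) \<in> int_poly_funs N"
  using assms
proof (induction S rule: finite_induct)
  case empty
  show ?case unfolding prod.empty by (rule int_poly_funs_const) (rule Ints_1)
next
  case (insert a S)
  show ?case unfolding prod.insert[OF insert.hyps]
    by (rule int_poly_funs_mult) (use insert in blast)+
qed

lemma int_poly_funs_power: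
  assumes "F \<in> int_poly_funs N"
  shows "(\<lambda>y. F y ^ k) \<in> int_poly_funs N"
proof (induction k)
  case 0
  show ?case unfolding power_0 by (rule int_poly_funs_const) (rule Ints_1)
next
  case (Suc k)
  show ?case unfolding power_Suc by (rule int_poly_funs_mult[OF assms Suc])
qed

text \<open>Up to sign these are elementary symmetric polynomials in the \<open>F a y\<close>; one
  more linear factor combines two coefficients of the shorter product.\<close>

lemma int_poly_funs_coeff_prod:
  assumes "finite S" "\<And>a. a \<in> S \<Longrightarrow> F a \<in> int_poly_funs N"
  shows "(\<lambda>y. coeff (\<Prod>a\<in>S. [:- F a y, 1:]) k) \<in> int_poly_funs N"
  using assms
proof (induction S arbitrary: k rule: finite_induct)
  case empty
  then show ?case by (cases k) (auto intro!: int_poly_funs_const)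
next
  case (insert a S)
  have "coeff (\<Prod>a\<in>insert a S. [:- F a y, 1:]) k =
    (- F a y) * coeff (\<Prod>a\<in>S. [:- F a y, 1:]) k +
      (if k = 0 then 0 else coeff (\<Prod>a\<in>S. [:- F a y, 1:]) (k - 1))" for y
    using insert.hyps by (cases k) (auto simp: coeff_pCons)
  moreover have "(\<lambda>y. (- F a y) * coeff (\<Prod>a\<in>S. [:- F a y, 1:]) k) \<in> int_poly_funs N"
    using insert by (intro int_poly_funs_mult int_poly_funs_uminus) auto
  moreover have "(\<lambda>y. if k = 0 then 0 else coeff (\<Prod>a\<in>S. [:- F a y, 1:]) (k - 1)) \<in> int_poly_funs N"
    using insert by (cases k) (auto intro: int_poly_funs.zero)
  ultimately show ?case
    by (simp only: int_poly_funs_add)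
qed

text \<open>Summing \<open>F\<close> over all permuted arguments repeats the same value
  \<open>fact N\<close> times, while each monomial of \<open>F\<close> contributes an integer to
  that sum.\<close>

lemma symmetric_value_Ints:
  assumes F: "F \<in> int_poly_funs N"
    and power_sums: "\<And>k. (\<Sum>i<N. y i ^ k) \<in> \<int>"
    and symmetric: "\<And>\<pi>. \<pi> permutes {..<N} \<Longrightarrow> F (y \<circ> \<pi>) = F y"
  shows "fact N * F y \<in> \<int>"
proof -
  have "(\<Sum>\<pi> | \<pi> permutes {..<N}. F (y \<circ> \<pi>)) \<in> \<int>"
    using F
  proof induction
    case (add_monomial F c e)
    then show ?case
      using permuted_monomial_sum_Ints[OF power_sums, of e]
      by (simp add: sum.distrib flip: sum_distrib_left)
  qed auto
  also have "(\<Sum>\<pi> | \<pi> permutes {..<N}. F (y \<circ> \<pi>)) = (\<Sum>\<pi> | \<pi> permutes {..<N}. F y)"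
    by (rule sum.cong) (auto simp: symmetric)
  also have "\<dots> = fact N * F y"
    by (simp add: card_permutations[where n = N])
  finally show ?thesis .
qed

section \<open>Hermite's functional\<close>

text \<open>For f = x^n this is the sum of D^j f^(j)(a) over all j, minus exp(a/D) times the same
  sum at 0. The recursion comes from f' = n x^(n-1).\<close>

fun hermite_remainder :: "complex \<Rightarrow> complex \<Rightarrow> nat \<Rightarrow> complex" where
  "hermite_remainder D a 0 = 1 - exp (a / D)"
| "hermite_remainder D a (Suc n) = a ^ Suc n + D * of_nat (Suc n) * hermite_remainder D a n"

lemma hermite_remainder_eq:
  assumes "D \<noteq> 0"
  shows "hermite_remainder D a n =
    - (fact n * D ^ n * (exp (a / D) - (\<Sum>i\<le>n. (a / D) ^ i / fact i)))"
proof (induction n)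
  case (Suc n)
  have "hermite_remainder D a (Suc n) =
      a ^ Suc n - D * of_nat (Suc n) * (fact n * D ^ n * (exp (a / D) - (\<Sum>i\<le>n. (a / D) ^ i / fact i)))"
    by (simp only: hermite_remainder.simps Suc.IH) simp
  also have "a ^ Suc n = fact (Suc n) * D ^ Suc n * ((a / D) ^ Suc n / fact (Suc n))"
    using assms by (simp add: power_divide del: fact_Suc)
  also have "D * of_nat (Suc n) * (fact n * D ^ n * (exp (a / D) - (\<Sum>i\<le>n. (a / D) ^ i / fact i))) =
      fact (Suc n) * D ^ Suc n * (exp (a / D) - (\<Sum>i\<le>n. (a / D) ^ i / fact i))"
    by (simp add: mult_ac)
  finally show ?case
    by (simp only: sum.atMost_Suc) (simp add: algebra_simps del: fact_Suc)
qed simp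

text \<open>The factorial in front cancels the one in the Taylor remainder of exp, which leaves only
  geometric growth in \<open>n\<close>.\<close>

lemma norm_hermite_remainder_le:
  assumes "D \<noteq> 0"
  shows "norm (hermite_remainder D a n) \<le> exp \<bar>Re (a / D)\<bar> * norm (a / D) * norm a ^ n"
proof -
  have "norm (hermite_remainder D a n) =
      fact n * norm D ^ n * norm (exp (a / D) - (\<Sum>i\<le>n. (a / D) ^ i / fact i))"
    using assms by (simp add: hermite_remainder_eq norm_mult norm_power)
  also have "\<dots> \<le> fact n * norm D ^ n * (exp \<bar>Re (a / D)\<bar> * norm (a / D) ^ Suc n / fact n)"
    by (intro mult_left_mono Taylor_exp) auto
  also have "\<dots> = exp \<bar>Re (a / D)\<bar> * norm (a / D) * norm a ^ n"
    using assms by (simp add: norm_divide power_divide)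
  finally show ?thesis .
qed

text \<open>Evaluated at a radius \<open>R \<ge> 0\<close> this is a submultiplicative norm, so
  powers of a fixed polynomial grow geometrically.\<close>

definition abs_poly :: "complex poly \<Rightarrow> real poly" where
  "abs_poly f = map_poly norm f"

lemma coeff_abs_poly [simp]: "coeff (abs_poly f) i = norm (coeff f i)"
  by (simp add: abs_poly_def coeff_map_poly)

lemma degree_abs_poly [simp]: "degree (abs_poly f) = degree f"
  by (simp add: abs_poly_def degree_map_poly)

lemma abs_poly_pCons: "abs_poly (pCons a f) = pCons (norm a) (abs_poly f)"
  by (rule poly_eqI) (simp add: coeff_pCons split: nat.split)

lemma poly_abs_poly_nonneg: "R \<ge> 0 \<Longrightarrow> poly (abs_poly f) R \<ge> 0"
  by (simp add: poly_altdef sum_nonneg)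

lemma poly_abs_poly_add_le:
  assumes "R \<ge> 0"
  shows "poly (abs_poly (f + g)) R \<le> poly (abs_poly f) R + poly (abs_poly g) R"
proof -
  let ?m = "max (degree f) (degree g)"
  have *: "poly (abs_poly h) R = (\<Sum>i\<le>?m. norm (coeff h i) * R ^ i)" if "degree h \<le> ?m" for h
    unfolding poly_altdef
    using that by (intro sum.mono_neutral_cong_left) (auto intro: coeff_eq_0)
  show ?thesis
    unfolding *[OF degree_add_le_max] *[OF max.cobounded1] *[OF max.cobounded2]
      sum.distrib[symmetric] distrib_right[symmetric] coeff_add
    using assms by (intro sum_mono mult_right_mono norm_triangle_ineq) auto
qed

lemma poly_abs_poly_smult: "poly (abs_poly (smult c f)) R = norm c * poly (abs_poly f) R"
proof -
  have "abs_poly (smult c f) = smult (norm c) (abs_poly f)"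
    by (rule poly_eqI) (simp add: norm_mult)
  then show ?thesis by simp
qed

lemma poly_abs_poly_mult_le:
  assumes "R \<ge> 0"
  shows "poly (abs_poly (f * g)) R \<le> poly (abs_poly f) R * poly (abs_poly g) R"
proof (induction f)
  case 0
  then show ?case by (simp add: abs_poly_def)
next
  case (pCons a f)
  have "poly (abs_poly (pCons a f * g)) R \<le>
      poly (abs_poly (smult a g)) R + poly (abs_poly (pCons 0 (f * g))) R"
    using assms by (simp add: poly_abs_poly_add_le)
  also have "\<dots> \<le> norm a * poly (abs_poly g) R + R * (poly (abs_poly f) R * poly (abs_poly g) R)"
    using assms pCons by (simp add: poly_abs_poly_smult abs_poly_pCons mult_left_mono)
  finally show ?case by (simp add: abs_poly_pCons algebra_simps)
qed

lemma poly_abs_poly_power_le: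
  assumes "R \<ge> 0"
  shows "poly (abs_poly (f ^ k)) R \<le> poly (abs_poly f) R ^ k"
proof (induction k)
  case (Suc k)
  have "poly (abs_poly (f ^ Suc k)) R \<le> poly (abs_poly f) R * poly (abs_poly (f ^ k)) R"
    using assms by (simp add: poly_abs_poly_mult_le)
  also have "\<dots> \<le> poly (abs_poly f) R * poly (abs_poly f) R ^ k"
    by (rule mult_left_mono[OF Suc poly_abs_poly_nonneg[OF assms]])
  finally show ?case by simp
qed (simp add: abs_poly_def map_poly_1)

text \<open>Differentiating x^(n+k) \<open>k\<close> times produces the factor (n+k)!/n!, which is
  \<open>fact k\<close> times a binomial coefficient.\<close>

lemma higher_pderiv_int_eq_smult_fact:
  fixes f :: "int poly"
  shows "\<exists>g. (pderiv ^^ k) f = smult (fact k) g"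
proof -
  have "[:fact k:] dvd (pderiv ^^ k) f"
  proof (subst const_poly_dvd_iff, rule allI)
    fix n
    have "fact n * pochhammer (int (Suc n)) k = fact (n + k)"
      unfolding pochhammer_fact pochhammer_product'[of 1 n k] by (simp only: of_nat_Suc)
    also have "\<dots> = int (fact k * fact n * ((n + k) choose k))"
      using binomial_fact_lemma[of k "n + k"] by (simp only: le_add2 add_diff_cancel_right' of_nat_fact)
    also have "\<dots> = fact n * (fact k * int ((n + k) choose k))"
      by (simp only: of_nat_mult of_nat_fact mult_ac)
    finally have "pochhammer (of_nat (Suc n)) k = (fact k :: int) * of_nat ((n + k) choose k)"
      by simp
    then show "fact k dvd coeff ((pderiv ^^ k) f) n"
      by (simp add: coeff_higher_pderiv)
  qed
  then show ?thesis by (elim dvdE) auto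
qed

text \<open>Each derivative removes at most one factor \<open>q\<close>; \<open>f\<close> is
  generalized because the cofactor changes with every step.\<close>

lemma poly_higher_pderiv_mult_power_eq_0:
  fixes q :: "complex poly"
  assumes "poly q a = 0" "j < k"
  shows "poly ((pderiv ^^ j) (f * q ^ k)) a = 0"
  using assms(2)
proof (induction j arbitrary: f k)
  case 0
  then show ?case using assms(1) by (simp add: power_0_left)
next
  case (Suc j)
  then obtain k' where k: "k = Suc k'" by (cases k) auto
  have "pderiv (f * q ^ k) = (pderiv f * q + smult (of_nat k) f * pderiv q) * q ^ k'"
    unfolding k pderiv_mult pderiv_power_Suc
    by (simp add: distrib_left distrib_right mult_ac)
  moreover have "poly ((pderiv ^^ j) ((pderiv f * q + smult (of_nat k) f * pderiv q) * q ^ k')) a = 0"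
    using Suc.prems k by (intro Suc.IH) simp
  ultimately show ?case by (simp only: funpow_Suc_right comp_def)
qed

locale hermite_relation =
  fixes \<Phi> :: "'i set" and B A :: "'i \<Rightarrow> complex" and D :: complex
  assumes finite_index: "finite \<Phi>" and D_nonzero: "D \<noteq> 0"
    and relation: "(\<Sum>\<phi>\<in>\<Phi>. B \<phi> * exp (A \<phi> / D)) = 0"
begin

definition hermite_coeff :: "nat \<Rightarrow> complex" where
  "hermite_coeff n = (\<Sum>\<phi>\<in>\<Phi>. B \<phi> * hermite_remainder D (A \<phi>) n)"

text \<open>Formally this is \<open>f \<mapsto> \<Sum>\<phi>. B \<phi> * (\<Sum>j. D ^ j * (pderiv ^^ j) f (A \<phi>))\<close>; the relation
  between the exponentials allows replacing each inner sum by the small Hermite remainder.\<close>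

definition hermite_fun :: "complex poly \<Rightarrow> complex" where
  "hermite_fun f = (\<Sum>i\<le>degree f. coeff f i * hermite_coeff i)"

lemma hermite_coeff_0: "hermite_coeff 0 = (\<Sum>\<phi>\<in>\<Phi>. B \<phi>)"
  using relation by (simp add: hermite_coeff_def right_diff_distrib sum_subtractf)

lemma hermite_coeff_Suc:
  "hermite_coeff (Suc n) = (\<Sum>\<phi>\<in>\<Phi>. B \<phi> * A \<phi> ^ Suc n) + D * of_nat (Suc n) * hermite_coeff n"
  by (simp add: hermite_coeff_def distrib_left sum.distrib sum_distrib_left mult_ac)

lemma hermite_fun_eq_sum:
  assumes "degree f \<le> m"
  shows "hermite_fun f = (\<Sum>i\<le>m. coeff f i * hermite_coeff i)"
  unfolding hermite_fun_def
  using assms by (intro sum.mono_neutral_cong_left) (auto intro: coeff_eq_0)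

lemma hermite_fun_0 [simp]: "hermite_fun 0 = 0"
  by (simp add: hermite_fun_def)

lemma hermite_fun_add: "hermite_fun (f + g) = hermite_fun f + hermite_fun g"
proof -
  let ?m = "max (degree f) (degree g)"
  show ?thesis
    unfolding hermite_fun_eq_sum[OF degree_add_le_max]
      hermite_fun_eq_sum[of f ?m, OF max.cobounded1] hermite_fun_eq_sum[of g ?m, OF max.cobounded2]
    by (simp add: distrib_right sum.distrib)
qed

lemma hermite_fun_smult: "hermite_fun (smult c f) = c * hermite_fun f"
  by (simp add: hermite_fun_eq_sum[OF degree_smult_le] hermite_fun_eq_sum[OF order.refl] sum_distrib_left mult_ac)

lemma hermite_fun_sum: "hermite_fun (\<Sum>a\<in>S. f a) = (\<Sum>a\<in>S. hermite_fun (f a))"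
  by (induction S rule: infinite_finite_induct) (auto simp: hermite_fun_add)

text \<open>The sum of D^j f^(j) over all j equals f plus D times the same sum for f'. The relation
  between the exponentials enters only through \<open>hermite_coeff_0\<close>.\<close>

lemma hermite_fun_pderiv:
  "hermite_fun f = (\<Sum>\<phi>\<in>\<Phi>. B \<phi> * poly f (A \<phi>)) + D * hermite_fun (pderiv f)"
proof -
  define m where "m = degree f"
  have deg: "degree f \<le> Suc m" "degree (pderiv f) \<le> m"
    by (auto simp: m_def degree_pderiv)
  have poly: "poly f x = (\<Sum>i\<le>Suc m. coeff f i * x ^ i)" for x
    unfolding poly_altdef
    using deg by (intro sum.mono_neutral_cong_left) (auto intro: coeff_eq_0)
  have "hermite_fun f = coeff f 0 * hermite_coeff 0 + (\<Sum>i\<le>m. coeff f (Suc i) * hermite_coeff (Suc i))"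
    by (simp only: hermite_fun_eq_sum[OF deg(1)] sum.atMost_Suc_shift)
  also have "\<dots> = (\<Sum>i\<le>Suc m. coeff f i * (\<Sum>\<phi>\<in>\<Phi>. B \<phi> * A \<phi> ^ i)) +
      D * (\<Sum>i\<le>m. of_nat (Suc i) * coeff f (Suc i) * hermite_coeff i)"
    unfolding sum.atMost_Suc_shift[where n = m] hermite_coeff_0 hermite_coeff_Suc
      distrib_left sum.distrib sum_distrib_left[of D]
    by (simp add: mult_ac)
  also have "(\<Sum>i\<le>m. of_nat (Suc i) * coeff f (Suc i) * hermite_coeff i) = hermite_fun (pderiv f)"
    by (simp only: hermite_fun_eq_sum[OF deg(2)] coeff_pderiv)
  also have "(\<Sum>i\<le>Suc m. coeff f i * (\<Sum>\<phi>\<in>\<Phi>. B \<phi> * A \<phi> ^ i)) = (\<Sum>\<phi>\<in>\<Phi>. B \<phi> * poly f (A \<phi>))"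
    unfolding poly sum_distrib_left by (subst sum.swap) (simp only: mult_ac)
  finally show ?thesis .
qed

lemma hermite_fun_higher_pderiv:
  "hermite_fun f = (\<Sum>j<n. D ^ j * (\<Sum>\<phi>\<in>\<Phi>. B \<phi> * poly ((pderiv ^^ j) f) (A \<phi>)))
    + D ^ n * hermite_fun ((pderiv ^^ n) f)"
proof (induction n)
  case (Suc n)
  then show ?case
    using hermite_fun_pderiv[of "(pderiv ^^ n) f"] by (simp add: algebra_simps)
qed simp

lemma hermite_fun_bound:
  assumes "R \<ge> 0" "\<And>\<phi>. \<phi> \<in> \<Phi> \<Longrightarrow> norm (A \<phi>) \<le> R"
  shows "\<exists>C\<ge>0. \<forall>f. norm (hermite_fun f) \<le> C * poly (abs_poly f) R"
proof -
  define C where "C = (\<Sum>\<phi>\<in>\<Phi>. norm (B \<phi>) * (exp \<bar>Re (A \<phi> / D)\<bar> * norm (A \<phi> / D)))"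
  have "C \<ge> 0" by (auto simp: C_def intro!: sum_nonneg)
  have V: "norm (hermite_coeff n) \<le> C * R ^ n" for n
  proof -
    have "norm (hermite_coeff n) \<le> (\<Sum>\<phi>\<in>\<Phi>. norm (B \<phi>) * norm (hermite_remainder D (A \<phi>) n))"
      unfolding hermite_coeff_def by (rule sum_norm_le) (simp add: norm_mult)
    also have "\<dots> \<le> (\<Sum>\<phi>\<in>\<Phi>. norm (B \<phi>) * (exp \<bar>Re (A \<phi> / D)\<bar> * norm (A \<phi> / D) * R ^ n))"
    proof (intro sum_mono mult_left_mono)
      fix \<phi> assume "\<phi> \<in> \<Phi>"
      have "norm (hermite_remainder D (A \<phi>) n) \<le> exp \<bar>Re (A \<phi> / D)\<bar> * norm (A \<phi> / D) * norm (A \<phi>) ^ n"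
        by (rule norm_hermite_remainder_le[OF D_nonzero])
      also have "\<dots> \<le> exp \<bar>Re (A \<phi> / D)\<bar> * norm (A \<phi> / D) * R ^ n"
        using assms(2)[OF \<open>\<phi> \<in> \<Phi>\<close>] by (intro mult_left_mono power_mono) auto
      finally show "norm (hermite_remainder D (A \<phi>) n) \<le>
        exp \<bar>Re (A \<phi> / D)\<bar> * norm (A \<phi> / D) * R ^ n" .
    qed auto
    also have "\<dots> = C * R ^ n"
      unfolding C_def sum_distrib_right by (simp only: mult_ac)
    finally show ?thesis .
  qed
  have "norm (hermite_fun f) \<le> C * poly (abs_poly f) R" for f
  proof -
    have "norm (hermite_fun f) \<le> (\<Sum>i\<le>degree f. norm (coeff f i) * (C * R ^ i))"
      unfolding hermite_fun_def
      by (rule sum_norm_le) (simp add: norm_mult mult_left_mono V)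
    also have "\<dots> = C * poly (abs_poly f) R"
      by (simp add: poly_altdef sum_distrib_left mult_ac)
    finally show ?thesis .
  qed
  with \<open>C \<ge> 0\<close> show ?thesis by blast
qed

text \<open>The functional kills a nonzero ideal. For a root of its generator \<open>R\<close> the identity
  \<open>hermite_fun_pderiv\<close> would produce an element of the ideal in which this root has smaller
  multiplicity than in \<open>R\<close>; hence \<open>R\<close> is constant.\<close>

lemma hermite_fun_eq_0_if_ideal:
  assumes "F \<noteq> 0" "\<And>g. hermite_fun (F * g) = 0"
  shows "hermite_fun f = 0"
proof -
  define Ann where "Ann = (\<lambda>r. r \<noteq> 0 \<and> (\<forall>g. hermite_fun (r * g) = 0))"
  obtain r where r: "Ann r" and min: "\<And>q. Ann q \<Longrightarrow> degree r \<le> degree q"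
    using assms arg_min_natI[of Ann F degree] arg_min_nat_le[of Ann _ degree]
    unfolding Ann_def by blast
  have r0: "r \<noteq> 0" and rg: "hermite_fun (r * g) = 0" for g
    using r by (auto simp: Ann_def)
  \<comment> \<open>\<open>T\<close> vanishes exactly at those points \<open>A \<phi>\<close> that
    are not roots of \<open>r\<close>. Thus \<open>r * T\<close> vanishes at all of them, while
    \<open>T\<close> keeps away from the roots of \<open>r\<close>.\<close>
  define T where "T = (\<Prod>a\<in>{a \<in> A ` \<Phi>. poly r a \<noteq> 0}. [:- a, 1:])"
  have finA: "finite {a \<in> A ` \<Phi>. poly r a \<noteq> 0}"
    using finite_index by simp
  have T0: "T \<noteq> 0" unfolding T_def using finA by (subst prod_zero_iff) auto
  have T_root: "poly T x = 0 \<longleftrightarrow> x \<in> A ` \<Phi> \<and> poly r x \<noteq> 0" for x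
    unfolding T_def poly_prod using finA by (subst prod_zero_iff) auto
  have rT: "hermite_fun (pderiv r * T * g) = 0" for g
  proof -
    have "poly (r * (T * g)) (A \<phi>) = 0" if "\<phi> \<in> \<Phi>" for \<phi>
      using T_root[of "A \<phi>"] that by auto
    then have "(\<Sum>\<phi>\<in>\<Phi>. B \<phi> * poly (r * (T * g)) (A \<phi>)) = 0"
      by (intro sum.neutral ballI) (simp only: mult_zero_right)
    then have "D * hermite_fun (pderiv (r * (T * g))) = 0"
      using hermite_fun_pderiv[of "r * (T * g)"] rg[of "T * g"] by simp
    then have "hermite_fun (pderiv (r * (T * g))) = 0"
      using D_nonzero by simp
    also have "pderiv (r * (T * g)) = pderiv r * T * g + r * pderiv (T * g)"
      by (simp only: pderiv_mult) (simp add: algebra_simps)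
    finally show ?thesis by (simp add: hermite_fun_add rg)
  qed
  \<comment> \<open>Otherwise the remainder modulo \<open>r\<close> would be an annihilator of
    smaller degree.\<close>
  have "r dvd pderiv r * T"
  proof (rule ccontr)
    assume "\<not> r dvd pderiv r * T"
    then have m: "pderiv r * T mod r \<noteq> 0" by (simp add: mod_eq_0_iff_dvd)
    have "hermite_fun ((pderiv r * T mod r) * g) = 0" for g
    proof -
      have "pderiv r * T * g = (r * (pderiv r * T div r) + pderiv r * T mod r) * g"
        by (simp only: mult_div_mod_eq)
      then have "pderiv r * T * g = (pderiv r * T mod r) * g + r * ((pderiv r * T div r) * g)"
        by (simp only: distrib_right mult.assoc add.commute)
      then show ?thesis
        using rT[of g] rg[of "(pderiv r * T div r) * g"] by (simp add: hermite_fun_add)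
    qed
    then have "Ann (pderiv r * T mod r)" using m by (simp add: Ann_def)
    then show False using min degree_mod_less'[OF r0 m] by fastforce
  qed
  have "degree r = 0"
  proof (rule ccontr)
    assume "degree r \<noteq> 0"
    then obtain z where z: "poly r z = 0"
      using fundamental_theorem_of_algebra[of r] constant_degree[of r] by auto
    have p0: "pderiv r \<noteq> 0" using \<open>degree r \<noteq> 0\<close> by (simp add: pderiv_eq_0_iff)
    \<comment> \<open>\<open>T\<close> contributes nothing at \<open>z\<close>, and
      \<open>pderiv r\<close> vanishes there to one order less than \<open>r\<close>, against the
      divisibility just shown.\<close>
    have "order z (pderiv r * T) = order z (pderiv r)"
      using p0 T0 T_root[of z] z by (simp add: order_mult order_0I)
    moreover have "order z r \<le> order z (pderiv r * T)"
      using \<open>r dvd pderiv r * T\<close> p0 T0 by (intro dvd_imp_order_le) auto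
    ultimately show False using order_pderiv[OF r0 z] by simp
  qed
  then obtain c where c: "r = [:c:]" "c \<noteq> 0" using r0 by (metis degree_eq_zeroE pCons_0_0)
  have "f = r * smult (inverse c) f" using c by simp
  then show ?thesis using rg by metis
qed

end

lemma sum_int_poly_Ints:
  fixes A B :: "'i \<Rightarrow> complex"
  assumes "\<And>n. M * (\<Sum>\<phi>\<in>\<Phi>. B \<phi> * A \<phi> ^ n) \<in> \<int>"
  shows "M * (\<Sum>\<phi>\<in>\<Phi>. B \<phi> * poly (map_poly of_int g) (A \<phi>)) \<in> \<int>"
proof -
  have "M * (\<Sum>\<phi>\<in>\<Phi>. B \<phi> * poly (map_poly of_int g) (A \<phi>)) =
    (\<Sum>i\<le>degree g. of_int (coeff g i) * (M * (\<Sum>\<phi>\<in>\<Phi>. B \<phi> * A \<phi> ^ i)))"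
    unfolding poly_altdef of_int_hom.degree_map_poly_hom sum_distrib_left
    by (subst sum.swap) (simp add: coeff_map_poly mult_ac)
  also have "\<dots> \<in> \<int>" by (intro Ints_sum Ints_mult Ints_of_int assms)
  finally show ?thesis .
qed

text \<open>The conclusion means that the \<open>B \<phi>\<close> belonging to one value of
  \<open>A\<close> add up to zero: the relation is trivial once equal exponents are collected. Test
  polynomials \<open>f\<close> express this without the collecting.\<close>

theorem hermite_vanishing:
  fixes A B :: "'i \<Rightarrow> complex" and D :: int
  assumes "finite \<Phi>" "D \<noteq> 0" "M \<noteq> 0"
    and relation: "(\<Sum>\<phi>\<in>\<Phi>. B \<phi> * exp (A \<phi> / of_int D)) = 0"
    and integral: "\<And>n. M * (\<Sum>\<phi>\<in>\<Phi>. B \<phi> * A \<phi> ^ n) \<in> \<int>"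
    and Q: "Q \<noteq> 0" "\<And>\<phi>. \<phi> \<in> \<Phi> \<Longrightarrow> poly (map_poly of_int Q) (A \<phi>) = 0"
  shows "(\<Sum>\<phi>\<in>\<Phi>. B \<phi> * poly f (A \<phi>)) = 0"
proof (cases "\<Phi> = {}")
  case False
  interpret hermite_relation \<Phi> B A "of_int D"
    using assms by unfold_locales auto
  define q :: "complex poly" where "q = map_poly of_int Q"
  have q0: "q \<noteq> 0" using Q by (simp add: q_def)
  have "degree q > 0"
  proof (rule ccontr)
    assume "\<not> degree q > 0"
    then obtain c where "q = [:c:]" by (auto elim: degree_eq_zeroE)
    then show False using q0 Q(2) False by (auto simp: q_def)
  qed
  \<comment> \<open>The summand 1 gives \<open>R \<ge> 1\<close>, so that
    \<open>R ^ n \<le> R ^ degree q\<close> for every \<open>n \<le> degree q\<close>.\<close>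
  define R where "R = 1 + (\<Sum>\<phi>\<in>\<Phi>. norm (A \<phi>))"
  have R1: "R \<ge> 1" by (auto simp: R_def intro!: sum_nonneg)
  have RA: "norm (A \<phi>) \<le> R" if "\<phi> \<in> \<Phi>" for \<phi>
    using member_le_sum[of \<phi> \<Phi> "\<lambda>\<phi>. norm (A \<phi>)"] that \<open>finite \<Phi>\<close> by (auto simp: R_def)
  obtain C where C: "C \<ge> 0" "\<And>f. norm (hermite_fun f) \<le> C * poly (abs_poly f) R"
    using hermite_fun_bound[of R] RA R1 by auto
  define w where "w = poly (abs_poly q) R"
  have divisible: "\<exists>z::int. M * hermite_fun (monom 1 n * q ^ k) = fact k * of_int z" for n k
  proof -
    define P :: "int poly" where "P = monom 1 n * Q ^ k"
    have P: "monom 1 n * q ^ k = map_poly of_int P"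
      by (simp add: P_def q_def of_int_poly_hom.hom_mult of_int_poly_hom.hom_power)
    \<comment> \<open>After \<open>m\<close> derivatives nothing is left, so
      \<open>hermite_fun_higher_pderiv\<close> expresses the value by derivatives at the points
      \<open>A \<phi>\<close> alone.\<close>
    define m where "m = Suc (degree P)"
    have "(pderiv ^^ m) (monom 1 n * q ^ k) = 0"
      unfolding P of_int_hom.map_poly_higher_pderiv[symmetric]
      by (rule poly_eqI) (simp add: coeff_higher_pderiv m_def coeff_eq_0 del: funpow.simps)
    then have "M * hermite_fun (monom 1 n * q ^ k) =
       (\<Sum>j<m. of_int D ^ j * (M * (\<Sum>\<phi>\<in>\<Phi>. B \<phi> * poly ((pderiv ^^ j) (monom 1 n * q ^ k)) (A \<phi>))))"
      using hermite_fun_higher_pderiv[of "monom 1 n * q ^ k" m] by (simp add: sum_distrib_left mult_ac)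
    also have "\<forall>j. \<exists>z::int. M * (\<Sum>\<phi>\<in>\<Phi>. B \<phi> * poly ((pderiv ^^ j) (monom 1 n * q ^ k)) (A \<phi>)) = fact k * of_int z"
    proof
      fix j
      show "\<exists>z::int. M * (\<Sum>\<phi>\<in>\<Phi>. B \<phi> * poly ((pderiv ^^ j) (monom 1 n * q ^ k)) (A \<phi>)) = fact k * of_int z"
      \<comment> \<open>Fewer than \<open>k\<close> derivatives leave a factor \<open>q\<close>,
        which vanishes at every \<open>A \<phi>\<close>; with \<open>k\<close> or more, the first
        \<open>k\<close> supply the factor \<open>fact k\<close>.\<close>
      proof (cases "j < k")
        case True
        then have "(\<Sum>\<phi>\<in>\<Phi>. B \<phi> * poly ((pderiv ^^ j) (monom 1 n * q ^ k)) (A \<phi>)) = 0"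
          using Q(2) by (intro sum.neutral) (auto simp: poly_higher_pderiv_mult_power_eq_0 q_def)
        then show ?thesis by (auto intro: exI[of _ 0])
      next
        case False
        obtain g where g: "(pderiv ^^ k) P = smult (fact k) g"
          using higher_pderiv_int_eq_smult_fact by blast
        have "(pderiv ^^ j) P = (pderiv ^^ (j - k)) ((pderiv ^^ k) P)"
          using False by (simp flip: funpow_add comp_apply[of "pderiv ^^ _" "pderiv ^^ _"])
        also have "\<dots> = smult (fact k) ((pderiv ^^ (j - k)) g)"
          by (simp add: g higher_pderiv_smult)
        finally have "M * (\<Sum>\<phi>\<in>\<Phi>. B \<phi> * poly ((pderiv ^^ j) (monom 1 n * q ^ k)) (A \<phi>)) =
           fact k * (M * (\<Sum>\<phi>\<in>\<Phi>. B \<phi> * poly (map_poly of_int ((pderiv ^^ (j - k)) g)) (A \<phi>)))"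
          by (simp add: P of_int_hom.map_poly_higher_pderiv[symmetric] of_int_hom.map_poly_hom_smult sum_distrib_left mult_ac)
        then show ?thesis
          using sum_int_poly_Ints[OF integral, of "(pderiv ^^ (j - k)) g"]
          by (auto elim!: Ints_cases)
      qed
    qed
    then obtain z :: "nat \<Rightarrow> int" where z: "\<And>j. M * (\<Sum>\<phi>\<in>\<Phi>. B \<phi> * poly ((pderiv ^^ j) (monom 1 n * q ^ k)) (A \<phi>)) = fact k * of_int (z j)"
      by metis
    have "(\<Sum>j<m. of_int D ^ j * (M * (\<Sum>\<phi>\<in>\<Phi>. B \<phi> * poly ((pderiv ^^ j) (monom 1 n * q ^ k)) (A \<phi>)))) =
        fact k * (of_int (\<Sum>j<m. D ^ j * z j))"
      unfolding z by (simp add: sum_distrib_left mult_ac)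
    finally show ?thesis by blast
  qed
  have bound: "norm (M * hermite_fun (monom 1 n * q ^ k)) \<le> norm M * C * R ^ degree q * w ^ k"
    if "n \<le> degree q" for n k
  proof -
    have "poly (abs_poly (monom 1 n * q ^ k)) R \<le> poly (abs_poly (monom 1 n)) R * poly (abs_poly (q ^ k)) R"
      using R1 by (intro poly_abs_poly_mult_le) auto
    also have "poly (abs_poly (monom 1 n)) R = R ^ n"
      by (simp add: abs_poly_def map_poly_monom poly_monom)
    also have "R ^ n * poly (abs_poly (q ^ k)) R \<le> R ^ degree q * w ^ k"
      unfolding w_def using R1 that
      by (intro mult_mono power_increasing poly_abs_poly_power_le poly_abs_poly_nonneg) auto
    finally have "C * poly (abs_poly (monom 1 n * q ^ k)) R \<le> C * (R ^ degree q * w ^ k)"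
      using C(1) by (rule mult_left_mono)
    with C(2) have "norm (hermite_fun (monom 1 n * q ^ k)) \<le> C * (R ^ degree q * w ^ k)"
      by (rule order.trans)
    then have "norm M * norm (hermite_fun (monom 1 n * q ^ k)) \<le> norm M * (C * (R ^ degree q * w ^ k))"
      by (rule mult_left_mono) simp
    then show ?thesis by (simp add: norm_mult mult_ac)
  qed
  have "(\<lambda>k. norm M * C * R ^ degree q * (w ^ k / fact k)) \<longlonglongrightarrow> norm M * C * R ^ degree q * 0"
    using summable_LIMSEQ_zero[OF summable_exp[of w]]
    by (intro tendsto_mult tendsto_const) (simp add: field_simps)
  then have "\<forall>\<^sub>F k in sequentially. norm M * C * R ^ degree q * (w ^ k / fact k) < 1"
    by (rule order_tendstoD) simp
  then obtain k0 where k0: "\<And>k. k \<ge> k0 \<Longrightarrow> norm M * C * R ^ degree q * (w ^ k / fact k) < 1"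
    by (auto simp: eventually_sequentially)
  have base: "hermite_fun (monom 1 n * q ^ k) = 0" if "n \<le> degree q" "k \<ge> k0" for n k
  proof -
    obtain z :: int where z: "M * hermite_fun (monom 1 n * q ^ k) = fact k * of_int z"
      using divisible by blast
    have "norm M * C * R ^ degree q * w ^ k < fact k"
      using k0[OF that(2)] by (simp add: field_simps)
    then have "fact k * \<bar>of_int z :: real\<bar> < fact k * 1"
      using bound[OF that(1), of k] by (simp only: z norm_mult norm_fact norm_of_int mult_1_right)
    then have "\<bar>of_int z :: real\<bar> < 1" by (simp only: mult_less_cancel_left_pos fact_gt_zero)
    then have "z = 0" by linarith
    with z \<open>M \<noteq> 0\<close> show ?thesis by simp
  qed
  \<comment> \<open>The threshold \<open>k0\<close> is uniform only for monomials of degree at most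
    \<open>degree q\<close>. Division by \<open>q\<close> reduces any \<open>g\<close> to remainders
    of small degree, paid for by higher powers of \<open>q\<close>.\<close>
  have ideal: "hermite_fun (q ^ k * g) = 0" if "k \<ge> k0" for g k
    using that
  proof (induction "degree g" arbitrary: g k rule: less_induct)
    case less
    have low: "hermite_fun (q ^ k * r) = 0" if r: "degree r < degree q" for r
    proof -
      have "q ^ k * r = (\<Sum>i\<le>degree r. smult (coeff r i) (monom 1 i * q ^ k))"
        by (subst poly_as_sum_of_monoms[of r, symmetric])
           (simp add: sum_distrib_left smult_monom mult_ac flip: mult_smult_left)
      then show ?thesis
        using r less.prems by (simp add: hermite_fun_sum hermite_fun_smult base)
    qed
    show ?case
    proof (cases "degree g < degree q")
      case False
      have "q ^ k * g = q ^ Suc k * (g div q) + q ^ k * (g mod q)"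
        by (subst div_mult_mod_eq[of g q, symmetric]) (simp only: algebra_simps power_Suc)
      moreover have "degree (g div q) < degree g"
        using False \<open>degree q > 0\<close> by (intro Polynomial.degree_div_less) auto
      moreover have "degree (g mod q) < degree q"
        using degree_mod_less[OF q0, of g] \<open>degree q > 0\<close> by (metis degree_0)
      ultimately show ?thesis
        using less.hyps[of "g div q" "Suc k"] less.prems low by (simp add: hermite_fun_add)
    qed (rule low)
  qed
  have "hermite_fun g = 0" for g
    using hermite_fun_eq_0_if_ideal[of "q ^ k0"] q0 ideal[OF order.refl] by simp
  then show ?thesis using hermite_fun_pderiv[of f] by simp
qed simp

section \<open>Defining polynomials and the Weil height\<close>

lemma int_poly_if_coeffs_Ints:
  fixes p :: "'a::ring_1 poly"
  assumes "\<And>i. coeff p i \<in> \<int>"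
  shows "\<exists>q. p = map_poly of_int q"
proof -
  have "\<forall>i. \<exists>z. coeff p i = of_int z" using assms by (auto elim: Ints_cases)
  then obtain z where z: "\<And>i. coeff p i = of_int (z i)" by metis
  have "p = map_poly of_int (\<Sum>i\<le>degree p. monom (z i) i)"
    by (rule poly_eqI) (auto simp: coeff_map_poly coeff_sum z coeff_eq_0 simp flip: z)
  then show ?thesis by blast
qed

lemma int_poly_root_smult_iff:
  fixes x :: complex and f :: "int poly"
  assumes "c \<noteq> 0"
  shows "poly (map_poly of_int (smult c f)) x = 0 \<longleftrightarrow> poly (map_poly of_int f) x = 0"
  using assms by (simp add: of_int_hom.map_poly_hom_smult)

lemma algebraic_if_int_poly_root:
  assumes "poly (map_poly of_int f) (x :: complex) = 0" "f \<noteq> 0"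
  shows "algebraic x"
  using assms by (intro algebraicI[of "map_poly of_int f"]) auto

lemma is_defining_poly_exists:
  assumes "algebraic x"
  shows "\<exists>p. is_defining_poly p x"
proof -
  let ?P = "\<lambda>f :: int poly. f \<noteq> 0 \<and> poly (map_poly of_int f) x = 0"
  obtain g :: "complex poly" where "\<And>i. coeff g i \<in> \<int>" "g \<noteq> 0" "poly g x = 0"
    using assms by (elim algebraicE) auto
  then obtain g' where "?P g'"
    using int_poly_if_coeffs_Ints[of g] by auto
  then obtain f where f: "?P f" "\<And>q. ?P q \<Longrightarrow> degree f \<le> degree q"
    using arg_min_natI[of ?P g' degree] arg_min_nat_le[of ?P _ degree] by blast
  have "smult (content f) (primitive_part f) = f" by simp
  then have "poly (map_poly of_int (primitive_part f)) x = 0"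
    using f(1) int_poly_root_smult_iff[of "content f" "primitive_part f" x] by simp
  then have "is_defining_poly (primitive_part f) x"
    using f unfolding is_defining_poly_def by (auto simp: content_primitive_part)
  then show ?thesis ..
qed

text \<open>Gauss's lemma: contents multiply and \<open>p\<close> is primitive, so \<open>c\<close>
  divides the content of the cofactor and cancels.\<close>

lemma dvd_smult_primitiveD:
  fixes p f :: "int poly"
  assumes "content p = 1" "c \<noteq> 0" "p dvd smult c f"
  shows "p dvd f"
proof -
  obtain q where q: "smult c f = p * q" using assms(3) by (elim dvdE)
  then have "normalize c * content f = content q"
    using arg_cong[OF q, of content] unfolding content_smult content_mult assms(1) by simp
  then have "c dvd content q"
    using dvd_triv_left[of "normalize c" "content f"] by simp
  then obtain k where "content q = c * k" by (elim dvdE)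
  then have "q = smult c (smult k (primitive_part q))"
    using content_times_primitive_part[of q] by (simp only: smult_smult)
  then obtain q' where "q = smult c q'" by blast
  then have "smult c f = smult c (p * q')" using q by simp
  then have "f = p * q'" by (rule injD[OF smult_inj[OF assms(2)]])
  then show ?thesis by simp
qed

text \<open>The pseudo-remainder vanishes at \<open>x\<close> too and has smaller degree, hence is
  zero; the power of the leading coefficient is then removed by Gauss's lemma.\<close>

lemma is_defining_poly_dvd:
  assumes "is_defining_poly p x" "poly (map_poly of_int f) x = 0"
  shows "p dvd f"
proof -
  from assms(1) have p: "p \<noteq> 0" "content p = 1" "poly (map_poly of_int p) x = 0"
    "\<And>q. q \<noteq> 0 \<Longrightarrow> poly (map_poly of_int q) x = 0 \<Longrightarrow> degree p \<le> degree q"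
    by (auto simp: is_defining_poly_def)
  obtain q r where qr: "pseudo_divmod f p = (q, r)" by fastforce
  define c where "c = lead_coeff p ^ (Suc (degree f) - degree p)"
  have eq: "smult c f = p * q + r" and deg: "r = 0 \<or> degree r < degree p"
    using pseudo_divmod[OF p(1) qr] by (auto simp: c_def)
  have "poly (map_poly of_int (smult c f)) x = 0" using assms(2) by (simp add: of_int_hom.map_poly_hom_smult)
  then have "poly (map_poly of_int r) x = 0"
    unfolding eq using p(3) by (simp add: of_int_poly_hom.hom_add of_int_poly_hom.hom_mult)
  then have "r = 0" using deg p(4)[of r] by (cases "r = 0") simp_all
  moreover have "c \<noteq> 0" using p(1) by (simp add: c_def)
  ultimately show ?thesis
    using dvd_smult_primitiveD[OF p(2) \<open>c \<noteq> 0\<close>, of f] eq by simp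
qed

lemma is_defining_poly_unique:
  assumes "is_defining_poly p x" "is_defining_poly q x"
  shows "p = q \<or> p = - q"
proof -
  have "p dvd q" "q dvd p"
    using assms is_defining_poly_dvd by (auto simp: is_defining_poly_def)
  then obtain r s where rs: "q = p * r" "p = q * s" by (elim dvdE)
  have "p \<noteq> 0" using assms by (auto simp: is_defining_poly_def)
  have "p * (r * s) = q * s" by (simp only: rs(1) mult.assoc)
  also have "\<dots> = p * 1" unfolding mult_1_right by (rule rs(2)[symmetric])
  finally have "r * s = 1" using \<open>p \<noteq> 0\<close> mult_left_cancel[of p "r * s" 1] by blast
  then have "r dvd 1" by (metis dvd_triv_left)
  then obtain c where c: "r = [:c:]" "c dvd 1" by (auto simp: is_unit_poly_iff)
  then have "c = 1 \<or> c = -1" by auto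
  then show ?thesis using rs(1) c by auto
qed

lemma defining_poly_eq:
  assumes "is_defining_poly p x"
  shows "defining_poly x = p \<or> defining_poly x = - p"
proof -
  have "is_defining_poly (defining_poly x) x"
    unfolding defining_poly_def using assms by (rule someI)
  then show ?thesis using assms by (rule is_defining_poly_unique)
qed

lemma alg_degree_eq: "is_defining_poly p x \<Longrightarrow> alg_degree x = degree p"
  using defining_poly_eq[of p x] by (auto simp: alg_degree_def)

lemma is_defining_poly_degree_pos:
  assumes "is_defining_poly p x"
  shows "degree p > 0"
proof (rule ccontr)
  assume "\<not> degree p > 0"
  then obtain c where "p = [:c:]" by (auto elim: degree_eq_zeroE)
  then show False using assms by (auto simp: is_defining_poly_def)
qed

text \<open>Links the root multiset in \<open>weil_height\<close> with the list of roots behind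
  \<open>mahler_measure\<close>, so that Landau's inequality applies to heights.\<close>

lemma mahler_measure_eq_proots:
  assumes "p \<noteq> 0"
  shows "mahler_measure p = \<bar>real_of_int (lead_coeff p)\<bar> *
    (\<Prod>y\<in>#proots (map_poly of_int p :: complex poly). max 1 (cmod y))"
proof -
  let ?q = "map_poly of_int p :: complex poly"
  have "proots (\<Prod>a\<leftarrow>as. [:- a, 1:]) = mset as" for as :: "complex list"
  proof (induction as)
    case (Cons a as)
    have "proots ([:- a, 1:] * (\<Prod>a\<leftarrow>as. [:- a, 1:])) = proots [:- a, 1:] + proots (\<Prod>a\<leftarrow>as. [:- a, 1:])"
      by (rule proots_mult) (auto simp: prod_list_zero_iff)
    then show ?case
      unfolding list.map prod_list.Cons Cons.IH proots_linear_factor by simp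
  qed simp
  moreover have "proots (smult (lead_coeff ?q) (\<Prod>a\<leftarrow>complex_roots_complex ?q. [:- a, 1:])) =
      proots (\<Prod>a\<leftarrow>complex_roots_complex ?q. [:- a, 1:])"
    by (rule proots_smult) (use assms in simp)
  ultimately have eq: "proots ?q = mset (complex_roots_complex ?q)"
    unfolding complex_roots by simp
  have "(\<Prod>y\<in>#proots ?q. max 1 (cmod y)) = (\<Prod>y\<leftarrow>complex_roots_complex ?q. max 1 (cmod y))"
    unfolding eq by (simp only: mset_map[symmetric] prod_mset_prod_list)
  then show ?thesis
    by (simp add: mahler_measure_def mahler_measure_poly_def)
qed

lemma weil_height_eq:
  assumes "is_defining_poly p x"
  shows "weil_height x = ln (mahler_measure p) / degree p"
proof -
  have p: "p \<noteq> 0" using assms by (simp add: is_defining_poly_def)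
  have "mahler_measure (- p) = mahler_measure p"
    using p by (simp add: mahler_measure_eq_proots of_int_poly_hom.hom_uminus)
  then have "mahler_measure (defining_poly x) = mahler_measure p"
    using defining_poly_eq[OF assms] by auto
  moreover have "defining_poly x \<noteq> 0" using defining_poly_eq[OF assms] p by auto
  ultimately show ?thesis
    unfolding weil_height_def alg_degree_eq[OF assms] by (simp add: mahler_measure_eq_proots)
qed

lemma mahler_measure_pos: "p \<noteq> 0 \<Longrightarrow> mahler_measure p > 0"
  using mahler_measure_poly_ge_1[of p] by linarith

text \<open>Let \<open>p\<close> be a defining polynomial of \<open>x\<close> and f = p r. The
  product of the lowest odd coefficients of \<open>p\<close> and \<open>r\<close> makes a
  coefficient of \<open>f\<close> odd, which must be the leading one. So if \<open>r\<close> had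
  positive degree, both constant terms would be even and 4 would divide that of
  \<open>f\<close>.\<close>

lemma eisenstein_degree:
  fixes f g :: "int poly" and x :: complex
  assumes "odd (lead_coeff f)" "\<And>i. i < degree f \<Longrightarrow> even (coeff f i)" "\<not> 4 dvd coeff f 0"
    and "degree f > 0"
    and "poly (map_poly of_int f) x = 0" "poly (map_poly of_int g) x = 0" "g \<noteq> 0"
  shows "degree f \<le> degree g"
proof -
  have f0: "f \<noteq> 0" using assms(4) by auto
  obtain p where p: "is_defining_poly p x"
    using is_defining_poly_exists[OF algebraic_if_int_poly_root[OF assms(5) f0]] by blast
  then obtain r where r: "f = p * r"
    using is_defining_poly_dvd[OF p assms(5)] by (elim dvdE)
  have nz: "p \<noteq> 0" "r \<noteq> 0" using r f0 by auto
  then have deg: "degree f = degree p + degree r" by (simp add: r degree_mult_eq)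
  have "odd (lead_coeff p)" "odd (lead_coeff r)" using assms(1) unfolding r lead_coeff_mult by auto
  define i where "i = (LEAST i. odd (coeff p i))"
  define j where "j = (LEAST j. odd (coeff r j))"
  have i: "odd (coeff p i)" "\<And>k. k < i \<Longrightarrow> even (coeff p k)"
    using \<open>odd (lead_coeff p)\<close> LeastI[of "\<lambda>i. odd (coeff p i)"] not_less_Least by (auto simp: i_def)
  have j: "odd (coeff r j)" "\<And>k. k < j \<Longrightarrow> even (coeff r k)"
    using \<open>odd (lead_coeff r)\<close> LeastI[of "\<lambda>i. odd (coeff r i)"] not_less_Least by (auto simp: j_def)
  have "odd (coeff f (i + j))"
  proof -
    have "coeff f (i + j) = coeff p i * coeff r j + (\<Sum>k\<in>{..i+j} - {i}. coeff p k * coeff r (i + j - k))"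
      unfolding r coeff_mult by (subst sum.remove[of _ i]) auto
    moreover have "even (\<Sum>k\<in>{..i+j} - {i}. coeff p k * coeff r (i + j - k))"
    proof (rule dvd_sum)
      fix k assume k: "k \<in> {..i+j} - {i}"
      show "even (coeff p k * coeff r (i + j - k))"
      proof (cases "k < i")
        case False
        then have "i + j - k < j" using k by auto
        then show ?thesis using j(2) by simp
      qed (simp add: i(2))
    qed
    ultimately show ?thesis using i(1) j(1) by simp
  qed
  then have "i + j \<ge> degree f" using assms(2)[of "i + j"] by (meson not_le)
  moreover have "i \<le> degree p" "j \<le> degree r" using i(1) j(1) by (metis even_zero le_degree)+
  ultimately have ij: "i = degree p" "j = degree r" using deg by auto
  have "degree r = 0"
  proof (rule ccontr)
    assume "degree r \<noteq> 0"
    then have "even (coeff p 0)" "even (coeff r 0)"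
      using i(2)[of 0] j(2)[of 0] ij is_defining_poly_degree_pos[OF p] by auto
    then have "2 * 2 dvd coeff p 0 * coeff r 0" by (intro mult_dvd_mono)
    then show False using assms(3) unfolding r coeff_mult_0 by simp
  qed
  then have "degree f = degree p" using deg by simp
  also have "\<dots> \<le> degree g" using p assms by (auto simp: is_defining_poly_def)
  finally show ?thesis .
qed

lemma eisenstein_is_defining_poly:
  fixes f :: "int poly"
  assumes "odd (lead_coeff f)" "\<And>i. i < degree f \<Longrightarrow> even (coeff f i)" "\<not> 4 dvd coeff f 0"
    and "degree f > 0" "content f = 1" "poly (map_poly of_int f) x = 0"
  shows "is_defining_poly f x"
  using assms eisenstein_degree[OF assms(1,2,3,4,6)] by (auto simp: is_defining_poly_def)

section \<open>The Lindemann--Weierstrass theorem\<close>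

text \<open>With u = 1 + i t, each \<open>x\<close> excludes at most one real slope
  \<open>t\<close>.\<close>

lemma exists_separating_direction:
  assumes "finite S" "0 \<notin> S"
  shows "\<exists>u. \<forall>x\<in>S. Re (u * x) \<noteq> 0"
proof -
  obtain t :: real where t: "t \<notin> (\<lambda>x. Re x / Im x) ` S"
    using ex_new_if_finite[OF infinite_UNIV_char_0] assms(1) by blast
  have "Re (Complex 1 t * x) \<noteq> 0" if "x \<in> S" for x
  proof (cases "Im x = 0")
    case True
    then have "Re x \<noteq> 0" using assms(2) that complex_eqI[of x 0] by auto
    then show ?thesis using True by simp
  next
    case False
    have "Re x \<noteq> t * Im x"
    proof
      assume "Re x = t * Im x"
      then have "t = Re x / Im x" using False by simp
      then show False using t that by blast
    qed
    then show ?thesis by simp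
  qed
  then show ?thesis by blast
qed

lemma strict_maximum_exists:
  fixes f :: "'b \<Rightarrow> real"
  assumes "finite S" "S \<noteq> {}" "inj_on f S"
  shows "\<exists>i\<in>S. \<forall>j\<in>S. j \<noteq> i \<longrightarrow> f j < f i"
proof -
  have "Max (f ` S) \<in> f ` S" using assms by (intro Max_in) auto
  then obtain i where i: "i \<in> S" "f i = Max (f ` S)" by auto
  have "f j < f i" if "j \<in> S" "j \<noteq> i" for j
    using Max_ge[of "f ` S" "f j"] assms that i inj_onD[OF assms(3), of j i] by fastforce
  with i(1) show ?thesis by blast
qed

text \<open>The vanishing linear form is multiplied by all its conjugates under permutations of the
  \<open>y i\<close>. Expanding the product gives a relation with symmetric data, to which
  \<open>hermite_vanishing\<close> applies; its lexicographically leading term cannot cancel.\<close>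

lemma linear_form_in_exponentials_nonzero:
  fixes y :: "nat \<Rightarrow> complex" and D :: int and n :: nat
  assumes inj: "inj_on y {..<N}" and y0: "\<And>i. i < N \<Longrightarrow> y i \<noteq> 0"
    and power_sums: "\<And>k. (\<Sum>i<N. y i ^ k) \<in> \<int>" and D: "D \<noteq> 0"
    and n: "n > 0" and s: "inj_on s {..<n}" "\<And>i. i < n \<Longrightarrow> s i < N"
    and t: "\<And>i. i < n \<Longrightarrow> t i < N"
  shows "(\<Sum>i<n. y (t i) * exp (y (s i) / of_int D)) \<noteq> 0"
proof
  assume zero: "(\<Sum>i<n. y (t i) * exp (y (s i) / of_int D)) = 0"
  define G where "G = {\<pi>. \<pi> permutes {..<N}}"
  define \<Phi> where "\<Phi> = G \<rightarrow>\<^sub>E {..<n}"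
  \<comment> \<open>Coefficient and exponent of one term of the expanded product;
    \<open>\<phi>\<close> picks a summand from each conjugate form. The point \<open>z\<close> stays
    variable so that symmetry can be stated as invariance under
    \<open>z \<circ> \<tau>\<close>.\<close>
  define B where "B = (\<lambda>z \<phi>. \<Prod>\<pi>\<in>G. (z :: nat \<Rightarrow> complex) (\<pi> (t (\<phi> \<pi>))))"
  define A where "A = (\<lambda>z \<phi>. \<Sum>\<pi>\<in>G. (z :: nat \<Rightarrow> complex) (\<pi> (s (\<phi> \<pi>))))"
  have finG: "finite G" by (simp add: G_def finite_permutations)
  have fin\<Phi>: "finite \<Phi>" by (simp add: \<Phi>_def finG finite_PiE)
  have GN: "\<pi> i < N" if "\<pi> \<in> G" "i < N" for \<pi> i
    using that permutes_in_image[of \<pi> "{..<N}" i] by (auto simp: G_def)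
  have \<Phi>n: "\<phi> \<pi> < n" if "\<phi> \<in> \<Phi>" "\<pi> \<in> G" for \<phi> \<pi>
    using that by (auto simp: \<Phi>_def)
  have id: "id \<in> G" by (simp add: G_def permutes_id)

  have relation: "(\<Sum>\<phi>\<in>\<Phi>. B y \<phi> * exp (A y \<phi> / of_int D)) = 0"
  proof -
    have "(\<Prod>\<pi>\<in>G. \<Sum>i<n. y (\<pi> (t i)) * exp (y (\<pi> (s i)) / of_int D)) =
        (\<Sum>\<phi>\<in>\<Phi>. \<Prod>\<pi>\<in>G. y (\<pi> (t (\<phi> \<pi>))) * exp (y (\<pi> (s (\<phi> \<pi>))) / of_int D))"
      unfolding \<Phi>_def by (rule prod_sum_PiE) (auto simp: finG)
    also have "\<dots> = (\<Sum>\<phi>\<in>\<Phi>. B y \<phi> * exp (A y \<phi> / of_int D))"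
      by (simp add: A_def B_def prod.distrib exp_sum finG sum_divide_distrib)
    also have "(\<Prod>\<pi>\<in>G. \<Sum>i<n. y (\<pi> (t i)) * exp (y (\<pi> (s i)) / of_int D)) = 0"
      using zero id by (intro prod_zero[OF finG] bexI[of _ id]) simp_all
    finally show ?thesis by simp
  qed

  \<comment> \<open>Permuting the coordinates of \<open>z\<close> permutes the conjugate forms,
    which merely relabels the choice functions.\<close>
  have sym: "\<exists>r. bij_betw r \<Phi> \<Phi> \<and> (\<forall>\<phi>\<in>\<Phi>. B (z \<circ> \<tau>) \<phi> = B z (r \<phi>) \<and> A (z \<circ> \<tau>) \<phi> = A z (r \<phi>))"
    if "\<tau> permutes {..<N}" for z \<tau>
  proof -
    have inv: "inv_into UNIV \<tau> permutes {..<N}" using that by (rule permutes_inv)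
    have comp: "\<tau> \<circ> \<pi> \<in> G" "inv_into UNIV \<tau> \<circ> \<pi> \<in> G" if "\<pi> \<in> G" for \<pi>
      using that \<open>\<tau> permutes {..<N}\<close> inv by (auto simp: G_def intro: permutes_compose)
    have canc: "\<tau> \<circ> (inv_into UNIV \<tau> \<circ> \<pi>) = \<pi>" "inv_into UNIV \<tau> \<circ> (\<tau> \<circ> \<pi>) = \<pi>" for \<pi>
      using permutes_inv_o[OF that] by (simp_all add: o_assoc)
    define r where "r = (\<lambda>\<phi>. \<lambda>\<pi>\<in>G. (\<phi> :: (nat \<Rightarrow> nat) \<Rightarrow> nat) (inv_into UNIV \<tau> \<circ> \<pi>))"
    have "bij_betw r \<Phi> \<Phi>"
      by (rule bij_betwI[where g = "\<lambda>\<phi>. \<lambda>\<pi>\<in>G. \<phi> (\<tau> \<circ> \<pi>)"])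
         (auto simp: r_def \<Phi>_def comp canc restrict_def PiE_def extensional_def fun_eq_iff)
    moreover have "B (z \<circ> \<tau>) \<phi> = B z (r \<phi>)" for \<phi>
      unfolding B_def
      by (rule prod.reindex_bij_witness[of _ "\<lambda>\<pi>. inv_into UNIV \<tau> \<circ> \<pi>" "\<lambda>\<pi>. \<tau> \<circ> \<pi>"])
         (auto simp: r_def comp canc)
    moreover have "A (z \<circ> \<tau>) \<phi> = A z (r \<phi>)" for \<phi>
      unfolding A_def
      by (rule sum.reindex_bij_witness[of _ "\<lambda>\<pi>. inv_into UNIV \<tau> \<circ> \<pi>" "\<lambda>\<pi>. \<tau> \<circ> \<pi>"])
         (auto simp: r_def comp canc)
    ultimately show ?thesis by blast
  qed

  have A_fun: "(\<lambda>z. A z \<phi>) \<in> int_poly_funs N" if "\<phi> \<in> \<Phi>" for \<phi>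
    unfolding A_def
    by (rule int_poly_funs_sum, rule int_poly_funs_var) (simp add: GN s \<Phi>n that)
  have B_fun: "(\<lambda>z. B z \<phi>) \<in> int_poly_funs N" if "\<phi> \<in> \<Phi>" for \<phi>
    unfolding B_def
    by (rule int_poly_funs_prod[OF finG], rule int_poly_funs_var) (simp add: GN t \<Phi>n that)

  have integral: "fact N * (\<Sum>\<phi>\<in>\<Phi>. B y \<phi> * A y \<phi> ^ k) \<in> \<int>" for k
  proof (rule symmetric_value_Ints[OF _ power_sums])
    show "(\<lambda>z. \<Sum>\<phi>\<in>\<Phi>. B z \<phi> * A z \<phi> ^ k) \<in> int_poly_funs N"
      by (rule int_poly_funs_sum, rule int_poly_funs_mult[OF B_fun int_poly_funs_power[OF A_fun]])
    fix \<tau> assume "\<tau> permutes {..<N}"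
    from sym[OF this, of y] obtain r where r: "bij_betw r \<Phi> \<Phi>"
      "\<And>\<phi>. \<phi> \<in> \<Phi> \<Longrightarrow> B (y \<circ> \<tau>) \<phi> = B y (r \<phi>) \<and> A (y \<circ> \<tau>) \<phi> = A y (r \<phi>)" by blast
    show "(\<Sum>\<phi>\<in>\<Phi>. B (y \<circ> \<tau>) \<phi> * A (y \<circ> \<tau>) \<phi> ^ k) = (\<Sum>\<phi>\<in>\<Phi>. B y \<phi> * A y \<phi> ^ k)"
      by (subst sum.reindex_bij_betw[OF r(1), symmetric]) (auto intro!: sum.cong simp: r(2))
  qed

  \<comment> \<open>Its roots are all exponents and its coefficients are symmetric, so
    \<open>fact N\<close> times it is the integer polynomial that \<open>hermite_vanishing\<close>
    requires.\<close>
  define P where "P = (\<lambda>z. \<Prod>\<phi>\<in>\<Phi>. [:- A z \<phi>, 1:])"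
  have coeff_P: "fact N * coeff (P y) k \<in> \<int>" for k
  proof (rule symmetric_value_Ints[OF _ power_sums])
    show "(\<lambda>z. coeff (P z) k) \<in> int_poly_funs N"
      unfolding P_def by (rule int_poly_funs_coeff_prod[OF fin\<Phi> A_fun])
    fix \<tau> assume "\<tau> permutes {..<N}"
    from sym[OF this, of y] obtain r where r: "bij_betw r \<Phi> \<Phi>"
      "\<And>\<phi>. \<phi> \<in> \<Phi> \<Longrightarrow> B (y \<circ> \<tau>) \<phi> = B y (r \<phi>) \<and> A (y \<circ> \<tau>) \<phi> = A y (r \<phi>)" by blast
    have "P (y \<circ> \<tau>) = P y"
      unfolding P_def
      by (subst prod.reindex_bij_betw[OF r(1), symmetric]) (auto intro!: prod.cong simp: r(2))
    then show "coeff (P (y \<circ> \<tau>)) k = coeff (P y) k" by simp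
  qed
  then have "coeff (smult (fact N) (P y)) k \<in> \<int>" for k by simp
  then obtain Q where Q: "smult (fact N) (P y) = map_poly of_int Q"
    using int_poly_if_coeffs_Ints by blast
  have "P y \<noteq> 0"
    unfolding P_def using fin\<Phi> by (subst prod_zero_iff) auto
  then have "Q \<noteq> 0" using Q by auto
  have Q_root: "poly (map_poly of_int Q) (A y \<phi>) = 0" if "\<phi> \<in> \<Phi>" for \<phi>
    unfolding Q[symmetric] P_def poly_smult poly_prod
    using that by (intro mult_eq_0_iff[THEN iffD2] disjI2 prod_zero[OF fin\<Phi>]) auto

  have vanish: "(\<Sum>\<phi>\<in>\<Phi>. B y \<phi> * poly f (A y \<phi>)) = 0" for f
    by (rule hermite_vanishing[OF fin\<Phi> D _ relation integral \<open>Q \<noteq> 0\<close> Q_root]) auto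

  obtain u where u: "\<forall>x\<in>(\<lambda>(i, j). y i - y j) ` {(i, j). i < N \<and> j < N \<and> i \<noteq> j}. Re (u * x) \<noteq> 0"
  proof (atomize_elim, rule exists_separating_direction)
    have "{(i, j). i < N \<and> j < N \<and> i \<noteq> j} \<subseteq> {..<N} \<times> {..<N}" by auto
    then show "finite ((\<lambda>(i, j). y i - y j) ` {(i, j). i < N \<and> j < N \<and> i \<noteq> j})"
      by (intro finite_imageI) (rule finite_subset, auto)
    show "0 \<notin> (\<lambda>(i, j). y i - y j) ` {(i, j). i < N \<and> j < N \<and> i \<noteq> j}"
      using inj by (auto simp: inj_on_def)
  qed
  \<comment> \<open>\<open>w\<close> is additive and separates the \<open>y i\<close>, so exponents
    of products can be compared factor by factor.\<close>
  define w where "w = (\<lambda>x. Re (u * x))"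
  have w_inj: "i = j" if "w (y i) = w (y j)" "i < N" "j < N" for i j
    using u that by (force simp: w_def right_diff_distrib)
  have "\<exists>i\<in>{..<n}. \<forall>j\<in>{..<n}. j \<noteq> i \<longrightarrow> w (y (\<pi> (s j))) < w (y (\<pi> (s i)))" if "\<pi> \<in> G" for \<pi>
  proof (rule strict_maximum_exists)
    have "inj \<pi>" using that permutes_inj by (auto simp: G_def)
    show "inj_on (\<lambda>i. w (y (\<pi> (s i)))) {..<n}"
    proof (rule inj_onI)
      fix i j assume ij: "i \<in> {..<n}" "j \<in> {..<n}" "w (y (\<pi> (s i))) = w (y (\<pi> (s j)))"
      then have "\<pi> (s i) = \<pi> (s j)" using w_inj GN[OF that] s(2) by blast
      then show "i = j" using injD[OF \<open>inj \<pi>\<close>] inj_onD[OF s(1)] ij by blast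
    qed
  qed (use n in auto)
  then have "\<forall>\<pi>\<in>G. \<exists>i. i < n \<and> (\<forall>j<n. j \<noteq> i \<longrightarrow> w (y (\<pi> (s j))) < w (y (\<pi> (s i))))"
    by blast
  then obtain m where "\<forall>\<pi>\<in>G. m \<pi> < n \<and> (\<forall>j<n. j \<noteq> m \<pi> \<longrightarrow> w (y (\<pi> (s j))) < w (y (\<pi> (s (m \<pi>)))))"
    by (rule bchoice[THEN exE])
  then have m: "\<And>\<pi>. \<pi> \<in> G \<Longrightarrow> m \<pi> < n"
    "\<And>\<pi> j. \<pi> \<in> G \<Longrightarrow> j < n \<Longrightarrow> j \<noteq> m \<pi> \<Longrightarrow> w (y (\<pi> (s j))) < w (y (\<pi> (s (m \<pi>))))"
    by blast+
  \<comment> \<open>In every conjugate form \<open>\<psi>\<close> takes the summand of largest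
    \<open>w\<close>. Any other choice is nowhere larger and somewhere strictly smaller, so its
    exponent differs.\<close>
  define \<psi> where "\<psi> = restrict m G"
  have \<psi>: "\<psi> \<in> \<Phi>" using m(1) by (auto simp: \<psi>_def \<Phi>_def)
  have A_ne: "A y \<phi> \<noteq> A y \<psi>" if "\<phi> \<in> \<Phi>" "\<phi> \<noteq> \<psi>" for \<phi>
  proof -
    have wA: "w (A y \<phi>) = (\<Sum>\<pi>\<in>G. w (y (\<pi> (s (\<phi> \<pi>)))))" for \<phi>
      by (simp only: A_def w_def sum_distrib_left Re_sum)
    have "\<exists>\<pi>\<in>G. \<phi> \<pi> \<noteq> \<psi> \<pi>"
    proof (rule ccontr)
      assume "\<not> ?thesis"
      then have "\<phi> = \<psi>" using that(1) \<psi> unfolding \<Phi>_def by (intro PiE_ext) auto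
      with that(2) show False by simp
    qed
    then obtain \<pi> where "\<pi> \<in> G" "\<phi> \<pi> \<noteq> \<psi> \<pi>" by blast
    have "w (A y \<phi>) < w (A y \<psi>)"
      unfolding wA
    proof (rule sum_strict_mono_ex1[OF finG])
      show "\<forall>\<pi>\<in>G. w (y (\<pi> (s (\<phi> \<pi>)))) \<le> w (y (\<pi> (s (\<psi> \<pi>))))"
      proof
        fix \<pi> assume "\<pi> \<in> G"
        then show "w (y (\<pi> (s (\<phi> \<pi>)))) \<le> w (y (\<pi> (s (\<psi> \<pi>))))"
          using m(2)[of \<pi> "\<phi> \<pi>"] \<Phi>n[OF that(1)] by (cases "\<phi> \<pi> = m \<pi>") (auto simp: \<psi>_def)
      qed
      show "\<exists>\<pi>\<in>G. w (y (\<pi> (s (\<phi> \<pi>)))) < w (y (\<pi> (s (\<psi> \<pi>))))"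
        using m(2)[of \<pi> "\<phi> \<pi>"] \<Phi>n[OF that(1)] \<open>\<pi> \<in> G\<close> \<open>\<phi> \<pi> \<noteq> \<psi> \<pi>\<close> by (auto simp: \<psi>_def)
    qed
    then show ?thesis by auto
  qed
  define T where "T = (\<Prod>\<phi>\<in>\<Phi> - {\<psi>}. [:- A y \<phi>, 1:])"
  have "(\<Sum>\<phi>\<in>\<Phi>. B y \<phi> * poly T (A y \<phi>)) = (\<Sum>\<phi>\<in>\<Phi>. if \<phi> = \<psi> then B y \<psi> * poly T (A y \<psi>) else 0)"
  proof (rule sum.cong[OF refl])
    fix \<phi> assume "\<phi> \<in> \<Phi>"
    then have "poly T (A y \<phi>) = 0" if "\<phi> \<noteq> \<psi>"
      unfolding T_def poly_prod using that fin\<Phi> by (intro prod_zero) auto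
    then show "B y \<phi> * poly T (A y \<phi>) = (if \<phi> = \<psi> then B y \<psi> * poly T (A y \<psi>) else 0)"
      by auto
  qed
  also have "\<dots> = B y \<psi> * poly T (A y \<psi>)"
    using fin\<Phi> \<psi> by (simp add: sum.delta)
  finally have "B y \<psi> * poly T (A y \<psi>) = 0" using vanish by simp
  moreover have "B y \<psi> \<noteq> 0"
    unfolding B_def using finG y0 GN t \<Phi>n[OF \<psi>] by (subst prod_zero_iff) auto
  moreover have "poly T (A y \<psi>) \<noteq> 0"
    unfolding T_def poly_prod using fin\<Phi> A_ne by (subst prod_zero_iff) force+
  ultimately show False by simp
qed

text \<open>Newton's identities, obtained by comparing the coefficients of \<open>pderiv p\<close> with those of
  the quotients of \<open>p\<close> by its linear factors.\<close>

lemma power_sums_of_roots_Ints: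
  fixes w :: "nat \<Rightarrow> complex" and P :: "int poly" and D :: int
  assumes P: "map_poly of_int P = smult (of_int D) (\<Prod>i<N. [:- w i, 1:])" and "D \<noteq> 0"
  shows "(\<Sum>i<N. (of_int D * w i) ^ n) \<in> \<int>"
proof -
  define p :: "complex poly" where "p = map_poly of_int P"
  define c where "c = coeff P"
  have coeff_p: "coeff p k = of_int (c k)" for k by (simp add: p_def c_def)
  define q where "q = (\<lambda>i. smult (of_int D) (\<Prod>j\<in>{..<N} - {i}. [:- w j, 1:]))"
  define s where "s = (\<lambda>n. \<Sum>i<N. w i ^ n)"
  have pq: "p = [:- w i, 1:] * q i" if "i < N" for i
    unfolding p_def P q_def using that by (subst prod.remove[of _ i]) auto
  have deg_prod: "degree (\<Prod>j\<in>S. [:- w j, 1:]) = card S" if "finite S" for S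
    by (subst degree_prod_eq_sum_degree) auto
  have degp: "degree p = N" unfolding p_def P using deg_prod[of "{..<N}"] \<open>D \<noteq> 0\<close> by simp
  have degq: "degree (q i) = N - 1" if "i < N" for i
    unfolding q_def using deg_prod[of "{..<N} - {i}"] that \<open>D \<noteq> 0\<close> by simp
  have cN: "c N = D"
  proof -
    have "lead_coeff p = of_int D"
      unfolding p_def P by (simp add: lead_coeff_prod)
    then show ?thesis using coeff_p[of N] degp by simp
  qed
  have coeff_rec: "coeff (q i) j = of_int (c (Suc j)) + w i * coeff (q i) (Suc j)" if "i < N" for i j
    using arg_cong[OF pq[OF that], of "\<lambda>p. coeff p (Suc j)"] by (simp add: coeff_p)
  \<comment> \<open>Synthetic division from the leading coefficient downwards. Summed over
    \<open>i\<close>, these coefficients yield Newton's identities for \<open>n < N\<close>.\<close>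
  have coeff_q: "coeff (q i) (N - 1 - n) = (\<Sum>m\<le>n. of_int (c (N - n + m)) * w i ^ m)"
    if "i < N" "n < N" for i n
    using that(2)
  proof (induction n)
    case 0
    have "coeff (q i) N = 0" using degq[OF that(1)] that(1) by (intro coeff_eq_0) auto
    then show ?case using coeff_rec[OF that(1), of "N - 1"] that(1) by simp
  next
    case (Suc n)
    have "coeff (q i) (N - 1 - Suc n) = of_int (c (N - Suc n)) + w i * coeff (q i) (N - 1 - n)"
      using coeff_rec[OF that(1), of "N - 1 - Suc n"] Suc.prems by (simp add: Suc_diff_Suc)
    also have "\<dots> = of_int (c (N - Suc n)) + (\<Sum>m\<le>n. of_int (c (N - Suc n + Suc m)) * w i ^ Suc m)"
      using Suc by (simp add: sum_distrib_left mult_ac Suc_diff_Suc)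
    also have "\<dots> = (\<Sum>m\<le>Suc n. of_int (c (N - Suc n + m)) * w i ^ m)"
      unfolding sum.atMost_Suc_shift by simp
    finally show ?case .
  qed
  have deriv: "pderiv p = (\<Sum>i<N. q i)"
    unfolding p_def P q_def pderiv_smult pderiv_prod smult_sum2 by (simp add: pderiv_pCons)
  have low: "of_int (int (N - n) * c (N - n)) = (\<Sum>m\<le>n. of_int (c (N - n + m)) * s m)" if "n < N" for n
  proof -
    have "of_int (int (N - n) * c (N - n)) = coeff (pderiv p) (N - 1 - n)"
      using that by (simp add: coeff_pderiv coeff_p Suc_diff_Suc)
    also have "\<dots> = (\<Sum>i<N. \<Sum>m\<le>n. of_int (c (N - n + m)) * w i ^ m)"
      unfolding deriv coeff_sum using that coeff_q by (intro sum.cong) auto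
    also have "\<dots> = (\<Sum>m\<le>n. of_int (c (N - n + m)) * s m)"
      unfolding s_def sum_distrib_left by (rule sum.swap)
    finally show ?thesis .
  qed
  have high: "(\<Sum>k\<le>N. of_int (c k) * s (n - N + k)) = 0" if "n \<ge> N" for n
  proof -
    have "(\<Sum>k\<le>N. of_int (c k) * w i ^ (n - N + k)) = 0" if "i < N" for i
    proof -
      have "w i ^ (n - N) * poly p (w i) = 0" using pq[OF that] by simp
      then show ?thesis
        unfolding poly_altdef degp sum_distrib_left coeff_p by (simp add: power_add mult_ac)
    qed
    then have "(\<Sum>i<N. \<Sum>k\<le>N. of_int (c k) * w i ^ (n - N + k)) = 0" by simp
    then show ?thesis
      unfolding s_def sum_distrib_left by (subst sum.swap)
  qed
  have "of_int D ^ n * s n \<in> \<int>"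
  proof (induction n rule: less_induct)
    case (less n)
    show ?case
    proof (cases "n = 0")
      case True
      then show ?thesis by (simp add: s_def)
    next
      case False
      \<comment> \<open>Newton's identity if \<open>n < N\<close>, otherwise the recurrence from
        \<open>p\<close> vanishing at its roots. Either way \<open>s n\<close> carries the factor
        \<open>D\<close>, and \<open>D ^ (n - 1)\<close> more clears the earlier power sums.\<close>
      have "\<exists>z (g :: nat \<Rightarrow> int). of_int D * s n = of_int z - (\<Sum>m<n. of_int (g m) * s m)"
      proof (cases "n < N")
        case True
        have "of_int D * s n = of_int (int (N - n) * c (N - n)) - (\<Sum>m<n. of_int (c (N - n + m)) * s m)"
          using low[OF True] True cN by (simp flip: lessThan_Suc_atMost)
        then show ?thesis
          by (intro exI[of _ "int (N - n) * c (N - n)"] exI[of _ "\<lambda>m. c (N - n + m)"])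
      next
        case False
        have "(\<Sum>k<N. of_int (c k) * s (n - N + k)) = (\<Sum>m<n. of_int (if m \<ge> n - N then c (m - (n - N)) else 0) * s m)"
        proof -
          have "(\<Sum>m<n. of_int (if m \<ge> n - N then c (m - (n - N)) else 0) * s m) =
             (\<Sum>m\<in>{n - N..<n}. of_int (c (m - (n - N))) * s m)"
            by (rule sum.mono_neutral_cong_right) auto
          also have "\<dots> = (\<Sum>k<N. of_int (c k) * s (n - N + k))"
            by (rule sum.reindex_bij_witness[of _ "\<lambda>k. n - N + k" "\<lambda>m. m - (n - N)"])
               (use False in auto)
          finally show ?thesis by simp
        qed
        moreover have "(\<Sum>k<N. of_int (c k) * s (n - N + k)) + of_int D * s n = 0"
          using high[of n] False cN by (simp flip: lessThan_Suc_atMost)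
        ultimately have "of_int D * s n = of_int 0 -
            (\<Sum>m<n. of_int (if m \<ge> n - N then c (m - (n - N)) else 0) * s m)"
          by (simp add: eq_neg_iff_add_eq_0 add.commute)
        then show ?thesis by (intro exI)
      qed
      then obtain z and g :: "nat \<Rightarrow> int" where
        zg: "of_int D * s n = of_int z - (\<Sum>m<n. of_int (g m) * s m)" by blast
      have "of_int D ^ n * s n = of_int D ^ (n - 1) * (of_int D * s n)"
        using False by (cases n) (simp_all add: mult_ac)
      also have "\<dots> = of_int (D ^ (n - 1) * z) - (\<Sum>m<n. of_int (g m * D ^ (n - 1 - m)) * (of_int D ^ m * s m))"
      proof -
        have "of_int D ^ (n - 1) = (of_int D ^ (n - 1 - m) * of_int D ^ m :: complex)" if "m < n" for m
          using that by (simp flip: power_add)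
        then have "(\<Sum>m<n. of_int (g m * D ^ (n - 1 - m)) * (of_int D ^ m * s m)) =
            of_int D ^ (n - 1) * (\<Sum>m<n. of_int (g m) * s m)"
          unfolding sum_distrib_left by (intro sum.cong) (auto simp: mult_ac)
        then show ?thesis by (simp add: zg right_diff_distrib)
      qed
      also have "\<dots> \<in> \<int>"
        by (rule Ints_diff[OF Ints_of_int Ints_sum[OF Ints_mult[OF Ints_of_int less.IH]]]) simp
      finally show ?thesis .
    qed
  qed
  then show ?thesis by (simp add: s_def power_mult_distrib sum_distrib_left)
qed

text \<open>An integer polynomial of least degree vanishing on \<open>S\<close> has only simple nonzero roots, so
  they can serve as the symmetric system required by \<open>linear_form_in_exponentials_nonzero\<close>.\<close>

lemma symmetric_root_system_exists:
  assumes "finite S" "\<And>x. x \<in> S \<Longrightarrow> algebraic x" "0 \<notin> S"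
  shows "\<exists>N (y :: nat \<Rightarrow> complex) (D :: int). D \<noteq> 0 \<and> inj_on y {..<N} \<and> (\<forall>i<N. y i \<noteq> 0) \<and>
    (\<forall>k. (\<Sum>i<N. y i ^ k) \<in> \<int>) \<and> (\<forall>x\<in>S. \<exists>i<N. y i = of_int D * x)"
proof -
  let ?V = "\<lambda>P :: int poly. P \<noteq> 0 \<and> (\<forall>x\<in>S. poly (map_poly of_int P) x = 0)"
  have "\<forall>x\<in>S. \<exists>p. is_defining_poly p x" using assms(2) is_defining_poly_exists by blast
  then obtain f where f: "\<forall>x\<in>S. is_defining_poly (f x) x" by (rule bchoice[THEN exE])
  have "?V (\<Prod>x\<in>S. f x)"
  proof (intro conjI ballI)
    show "prod f S \<noteq> 0"
      using f \<open>finite S\<close> by (subst prod_zero_iff) (auto simp: is_defining_poly_def)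
    fix x assume "x \<in> S"
    then have "prod f S = f x * prod f (S - {x})" using \<open>finite S\<close> by (rule prod.remove[rotated])
    then show "poly (map_poly of_int (prod f S)) x = 0"
      using f \<open>x \<in> S\<close> by (simp add: of_int_poly_hom.hom_mult is_defining_poly_def)
  qed
  then obtain P where P: "?V P" and min: "\<And>q. ?V q \<Longrightarrow> degree P \<le> degree q"
    using arg_min_natI[of ?V "prod f S" degree] arg_min_nat_le[of ?V _ degree] by blast
  define p :: "complex poly" where "p = map_poly of_int P"
  have p0: "p \<noteq> 0" using P by (simp add: p_def)
  \<comment> \<open>A factor x of \<open>P\<close> could be cancelled, as
    \<open>0 \<notin> S\<close>, contradicting minimality.\<close>
  have zero: "poly p 0 \<noteq> 0"
  proof
    assume "poly p 0 = 0"
    then have "coeff P 0 = 0" by (simp add: p_def poly_0_coeff_0)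
    then obtain g where g: "P = pCons 0 g" by (cases P) auto
    have "?V g"
      using P \<open>0 \<notin> S\<close> by (auto simp: g of_int_hom.map_poly_pCons_hom)
    then have "degree P \<le> degree g" by (rule min)
    then show False using P by (simp add: g degree_pCons_eq_if split: if_splits)
  qed
  \<comment> \<open>At a multiple root \<open>z\<close> the defining polynomial of \<open>z\<close>
    divides \<open>P\<close> twice; dropping one copy keeps every root and lowers the
    degree.\<close>
  have simple: "poly (pderiv p) z \<noteq> 0" if z: "poly p z = 0" for z
  proof
    assume z': "poly (pderiv p) z = 0"
    have "algebraic z" using z P by (intro algebraic_if_int_poly_root[of P]) (auto simp: p_def)
    then obtain r where r: "is_defining_poly r z" using is_defining_poly_exists by blast
    obtain g where g: "P = r * g" using is_defining_poly_dvd[OF r, of P] z by (auto simp: p_def)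
    have "degree (pderiv r) < degree r"
      using is_defining_poly_degree_pos[OF r] by (simp add: degree_pderiv)
    moreover have "pderiv r \<noteq> 0" using is_defining_poly_degree_pos[OF r] by (simp add: pderiv_eq_0_iff)
    ultimately have "poly (map_poly of_int (pderiv r)) z \<noteq> 0"
      using r by (auto simp: is_defining_poly_def)
    moreover have "pderiv p = map_poly of_int (pderiv r) * map_poly of_int g + map_poly of_int r * map_poly of_int (pderiv g)"
      by (simp add: p_def g pderiv_mult of_int_hom.map_poly_pderiv of_int_poly_hom.hom_mult mult.commute)
    ultimately have "poly (map_poly of_int g) z = 0"
      using z' r by (simp add: is_defining_poly_def)
    then obtain h where h: "g = r * h" using is_defining_poly_dvd[OF r, of g] by auto
    have "?V g"
    proof (intro conjI ballI)
      show "g \<noteq> 0" using P g by auto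
      fix x assume "x \<in> S"
      then have "poly (map_poly of_int (r * (r * h))) x = 0" using P g h by simp
      then show "poly (map_poly of_int g) x = 0" by (simp add: h of_int_poly_hom.hom_mult)
    qed
    then have "degree P \<le> degree g" by (rule min)
    moreover have "r \<noteq> 0" "g \<noteq> 0" using P g by auto
    ultimately show False
      using is_defining_poly_degree_pos[OF r] by (simp add: g degree_mult_eq)
  qed
  have "rsquarefree p" using simple by (auto simp: rsquarefree_roots)
  then have decomp: "smult (lead_coeff p) (\<Prod>z|poly p z = 0. [:- z, 1:]) = p"
    by (rule complex_poly_decompose_rsquarefree)
  define D where "D = lead_coeff P"
  have D: "lead_coeff p = of_int D" "D \<noteq> 0" using P by (simp_all add: p_def D_def)
  have "finite {z. poly p z = 0}" using p0 by (rule poly_roots_finite)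
  then obtain w N where w: "bij_betw w {..<N::nat} {z. poly p z = 0}"
    using ex_bij_betw_nat_finite[of "{z. poly p z = 0}"] by (auto simp: atLeast0LessThan)
  have eq: "map_poly of_int P = smult (of_int D) (\<Prod>i<N. [:- w i, 1:])"
    using decomp unfolding D(1) prod.reindex_bij_betw[OF w, symmetric] by (simp add: p_def)
  have w0: "w i \<noteq> 0" if "i < N" for i
  proof -
    have "poly p (w i) = 0" using bij_betwE[OF w] that by simp
    then show ?thesis using zero by auto
  qed
  \<comment> \<open>The system consists of the roots times the leading coefficient \<open>D\<close>,
    which makes their power sums integers.\<close>
  show ?thesis
  proof (intro exI conjI)
    show "D \<noteq> 0" by fact
    show "inj_on (\<lambda>i. of_int D * w i) {..<N}"
      using bij_betw_imp_inj_on[OF w] D(2) by (auto simp: inj_on_def)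
    show "\<forall>i<N. of_int D * w i \<noteq> 0" using w0 D(2) by simp
    show "\<forall>k. (\<Sum>i<N. (of_int D * w i) ^ k) \<in> \<int>"
      using power_sums_of_roots_Ints[OF eq D(2)] by blast
    show "\<forall>x\<in>S. \<exists>i<N. of_int D * w i = of_int D * x"
    proof
      fix x assume "x \<in> S"
      then have "x \<in> w ` {..<N}" using P bij_betw_imp_surj_on[OF w] by (auto simp: p_def)
      then show "\<exists>i<N. of_int D * w i = of_int D * x" by auto
    qed
  qed
qed

lemma algebraic_add_of_int:
  fixes x :: complex
  assumes "algebraic x"
  shows "algebraic (x + of_int c)"
proof -
  obtain p where p: "is_defining_poly p x" using is_defining_poly_exists[OF assms] by blast
  let ?q = "pcompose p [:- c, 1:]"
  have "poly (map_poly of_int ?q) (x + of_int c) = 0"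
    using p by (simp add: of_int_hom.map_poly_pcompose poly_pcompose is_defining_poly_def of_int_hom.map_poly_pCons_hom)
  moreover have "?q \<noteq> 0" using p by (simp add: pcompose_eq_0_iff is_defining_poly_def)
  ultimately show ?thesis by (rule algebraic_if_int_poly_root)
qed

text \<open>Exponents and coefficients go into one set \<open>S\<close>, so that a single symmetric
  system serves both. It must consist of nonzero numbers, hence the shift of all exponents by an
  integer \<open>c\<close>, which only multiplies the sum by \<open>exp c\<close>.\<close>

theorem lindemann_weierstrass:
  fixes b :: "complex \<Rightarrow> complex"
  assumes "finite A" "A \<noteq> {}" and A: "\<And>a. a \<in> A \<Longrightarrow> algebraic a"
    and b: "\<And>a. a \<in> A \<Longrightarrow> algebraic (b a)" "\<And>a. a \<in> A \<Longrightarrow> b a \<noteq> 0"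
  shows "(\<Sum>a\<in>A. b a * exp a) \<noteq> 0"
proof -
  have "infinite (range (of_int :: int \<Rightarrow> complex))"
    using finite_imageD[of of_int UNIV] infinite_UNIV_int by (auto simp: inj_def)
  then have "\<not> range (of_int :: int \<Rightarrow> complex) \<subseteq> uminus ` A"
    using \<open>finite A\<close> finite_subset by blast
  then obtain c :: int where "of_int c \<notin> uminus ` A" by blast
  then have c: "a + of_int c \<noteq> 0" if "a \<in> A" for a
    using that by (metis add_eq_0_iff2 add.commute image_eqI)
  define S where "S = (\<lambda>a. a + of_int c) ` A \<union> b ` A"
  have "finite S" "0 \<notin> S" and alg: "\<And>x. x \<in> S \<Longrightarrow> algebraic x"
    using assms c by (force simp: S_def algebraic_add_of_int)+
  obtain N and y :: "nat \<Rightarrow> complex" and D :: int where D: "D \<noteq> 0" and y: "inj_on y {..<N}" "\<And>i. i < N \<Longrightarrow> y i \<noteq> 0"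
    "\<And>k. (\<Sum>i<N. y i ^ k) \<in> \<int>" and yS: "\<forall>x\<in>S. \<exists>i<N. y i = of_int D * x"
    using symmetric_root_system_exists[OF \<open>finite S\<close> alg \<open>0 \<notin> S\<close>] by blast
  obtain e where e: "bij_betw e {..<card A} A"
    using ex_bij_betw_nat_finite[OF \<open>finite A\<close>] by (auto simp: atLeast0LessThan)
  have eA: "e i \<in> A" if "i < card A" for i using bij_betwE[OF e] that by auto
  have "\<forall>i\<in>{..<card A}. \<exists>k. k < N \<and> y k = of_int D * (e i + of_int c)"
    using yS eA by (auto simp: S_def)
  then obtain s where s: "\<forall>i\<in>{..<card A}. s i < N \<and> y (s i) = of_int D * (e i + of_int c)"
    by (rule bchoice[THEN exE])
  have "\<forall>i\<in>{..<card A}. \<exists>k. k < N \<and> y k = of_int D * b (e i)"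
    using yS eA by (auto simp: S_def)
  then obtain t where t: "\<forall>i\<in>{..<card A}. t i < N \<and> y (t i) = of_int D * b (e i)"
    by (rule bchoice[THEN exE])
  have "inj_on s {..<card A}"
  proof (rule inj_onI)
    fix i j assume ij: "i \<in> {..<card A}" "j \<in> {..<card A}" "s i = s j"
    then have "of_int D * (e i + of_int c) = of_int D * (e j + of_int c)" using s by metis
    then have "e i = e j" using D by simp
    then show "i = j" using ij bij_betw_imp_inj_on[OF e] by (simp add: inj_on_eq_iff)
  qed
  then have "(\<Sum>i<card A. y (t i) * exp (y (s i) / of_int D)) \<noteq> 0"
    using assms(1,2) s t by (intro linear_form_in_exponentials_nonzero[OF y(1,2,3) D]) auto
  also have "(\<Sum>i<card A. y (t i) * exp (y (s i) / of_int D)) =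
      (\<Sum>i<card A. of_int D * exp (of_int c) * (b (e i) * exp (e i)))"
    using s t D by (intro sum.cong) (simp_all add: exp_add)
  also have "\<dots> = of_int D * exp (of_int c) * (\<Sum>a\<in>A. b a * exp a)"
    unfolding sum.reindex_bij_betw[OF e, symmetric] sum_distrib_left ..
  finally show ?thesis by auto
qed

section \<open>Many algebraic numbers of bounded degree and height\<close>

lemma card_multiples_le:
  assumes "c > 0"
  shows "card {x \<in> {1..n}. c dvd x} \<le> n div (c :: nat)"
proof -
  have "card {x \<in> {1..n}. c dvd x} = card ((\<lambda>x. x div c) ` {x \<in> {1..n}. c dvd x})"
    by (rule card_image[symmetric]) (auto simp: inj_on_def dvd_def)
  also have "\<dots> \<le> card {1..n div c}"
  proof (rule card_mono)
    show "(\<lambda>x. x div c) ` {x \<in> {1..n}. c dvd x} \<subseteq> {1..n div c}"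
    proof clarsimp
      fix x assume "Suc 0 \<le> x" "x \<le> n" "c dvd x"
      then show "Suc 0 \<le> x div c \<and> x div c \<le> n div c"
        using assms dvd_imp_le[of c x] by (simp add: div_le_mono Suc_le_eq div_greater_zero_iff)
    qed
  qed simp
  finally show ?thesis by simp
qed

lemma real_card_multiples_le:
  assumes "c > 0" "S \<subseteq> {1..n}"
  shows "real (card {x \<in> S. c dvd x}) \<le> real n / real (c :: nat)"
proof -
  have "card {x \<in> S. c dvd x} \<le> card {x \<in> {1..n}. c dvd x}"
    using assms(2) by (intro card_mono) auto
  also have "\<dots> \<le> n div c" using assms(1) by (rule card_multiples_le)
  finally have "real (card {x \<in> S. c dvd x}) \<le> real (n div c)" by simp
  then show ?thesis using of_nat_div_le_of_nat[of n c, where 'a = real] by linarith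
qed

text \<open>1/c^3 is at most 1/((c-1) c (c+1)), which telescopes; from c = 3 on the total is
  1/(2*2*3).\<close>

lemma sum_inverse_cubes_le: "(\<Sum>c=3..m. 1 / real c ^ 3) \<le> 1 / 12"
proof (cases "m \<ge> 2")
  case True
  then have "(\<Sum>c=3..m. 1 / real c ^ 3) \<le> 1 / 12 - 1 / (2 * real m * (real m + 1))"
  proof (induction m rule: dec_induct)
    case (step m)
    define x where "x = real m"
    have x: "x > 0" using step by (simp add: x_def)
    have "x * (x + 1) * (x + 2) \<le> (x + 1) ^ 3"
      using x by (simp add: power3_eq_cube algebra_simps)
    then have "1 / (x + 1) ^ 3 \<le> 1 / (x * (x + 1) * (x + 2))"
      using x by (intro frac_le mult_pos_pos) auto
    also have "\<dots> = 1 / (2 * x * (x + 1)) - 1 / (2 * (x + 1) * (x + 2))"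
    proof -
      define u where "u = 1 / (x * (x + 1) * (x + 2))"
      have nz: "2 * x * (x + 1) \<noteq> 0" "2 * (x + 1) * (x + 2) \<noteq> 0" "2 * (x * (x + 1) * (x + 2)) \<noteq> 0"
        using x by auto
      have "1 / (2 * x * (x + 1)) = (x + 2) / (2 * (x * (x + 1) * (x + 2)))"
        unfolding frac_eq_eq[OF nz(1,3)] by (simp add: algebra_simps)
      moreover have "1 / (2 * (x + 1) * (x + 2)) = x / (2 * (x * (x + 1) * (x + 2)))"
        unfolding frac_eq_eq[OF nz(2,3)] by (simp add: algebra_simps)
      ultimately have e: "1 / (2 * x * (x + 1)) = (x + 2) / 2 * u" "1 / (2 * (x + 1) * (x + 2)) = x / 2 * u"
        by (simp_all only: u_def times_divide_times_eq mult_1_right)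
      have "(x + 2) / 2 * u - x / 2 * u = u"
        unfolding left_diff_distrib[symmetric] diff_divide_distrib[symmetric] by simp
      then show ?thesis unfolding e u_def[symmetric] by (rule sym)
    qed
    finally have "1 / (x + 1) ^ 3 \<le> 1 / (2 * x * (x + 1)) - 1 / (2 * (x + 1) * (x + 2))" .
    moreover have "(\<Sum>c=3..Suc m. 1 / real c ^ 3) = (\<Sum>c=3..m. 1 / real c ^ 3) + 1 / (x + 1) ^ 3"
      using step by (simp add: x_def add.commute)
    moreover have "1 / (2 * real (Suc m) * (real (Suc m) + 1)) = 1 / (2 * (x + 1) * (x + 2))"
      by (simp add: x_def add.commute)
    ultimately show ?case
      using step.IH unfolding x_def[symmetric] by linarith
  qed simp
  also have "\<dots> \<le> 1 / 12" by simp
  finally show ?thesis .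
qed simp

lemma prod_list_gt_1:
  fixes xs :: "real list"
  assumes "xs \<noteq> []" "\<And>x. x \<in> set xs \<Longrightarrow> x > 1"
  shows "prod_list xs > 1"
  using assms
proof (induction xs)
  case (Cons x xs)
  then show ?case
    by (cases "xs = []") (auto intro!: less_1_mult)
qed simp

text \<open>The moduli of the roots multiply to the quotient of constant and leading coefficient,
  which is at most 1 in modulus.\<close>

lemma root_in_unit_disc_exists:
  fixes p :: "complex poly"
  assumes "degree p > 0" "norm (coeff p 0) \<le> norm (lead_coeff p)"
  shows "\<exists>z. poly p z = 0 \<and> norm z \<le> 1"
proof (rule ccontr)
  assume no: "\<not> ?thesis"
  obtain as where as: "smult (lead_coeff p) (\<Prod>a\<leftarrow>as. [:- a, 1:]) = p" "length as = degree p"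
    using fundamental_theorem_algebra_factorized[of p] by blast
  have root: "poly p a = 0" if "a \<in> set as" for a
    by (subst as(1)[symmetric]) (use that in \<open>auto simp: poly_prod_list prod_list_zero_iff\<close>)
  have "poly p 0 = lead_coeff p * (\<Prod>a\<leftarrow>as. - a)"
    by (subst as(1)[symmetric]) (simp add: poly_prod_list o_def)
  then have "norm (coeff p 0) = norm (lead_coeff p) * prod_list (map norm as)"
    by (simp add: poly_0_coeff_0 norm_mult)
  moreover have "prod_list (map norm as) > 1"
    using as(2) assms(1) no root by (intro prod_list_gt_1) (auto simp: not_le)
  moreover have "norm (lead_coeff p) > 0" using assms(1) by auto
  ultimately show False using assms(2) by (simp add: mult_le_cancel_left1)
qed

lemma mahler_measure_le_max_coeff:
  fixes f :: "int poly"
  assumes "degree f \<le> d" "\<And>i. \<bar>real_of_int (coeff f i)\<bar> \<le> b"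
  shows "mahler_measure f \<le> sqrt (real d + 1) * b"
proof -
  have b: "b \<ge> 0" using assms(2)[of 0] by linarith
  have "(\<Sum>a\<leftarrow>coeffs (map_poly of_int f :: complex poly). (cmod a)\<^sup>2) =
      (\<Sum>c\<leftarrow>coeffs f. (real_of_int c)\<^sup>2)"
    by (simp add: o_def)
  also have "\<dots> \<le> (\<Sum>c\<leftarrow>coeffs f. b\<^sup>2)"
  proof (rule sum_list_mono)
    fix c assume "c \<in> set (coeffs f)"
    then have "c \<in> range (coeff f)" using range_coeff[of f] by blast
    then obtain i where "c = coeff f i" by blast
    then have "\<bar>real_of_int c\<bar> \<le> \<bar>b\<bar>" using assms(2)[of i] by simp
    then show "(real_of_int c)\<^sup>2 \<le> b\<^sup>2" by (simp add: abs_le_square_iff)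
  qed
  also have "\<dots> = real (length (coeffs f)) * b\<^sup>2"
    by (simp add: sum_list_triv)
  also have "\<dots> \<le> (real d + 1) * b\<^sup>2"
    using assms(1) by (intro mult_right_mono) (cases "f = 0"; simp add: length_coeffs_degree)+
  finally have "(\<Sum>a\<leftarrow>coeffs (map_poly of_int f :: complex poly). (cmod a)\<^sup>2) \<le> (real d + 1) * b\<^sup>2" .
  then have "l2norm_complex (map_poly of_int f) \<le> sqrt ((real d + 1) * b\<^sup>2)"
    by (rule real_sqrt_le_mono)
  also have "\<dots> = sqrt (real d + 1) * b" using b by (simp add: real_sqrt_mult)
  finally show ?thesis
    using Landau_inequality[of "map_poly of_int f"] by (simp add: mahler_measure_def)
qed

text \<open>The residues are those of Eisenstein's criterion at 2: leading coefficient odd, constant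
  term 2 modulo 4, the others even. The constant term stays below \<open>4 * Y\<close>, the leading
  one ranges up to \<open>16 * Y\<close>, so few choices violate the condition for a root in the
  unit disc.\<close>

definition coeff_choices :: "nat \<Rightarrow> nat \<Rightarrow> nat \<Rightarrow> nat set" where
  "coeff_choices d Y i =
     (if i = d then (\<lambda>u. 2 * u + 1) ` {..<8 * Y}
      else if i = 0 then (\<lambda>u. 2 * (2 * u + 1)) ` {..<Y}
      else (\<lambda>u. 2 * (u + 1)) ` {..<8 * Y})"

definition choice_poly :: "nat \<Rightarrow> (nat \<Rightarrow> nat) \<Rightarrow> int poly" where
  "choice_poly d a = (\<Sum>i\<le>d. monom (int (a i)) i)"

lemma coeff_choice_poly: "coeff (choice_poly d a) i = (if i \<le> d then int (a i) else 0)"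
  by (simp add: choice_poly_def coeff_sum)

lemma finite_coeff_choices: "finite (coeff_choices d Y i)"
  by (simp add: coeff_choices_def)

lemma card_coeff_choices:
  "card (coeff_choices d Y i) = (if i = d then 8 * Y else if i = 0 then Y else 8 * Y)"
  by (auto simp: coeff_choices_def card_image inj_on_def)

lemma card_Pi_coeff_choices:
  assumes "d \<ge> 1"
  shows "card (Pi\<^sub>E {..d} (coeff_choices d Y)) = 8 ^ d * Y ^ (d + 1)"
proof -
  have "card (Pi\<^sub>E {..d} (coeff_choices d Y)) = (\<Prod>i\<le>d. if i = 0 then Y else 8 * Y)"
    unfolding card_PiE[OF finite_atMost] card_coeff_choices using assms by (intro prod.cong) auto
  also have "\<dots> = Y * (8 * Y) ^ d"
    by (simp add: prod.atMost_shift)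
  finally show ?thesis by (simp add: power_mult_distrib)
qed

text \<open>Halving even numbers keeps divisibility by odd \<open>c\<close>. The middle coefficients
  then fill an interval; at both ends odd numbers are counted among all integers of an interval
  twice as long, hence the 2.\<close>

lemma card_coeff_choices_multiples_le:
  assumes "odd c" "d \<ge> 1"
  shows "real (card {x \<in> coeff_choices d Y i. c dvd x})
    \<le> (if i = d \<or> i = 0 then 2 else 1) / real c * real (card (coeff_choices d Y i))"
proof -
  have c: "c > 0" using assms(1) by (rule odd_pos)
  have halve: "c dvd 2 * x \<longleftrightarrow> c dvd x" for x
    using assms(1) by (simp add: coprime_dvd_mult_right_iff coprime_right_2_iff_odd)
  consider "i = d" | "i = 0" "i \<noteq> d" | "i \<noteq> 0" "i \<noteq> d" by blast
  then show ?thesis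
  proof cases
    case 1
    have "coeff_choices d Y i \<subseteq> {1..16 * Y}" by (auto simp: coeff_choices_def 1)
    from real_card_multiples_le[OF c this] show ?thesis by (simp add: 1 card_coeff_choices)
  next
    case 2
    have "coeff_choices d Y i = (*) 2 ` (\<lambda>u. 2 * u + 1) ` {..<Y}"
      using 2 by (simp add: coeff_choices_def image_image)
    then have "card {x \<in> coeff_choices d Y i. c dvd x} = card ((*) 2 ` {x \<in> (\<lambda>u. 2 * u + 1) ` {..<Y}. c dvd x})"
      by (intro arg_cong[of _ _ card]) (auto simp only: halve)
    also have "\<dots> = card {x \<in> (\<lambda>u. 2 * u + 1) ` {..<Y}. c dvd x}"
      by (rule card_image) (simp add: inj_on_def)
    finally have eq: "card {x \<in> coeff_choices d Y i. c dvd x} = card {x \<in> (\<lambda>u. 2 * u + 1) ` {..<Y}. c dvd x}" .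
    have "(\<lambda>u. 2 * u + 1) ` {..<Y} \<subseteq> {1..2 * Y}" by auto
    from real_card_multiples_le[OF c this] show ?thesis
      unfolding eq using 2 by (simp add: card_coeff_choices)
  next
    case 3
    have "coeff_choices d Y i = (*) 2 ` (\<lambda>u. u + 1) ` {..<8 * Y}"
      using 3 by (simp add: coeff_choices_def image_image)
    then have "card {x \<in> coeff_choices d Y i. c dvd x} = card ((*) 2 ` {x \<in> (\<lambda>u. u + 1) ` {..<8 * Y}. c dvd x})"
      by (intro arg_cong[of _ _ card]) (auto simp only: halve)
    also have "\<dots> = card {x \<in> (\<lambda>u. u + 1) ` {..<8 * Y}. c dvd x}"
      by (rule card_image) (simp add: inj_on_def)
    finally have eq: "card {x \<in> coeff_choices d Y i. c dvd x} = card {x \<in> (\<lambda>u. u + 1) ` {..<8 * Y}. c dvd x}" .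
    have "(\<lambda>u. u + 1) ` {..<8 * Y} \<subseteq> {1..8 * Y}" by auto
    from real_card_multiples_le[OF c this] show ?thesis
      unfolding eq using 3 by (simp add: card_coeff_choices)
  qed
qed

text \<open>The two ends contribute 2 * 2, and there are at least three coefficients; the cube makes
  the sum over \<open>c\<close> small.\<close>

lemma card_common_divisor_choices_le:
  assumes "odd c" "d \<ge> 2"
  shows "real (card (Pi\<^sub>E {..d} (\<lambda>i. {x \<in> coeff_choices d Y i. c dvd x})))
    \<le> 4 / real c ^ 3 * real (card (Pi\<^sub>E {..d} (coeff_choices d Y)))"
proof -
  have c: "real c \<ge> 1" using odd_pos[OF assms(1)] by simp
  let ?r = "\<lambda>i. if i = d \<or> i = 0 then 2 else (1 :: real)"
  have "real (card (Pi\<^sub>E {..d} (\<lambda>i. {x \<in> coeff_choices d Y i. c dvd x}))) =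
      (\<Prod>i\<le>d. real (card {x \<in> coeff_choices d Y i. c dvd x}))"
    by (simp add: card_PiE)
  also have "\<dots> \<le> (\<Prod>i\<le>d. ?r i / real c * real (card (coeff_choices d Y i)))"
    using card_coeff_choices_multiples_le[OF assms(1)] assms(2) by (intro prod_mono) auto
  also have "\<dots> = (\<Prod>i\<le>d. ?r i) / real c ^ (d + 1) * real (card (Pi\<^sub>E {..d} (coeff_choices d Y)))"
    unfolding prod.distrib prod_dividef card_PiE[OF finite_atMost] of_nat_prod prod_constant card_atMost
    by simp
  also have "(\<Prod>i\<le>d. ?r i) = (\<Prod>i\<in>{0, d}. 2)"
    by (rule prod.mono_neutral_cong_right) auto
  also have "\<dots> = 4" using assms(2) by simp
  also have "4 / real c ^ (d + 1) * real (card (Pi\<^sub>E {..d} (coeff_choices d Y)))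
      \<le> 4 / real c ^ 3 * real (card (Pi\<^sub>E {..d} (coeff_choices d Y)))"
  proof -
    have "real c ^ 3 \<le> real c ^ (d + 1)" using c assms(2) by (intro power_increasing) auto
    then have "4 / real c ^ (d + 1) \<le> 4 / real c ^ 3" using c by (intro frac_le) auto
    then show ?thesis by (rule mult_right_mono) simp
  qed
  finally show ?thesis .
qed

definition good_choices :: "nat \<Rightarrow> nat \<Rightarrow> (nat \<Rightarrow> nat) set" where
  "good_choices d Y = {a \<in> Pi\<^sub>E {..d} (coeff_choices d Y). content (choice_poly d a) = 1 \<and> a 0 \<le> a d}"

lemma choice_bounds:
  assumes "a \<in> Pi\<^sub>E {..d} (coeff_choices d Y)" "i \<le> d"
  shows "1 \<le> a i" "a i \<le> 16 * Y" "odd (a i) \<longleftrightarrow> i = d"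
  using PiE_mem[OF assms(1), of i] assms(2) by (auto simp: coeff_choices_def split: if_splits)

text \<open>5/12 = 1 - 1/3 - 1/4. A nontrivial content is odd, hence at least 3, which costs 4 *
  1/12; \<open>a 0 > a d\<close> needs a leading coefficient in the lowest quarter of its
  range.\<close>

lemma card_good_choices_ge:
  assumes "d \<ge> 2"
  shows "5 / 12 * 8 ^ d * real Y ^ (d + 1) \<le> real (card (good_choices d Y))"
proof -
  define Box where "Box = Pi\<^sub>E {..d} (coeff_choices d Y)"
  have finBox: "finite Box"
    unfolding Box_def by (intro finite_PiE) (auto simp: finite_coeff_choices)
  define C where "C = {c \<in> {3..16 * Y}. odd c}"
  define Bad1 where "Bad1 = (\<Union>c\<in>C. Pi\<^sub>E {..d} (\<lambda>i. {x \<in> coeff_choices d Y i. c dvd x}))"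
  define Bad2 where "Bad2 = Pi\<^sub>E {..d} (\<lambda>i. if i = d then (\<lambda>u. 2 * u + 1) ` {..<2 * Y} else coeff_choices d Y i)"
  have sub: "Box \<subseteq> good_choices d Y \<union> Bad1 \<union> Bad2"
  proof
    fix a assume a: "a \<in> Box"
    note bounds = choice_bounds[OF a[unfolded Box_def]]
    show "a \<in> good_choices d Y \<union> Bad1 \<union> Bad2"
    proof (cases "a 0 \<le> a d")
      case False
      note mem = PiE_mem[OF a[unfolded Box_def]]
      obtain u where u: "a d = 2 * u + 1"
        using mem[of d] by (auto simp: coeff_choices_def)
      obtain v where v: "a 0 = 2 * (2 * v + 1)" "v < Y"
        using mem[of 0] assms by (auto simp: coeff_choices_def)
      have "u < 2 * Y" using False v(2) unfolding u v(1) by arith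
      then have ad: "a d \<in> (\<lambda>u. 2 * u + 1) ` {..<2 * Y}" using u by blast
      have "a \<in> Bad2"
        unfolding Bad2_def
      proof (rule PiE_I)
        show "a i \<in> (if i = d then (\<lambda>u. 2 * u + 1) ` {..<2 * Y} else coeff_choices d Y i)"
          if "i \<in> {..d}" for i
          using ad mem[OF that] by (cases "i = d") simp_all
        show "a i = undefined" if "i \<notin> {..d}" for i
          using a that unfolding Box_def by (rule PiE_arb)
      qed
      then show ?thesis by simp
    next
      case True
      show ?thesis
      proof (cases "content (choice_poly d a) = 1")
        case True
        then show ?thesis using a \<open>a 0 \<le> a d\<close> by (simp add: good_choices_def Box_def)
      next
        case False
        define c where "c = nat (content (choice_poly d a))"
        have "content (choice_poly d a) \<ge> 0"
        proof -
          define k where "k = content (choice_poly d a)"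
          have "normalize k = k" unfolding k_def by (rule normalize_content)
          then show ?thesis unfolding k_def[symmetric] by simp
        qed
        then have cd: "int c = content (choice_poly d a)" by (simp add: c_def)
        have dvd: "c dvd a i" if "i \<le> d" for i
        proof -
          have "int c dvd coeff (choice_poly d a) i" unfolding cd by (rule content_dvd_coeff)
          then show ?thesis using that by (simp add: coeff_choice_poly)
        qed
        have "odd c" using dvd_trans[OF _ dvd[of d], of 2] bounds(3)[of d] by auto
        moreover have "c \<le> 16 * Y" using dvd_imp_le[OF dvd[of d]] bounds(1,2)[of d] by linarith
        moreover have "c \<noteq> 1" using False cd by auto
        moreover have "c \<ge> 3"
        proof -
          obtain k where "c = 2 * k + 1" using \<open>odd c\<close> by (rule oddE)
          then show ?thesis using \<open>c \<noteq> 1\<close> by simp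
        qed
        ultimately have "c \<in> C" by (simp add: C_def)
        moreover have "a \<in> Pi\<^sub>E {..d} (\<lambda>i. {x \<in> coeff_choices d Y i. c dvd x})"
          using a dvd unfolding Box_def PiE_iff by blast
        ultimately show ?thesis unfolding Bad1_def by blast
      qed
    qed
  qed
  have "real (card Bad1) \<le> (\<Sum>c\<in>C. real (card (Pi\<^sub>E {..d} (\<lambda>i. {x \<in> coeff_choices d Y i. c dvd x}))))"
  proof -
    have "card Bad1 \<le> (\<Sum>c\<in>C. card (Pi\<^sub>E {..d} (\<lambda>i. {x \<in> coeff_choices d Y i. c dvd x})))"
      unfolding Bad1_def by (rule card_UN_le) (simp add: C_def)
    then show ?thesis by (simp only: of_nat_sum[symmetric] of_nat_le_iff)
  qed
  also have "\<dots> \<le> (\<Sum>c\<in>C. 4 / real c ^ 3 * real (card Box))"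
    unfolding Box_def using assms by (intro sum_mono card_common_divisor_choices_le) (auto simp: C_def)
  also have "\<dots> \<le> (\<Sum>c=3..16 * Y. 4 / real c ^ 3 * real (card Box))"
    by (rule sum_mono2) (auto simp: C_def)
  also have "\<dots> = 4 * real (card Box) * (\<Sum>c=3..16 * Y. 1 / real c ^ 3)"
    by (simp add: sum_distrib_left mult.commute)
  also have "\<dots> \<le> 4 * real (card Box) * (1 / 12)"
    by (intro mult_left_mono sum_inverse_cubes_le) auto
  finally have bad1: "real (card Bad1) \<le> real (card Box) / 3" by simp
  have "4 * card Bad2 = card Box"
  proof -
    have "card Bad2 = card ((\<lambda>u. 2 * u + 1) ` {..<2 * Y}) * (\<Prod>i\<in>{..d} - {d}. card (coeff_choices d Y i))"
      unfolding Bad2_def card_PiE[OF finite_atMost] by (subst prod.remove[of _ d]) auto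
    also have "card ((\<lambda>u. 2 * u + 1) ` {..<2 * Y}) = 2 * Y"
      by (simp add: card_image inj_on_def)
    finally have "4 * card Bad2 = card (coeff_choices d Y d) * (\<Prod>i\<in>{..d} - {d}. card (coeff_choices d Y i))"
      by (simp add: card_coeff_choices)
    also have "\<dots> = card Box"
      unfolding Box_def card_PiE[OF finite_atMost] by (subst prod.remove[of "{..d}" d]) auto
    finally show ?thesis .
  qed
  then have bad2: "real (card Bad2) = real (card Box) / 4" by linarith
  have fin: "finite (good_choices d Y \<union> Bad1 \<union> Bad2)"
  proof (intro finite_UnI)
    show "finite (good_choices d Y)"
      using finBox by (simp add: good_choices_def Box_def)
    show "finite Bad1"
      unfolding Bad1_def C_def by (intro finite_UN_I finite_PiE) (auto simp: finite_coeff_choices)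
    show "finite Bad2"
      unfolding Bad2_def by (intro finite_PiE) (auto simp: finite_coeff_choices)
  qed
  have "card Box \<le> card (good_choices d Y \<union> Bad1 \<union> Bad2)"
    using fin sub by (rule card_mono)
  also have "\<dots> \<le> card (good_choices d Y) + card Bad1 + card Bad2"
    using card_Un_le[of "good_choices d Y \<union> Bad1" Bad2] card_Un_le[of "good_choices d Y" Bad1] by linarith
  finally have "real (card Box) \<le> real (card (good_choices d Y)) + real (card Bad1) + real (card Bad2)"
    by linarith
  then have "5 / 12 * real (card Box) \<le> real (card (good_choices d Y))"
    using bad1 bad2 by linarith
  moreover have "real (card Box) = 8 ^ d * real Y ^ (d + 1)"
    unfolding Box_def using assms by (subst card_Pi_coeff_choices) auto
  ultimately show ?thesis by simp
qed

text \<open>Distinct choices have distinct roots, since defining polynomials agree up to sign and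
  the leading coefficients are positive. The degree is exactly \<open>d\<close>, so Landau's bound
  for coefficients up to \<open>16 * Y\<close> may reach \<open>exp (d * h)\<close>.\<close>

lemma many_algebraic_numbers:
  assumes d: "d \<ge> 2" and Y: "sqrt (real d + 1) * (16 * real Y) \<le> exp (real d * h)"
  shows "\<exists>S. finite S \<and> 5 / 12 * 8 ^ d * real Y ^ (d + 1) \<le> real (card S) \<and>
    (\<forall>\<alpha>\<in>S. algebraic \<alpha> \<and> alg_degree \<alpha> \<le> d \<and> weil_height \<alpha> \<le> h \<and> cmod \<alpha> \<le> 1)"
proof -
  let ?G = "good_choices d Y"
  have ex: "\<exists>\<alpha>. is_defining_poly (choice_poly d a) \<alpha> \<and> cmod \<alpha> \<le> 1" if a: "a \<in> ?G" for a
  proof -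
    let ?f = "choice_poly d a"
    have box: "a \<in> Pi\<^sub>E {..d} (coeff_choices d Y)" and cont: "content ?f = 1" and le: "a 0 \<le> a d"
      using a by (auto simp: good_choices_def)
    note bounds = choice_bounds[OF box]
    have deg: "degree ?f = d"
    proof (rule antisym)
      show "degree ?f \<le> d" by (rule degree_le) (simp add: coeff_choice_poly)
      show "d \<le> degree ?f" using bounds(1)[of d] by (intro le_degree) (simp add: coeff_choice_poly)
    qed
    obtain \<alpha> where \<alpha>: "poly (map_poly of_int ?f) \<alpha> = 0" "cmod \<alpha> \<le> 1"
      using root_in_unit_disc_exists[of "map_poly of_int ?f"] d le
      by (auto simp: deg coeff_choice_poly)
    have a0: "\<not> 4 dvd a 0"
    proof -
      obtain v where "a 0 = 2 * (2 * v + 1)"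
        using PiE_mem[OF box, of 0] d by (auto simp: coeff_choices_def)
      then show ?thesis by presburger
    qed
    have "is_defining_poly ?f \<alpha>"
    proof (rule eisenstein_is_defining_poly[OF _ _ _ _ cont \<alpha>(1)])
      show "odd (lead_coeff ?f)" using bounds(3)[of d] by (simp add: deg coeff_choice_poly)
      show "even (coeff ?f i)" if "i < degree ?f" for i
        using bounds(3)[of i] that by (simp add: deg coeff_choice_poly)
      show "\<not> 4 dvd coeff ?f 0"
        using a0 by (simp add: coeff_choice_poly) presburger
      show "degree ?f > 0" using d deg by simp
    qed
    with \<alpha>(2) show ?thesis by blast
  qed
  then obtain \<alpha> where \<alpha>: "\<And>a. a \<in> ?G \<Longrightarrow> is_defining_poly (choice_poly d a) (\<alpha> a)"
    "\<And>a. a \<in> ?G \<Longrightarrow> cmod (\<alpha> a) \<le> 1"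
    by (metis (no_types))
  have deg: "degree (choice_poly d a) = d" if "a \<in> ?G" for a
  proof (rule antisym)
    show "degree (choice_poly d a) \<le> d" by (rule degree_le) (simp add: coeff_choice_poly)
    show "d \<le> degree (choice_poly d a)"
      using choice_bounds(1)[of a d Y d] that
      by (intro le_degree) (simp add: coeff_choice_poly good_choices_def)
  qed
  have inj: "inj_on \<alpha> ?G"
  proof (rule inj_onI)
    fix a b assume ab: "a \<in> ?G" "b \<in> ?G" "\<alpha> a = \<alpha> b"
    have box: "a \<in> Pi\<^sub>E {..d} (coeff_choices d Y)" "b \<in> Pi\<^sub>E {..d} (coeff_choices d Y)"
      using ab by (auto simp: good_choices_def)
    have "choice_poly d a = choice_poly d b \<or> choice_poly d a = - choice_poly d b"
      using is_defining_poly_unique \<alpha>(1) ab by metis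
    moreover have "coeff (choice_poly d a) d > 0" "coeff (choice_poly d b) d > 0"
      using choice_bounds(1)[OF box(1), of d] choice_bounds(1)[OF box(2), of d]
      by (simp_all add: coeff_choice_poly)
    ultimately have eq: "choice_poly d a = choice_poly d b" by auto
    show "a = b"
    proof (rule PiE_ext[OF box])
      fix i assume "i \<in> {..d}"
      then show "a i = b i"
        using arg_cong[OF eq, of "\<lambda>p. coeff p i"] by (simp add: coeff_choice_poly)
    qed
  qed
  have fin: "finite ?G"
  proof (rule finite_subset)
    show "?G \<subseteq> Pi\<^sub>E {..d} (coeff_choices d Y)" by (auto simp: good_choices_def)
  qed (intro finite_PiE, auto simp: finite_coeff_choices)
  have height: "weil_height (\<alpha> a) \<le> h" if a: "a \<in> ?G" for a
  proof -
    let ?f = "choice_poly d a"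
    have f0: "?f \<noteq> 0" using deg[OF a] d by auto
    have "mahler_measure ?f \<le> sqrt (real d + 1) * (16 * real Y)"
    proof (rule mahler_measure_le_max_coeff)
      show "\<bar>real_of_int (coeff ?f i)\<bar> \<le> 16 * real Y" for i
        using choice_bounds(2)[of a d Y i] a by (auto simp: coeff_choice_poly good_choices_def)
    qed (simp add: deg[OF a])
    also note Y
    finally have "ln (mahler_measure ?f) \<le> ln (exp (real d * h))"
      using mahler_measure_pos[OF f0] by (subst ln_le_cancel_iff) auto
    then have "ln (mahler_measure ?f) \<le> real d * h" by simp
    then show ?thesis
      using d unfolding weil_height_eq[OF \<alpha>(1)[OF a]] deg[OF a] by (simp add: divide_le_eq mult.commute)
  qed
  show ?thesis
  proof (intro exI[of _ "\<alpha> ` ?G"] conjI ballI)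
    show "finite (\<alpha> ` ?G)" using fin by simp
    show "5 / 12 * 8 ^ d * real Y ^ (d + 1) \<le> real (card (\<alpha> ` ?G))"
      using card_good_choices_ge[OF d] by (simp add: card_image[OF inj])
    fix x assume "x \<in> \<alpha> ` ?G"
    then obtain a where a: "a \<in> ?G" and x: "x = \<alpha> a" by blast
    have "choice_poly d a \<noteq> 0" using deg[OF a] d by auto
    then show "algebraic x"
      unfolding x using \<alpha>(1)[OF a] by (intro algebraic_if_int_poly_root) (auto simp: is_defining_poly_def)
    show "alg_degree x \<le> d" unfolding x alg_degree_eq[OF \<alpha>(1)[OF a]] by (simp add: deg[OF a])
    show "weil_height x \<le> h" unfolding x by (rule height[OF a])
    show "cmod x \<le> 1" unfolding x by (rule \<alpha>(2)[OF a])
  qed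
qed

section \<open>Many coefficients with differences of bounded height\<close>

text \<open>All conjugates of y/q lie in the unit disc, so the Mahler measure is just the leading
  coefficient; it divides a power of \<open>q\<close> up to sign because \<open>y\<close> is an
  algebraic integer.\<close>

lemma weil_height_le_if_conjugates_bounded:
  fixes G :: "int poly" and y :: complex and q :: nat
  assumes G: "lead_coeff G = 1" "poly (map_poly of_int G) y = 0" and q: "q \<ge> 1"
    and roots: "\<And>z. poly (map_poly of_int G) z = 0 \<Longrightarrow> cmod z \<le> real q"
  shows "algebraic (y / of_nat q)" "alg_degree (y / of_nat q) \<le> degree G"
    "weil_height (y / of_nat q) \<le> ln (real q)"
proof -
  have G0: "G \<noteq> 0" using G(1) by auto
  have qC: "(of_nat q :: complex) \<noteq> 0" using q by simp
  obtain r where r: "is_defining_poly r y"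
    using is_defining_poly_exists[OF algebraic_if_int_poly_root[OF G(2) G0]] by blast
  obtain r' where r': "G = r * r'" using is_defining_poly_dvd[OF r G(2)] by (elim dvdE)
  have lead_r: "\<bar>lead_coeff r\<bar> = 1"
  proof -
    have "lead_coeff r * lead_coeff r' = 1" using G(1) unfolding r' lead_coeff_mult .
    then have "lead_coeff r dvd 1" by (metis dvd_triv_left)
    then show ?thesis by simp
  qed
  have r0: "r \<noteq> 0" "r' \<noteq> 0" using r' G0 by auto
  define P where "P = pcompose r [:0, int q:]"
  have P_poly: "poly (map_poly of_int P) x = poly (map_poly of_int r) (of_nat q * x)" for x :: complex
    by (simp add: P_def of_int_hom.map_poly_pcompose poly_pcompose of_int_hom.map_poly_pCons_hom mult.commute)
  have degP: "degree P = degree r" using q by (simp add: P_def degree_pcompose)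
  have leadP: "lead_coeff P = lead_coeff r * int q ^ degree r"
  proof -
    have "lead_coeff (pcompose r [:0, int q:]) = lead_coeff r * lead_coeff [:0, int q:] ^ degree r"
      using q by (intro lead_coeff_comp) simp
    then show ?thesis unfolding P_def using q by (simp only:) simp
  qed
  have P0: "P \<noteq> 0" using leadP r0 q by auto
  have root_P: "poly (map_poly of_int P) (y / of_nat q) = 0"
    using r qC by (simp add: P_poly is_defining_poly_def)
  show "algebraic (y / of_nat q)" by (rule algebraic_if_int_poly_root[OF root_P P0])
  then obtain p where p: "is_defining_poly p (y / of_nat q)" using is_defining_poly_exists by blast
  have p0: "p \<noteq> 0" using p by (simp add: is_defining_poly_def)
  define k where "k = degree p"
  obtain p' where p': "P = p * p'" using is_defining_poly_dvd[OF p root_P] by (elim dvdE)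
  have "k \<le> degree P" using p root_P P0 by (simp add: k_def is_defining_poly_def)
  then have k1: "k \<le> degree r" by (simp add: degP)
  \<comment> \<open>Rescaling \<open>p\<close> to q^k p(x/q) gives an integer polynomial vanishing
    at \<open>y\<close>. Equality of the two degrees matters: the power of \<open>q\<close> must
    match the \<open>k\<close> that divides the logarithm.\<close>
  have k2: "degree r \<le> k"
  proof -
    define R where "R = (\<Sum>i\<le>k. monom (coeff p i * int q ^ (k - i)) i)"
    have coeff_R: "coeff R i = (if i \<le> k then coeff p i * int q ^ (k - i) else 0)" for i
      by (simp add: R_def coeff_sum)
    have "coeff R k \<noteq> 0" using p0 by (simp add: coeff_R k_def)
    then have R0: "R \<noteq> 0" by auto
    have degR: "degree R \<le> k" by (rule degree_le) (simp add: coeff_R)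
    have "poly (map_poly of_int R) y = (\<Sum>i\<le>k. of_int (coeff p i) * of_nat q ^ (k - i) * y ^ i)"
    proof -
      have "poly (map_poly of_int R) y = (\<Sum>i\<le>k. of_int (coeff R i) * y ^ i)"
        unfolding poly_altdef of_int_hom.degree_map_poly_hom of_int_hom.coeff_map_poly_hom
        using degR by (intro sum.mono_neutral_cong_left) (auto intro: coeff_eq_0)
      then show ?thesis by (simp add: coeff_R)
    qed
    also have "\<dots> = of_nat q ^ k * (\<Sum>i\<le>k. of_int (coeff p i) * (y / of_nat q) ^ i)"
      unfolding sum_distrib_left
    proof (rule sum.cong[OF refl])
      fix i assume "i \<in> {..k}"
      then have "(of_nat q :: complex) ^ k = of_nat q ^ (k - i) * of_nat q ^ i"
        by (simp flip: power_add)
      then show "of_int (coeff p i) * of_nat q ^ (k - i) * y ^ i =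
        (of_nat q :: complex) ^ k * (of_int (coeff p i) * (y / of_nat q) ^ i)"
        using qC by (simp add: power_divide)
    qed
    also have "(\<Sum>i\<le>k. of_int (coeff p i) * (y / of_nat q) ^ i) = poly (map_poly of_int p) (y / of_nat q)"
      unfolding poly_altdef k_def by simp
    also have "\<dots> = 0" using p by (simp add: is_defining_poly_def)
    finally have "poly (map_poly of_int R) y = 0" by simp
    then have "degree r \<le> degree R" using r R0 by (simp add: is_defining_poly_def)
    with degR show ?thesis by simp
  qed
  have "degree r \<le> degree G" using r0 by (simp add: r' degree_mult_eq)
  then show "alg_degree (y / of_nat q) \<le> degree G"
    using k1 unfolding alg_degree_eq[OF p] k_def by simp
  have root_le: "cmod z \<le> 1" if "poly (map_poly of_int p) z = 0" for z
  proof -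
    have "poly (map_poly of_int P) z = 0" using that by (simp add: p' of_int_poly_hom.hom_mult)
    then have "poly (map_poly of_int G) (of_nat q * z) = 0"
      by (simp add: P_poly r' of_int_poly_hom.hom_mult)
    from roots[OF this] have "real q * cmod z \<le> real q * 1" by (simp add: norm_mult)
    then show ?thesis using q by (simp only: mult_le_cancel_left_pos of_nat_0_less_iff)
  qed
  have "(\<Prod>z\<in>#proots (map_poly of_int p :: complex poly). max 1 (cmod z)) = (\<Prod>z\<in>#proots (map_poly of_int p :: complex poly). 1)"
  proof (rule arg_cong[where f = prod_mset], rule image_mset_cong)
    fix z assume "z \<in># proots (map_poly of_int p :: complex poly)"
    then have "poly (map_poly of_int p) z = 0" using p0 by (simp add: set_count_proots)
    then show "max 1 (cmod z) = 1" using root_le by simp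
  qed
  then have mahler: "mahler_measure p = \<bar>real_of_int (lead_coeff p)\<bar>"
    using p0 by (simp add: mahler_measure_eq_proots)
  have "lead_coeff p dvd lead_coeff P" unfolding p' lead_coeff_mult by simp
  then have "\<bar>lead_coeff p\<bar> \<le> \<bar>lead_coeff P\<bar>" using P0 by (intro dvd_imp_le_int) auto
  also have "\<bar>lead_coeff P\<bar> = int q ^ k" using lead_r k1 k2 by (simp add: leadP abs_mult)
  finally have "real_of_int \<bar>lead_coeff p\<bar> \<le> real_of_int (int q ^ k)" by (simp only: of_int_le_iff)
  then have "mahler_measure p \<le> real q ^ k" by (simp add: mahler)
  then have "ln (mahler_measure p) \<le> ln (real q ^ k)"
    using mahler_measure_pos[OF p0] q by (subst ln_le_cancel_iff) auto
  then have "ln (mahler_measure p) \<le> real k * ln (real q)" using q by (simp add: ln_realpow)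
  moreover have "k > 0" using is_defining_poly_degree_pos[OF p] by (simp add: k_def)
  ultimately show "weil_height (y / of_nat q) \<le> ln (real q)"
    unfolding weil_height_eq[OF p] k_def[symmetric] by (simp add: divide_le_eq mult.commute)
qed

text \<open>Read the eigenvector equation in a row where the eigenvector has an entry of largest
  modulus.\<close>

lemma eigenvalue_norm_le:
  fixes M :: "complex mat"
  assumes M: "M \<in> carrier_mat n n" and ev: "eigenvalue M z"
    and row: "\<And>i. i < n \<Longrightarrow> (\<Sum>j<n. cmod (M $$ (i, j))) \<le> b"
  shows "cmod z \<le> b"
proof -
  obtain v where v: "v \<in> carrier_vec n" "v \<noteq> 0\<^sub>v n" "M *\<^sub>v v = z \<cdot>\<^sub>v v"
    using ev M by (auto simp: eigenvalue_def eigenvector_def)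
  have n: "n > 0" using eigenvalue_imp_nonzero_dim[OF M ev] .
  define m where "m = Max ((\<lambda>i. cmod (v $ i)) ` {..<n})"
  have "m \<in> (\<lambda>i. cmod (v $ i)) ` {..<n}" unfolding m_def using n by (intro Max_in) auto
  then obtain i where i: "i < n" "m = cmod (v $ i)" by auto
  have le: "cmod (v $ j) \<le> m" if "j < n" for j
    unfolding m_def using that by (intro Max_ge) auto
  have "m > 0"
  proof (rule ccontr)
    assume "\<not> m > 0"
    then have "v $ j = 0" if "j < n" for j
      using order.trans[OF le[OF that], of 0] by simp
    then have "v = 0\<^sub>v n" using v(1) by (intro eq_vecI) auto
    with v(2) show False by simp
  qed
  have "z * v $ i = (M *\<^sub>v v) $ i" using v i by simp
  also have "\<dots> = (\<Sum>j<n. M $$ (i, j) * v $ j)"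
    using M v(1) i by (simp add: scalar_prod_def atLeast0LessThan)
  finally have "cmod z * m = cmod (\<Sum>j<n. M $$ (i, j) * v $ j)"
    using i by (simp flip: norm_mult)
  also have "\<dots> \<le> (\<Sum>j<n. cmod (M $$ (i, j)) * m)"
    by (rule sum_norm_le) (simp add: norm_mult mult_left_mono le)
  also have "\<dots> \<le> b * m"
    unfolding sum_distrib_right[symmetric] using row[OF i(1)] \<open>m > 0\<close> by (intro mult_right_mono) auto
  finally show ?thesis using \<open>m > 0\<close> by (simp only: mult_le_cancel_right_pos)
qed

text \<open>Multiplication by \<open>\<Sum>i<d. c i * \<theta> ^ i\<close> on the basis \<open>1, \<theta>, \<dots>, \<theta> ^ (d - 1)\<close> of
  \<open>\<rat>(\<theta>)\<close>, where \<open>\<theta> ^ d = 2\<close>.\<close>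

definition mult_matrix :: "nat \<Rightarrow> (nat \<Rightarrow> int) \<Rightarrow> int mat" where
  "mult_matrix d c = mat d d (\<lambda>(i, j). if i \<le> j then c (j - i) else 2 * c (d + j - i))"

text \<open>The eigenvector is (1, \<theta>, ..., \<theta>^(d-1)); entries below the diagonal get a
  2 from \<theta>^d = 2 when the exponent wraps around.\<close>

lemma combination_is_eigenvalue:
  fixes \<theta> :: complex
  assumes d: "d \<ge> 1" and \<theta>: "\<theta> ^ d = 2"
  shows "eigenvalue (map_mat of_int (mult_matrix d c)) (\<Sum>i<d. of_int (c i) * \<theta> ^ i)"
proof -
  define v where "v = vec d (\<lambda>i. \<theta> ^ i)"
  define M where "M = (map_mat of_int (mult_matrix d c) :: complex mat)"
  have M: "M \<in> carrier_mat d d" by (simp add: M_def mult_matrix_def)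
  have "v $ 0 \<noteq> 0\<^sub>v d $ 0" using d by (simp add: v_def)
  then have v0: "v \<noteq> 0\<^sub>v d" by metis
  have "M *\<^sub>v v = (\<Sum>i<d. of_int (c i) * \<theta> ^ i) \<cdot>\<^sub>v v"
  proof (rule eq_vecI)
    fix i assume "i < dim_vec ((\<Sum>i<d. of_int (c i) * \<theta> ^ i) \<cdot>\<^sub>v v)"
    then have i: "i < d" by (simp add: v_def)
    have "(M *\<^sub>v v) $ i = (\<Sum>j<d. M $$ (i, j) * \<theta> ^ j)"
      using M i by (simp add: v_def scalar_prod_def atLeast0LessThan)
    also have "\<dots> = (\<Sum>j\<in>{i..<d}. of_int (c (j - i)) * \<theta> ^ j) + (\<Sum>j<i. of_int (2 * c (d + j - i)) * \<theta> ^ j)"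
    proof -
      have "(\<Sum>j<d. M $$ (i, j) * \<theta> ^ j) = (\<Sum>j\<in>{i..<d}. M $$ (i, j) * \<theta> ^ j) + (\<Sum>j<i. M $$ (i, j) * \<theta> ^ j)"
        using i by (subst sum.union_disjoint[symmetric]) (auto intro!: sum.cong)
      then show ?thesis using i by (simp add: M_def mult_matrix_def)
    qed
    also have "(\<Sum>j\<in>{i..<d}. of_int (c (j - i)) * \<theta> ^ j) = (\<Sum>k<d - i. of_int (c k) * \<theta> ^ (k + i))"
      by (rule sum.reindex_bij_witness[of _ "\<lambda>k. k + i" "\<lambda>j. j - i"]) auto
    also have "(\<Sum>j<i. of_int (2 * c (d + j - i)) * \<theta> ^ j) = (\<Sum>k\<in>{d - i..<d}. of_int (c k) * \<theta> ^ (k + i))"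
    proof (rule sum.reindex_bij_witness[of _ "\<lambda>k. k + i - d" "\<lambda>j. d + j - i"])
      fix j assume j: "j \<in> {..<i}"
      then have "d + j - i + i = d + j" using i by simp
      then show "of_int (c (d + j - i)) * \<theta> ^ (d + j - i + i) = of_int (2 * c (d + j - i)) * \<theta> ^ j"
        by (simp add: power_add \<theta>)
    qed (use i in auto)
    also have "(\<Sum>k<d - i. of_int (c k) * \<theta> ^ (k + i)) + (\<Sum>k\<in>{d - i..<d}. of_int (c k) * \<theta> ^ (k + i)) =
        (\<Sum>k<d. of_int (c k) * \<theta> ^ (k + i))"
      by (subst sum.union_disjoint[symmetric]) (auto intro!: sum.cong)
    also have "\<dots> = ((\<Sum>i<d. of_int (c i) * \<theta> ^ i) \<cdot>\<^sub>v v) $ i"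
      using i by (simp add: v_def power_add sum_distrib_right mult.assoc)
    finally show "(M *\<^sub>v v) $ i = ((\<Sum>i<d. of_int (c i) * \<theta> ^ i) \<cdot>\<^sub>v v) $ i" .
  qed (simp add: v_def M_def mult_matrix_def)
  then show ?thesis
    using v0 M unfolding M_def[symmetric] eigenvalue_def eigenvector_def
    by (intro exI[of _ v]) (simp add: v_def)
qed

text \<open>The characteristic polynomial is monic and integral, and \<open>2 * d * W\<close> bounds
  every absolute row sum, hence all conjugates at once.\<close>

lemma small_combination:
  fixes \<theta> :: complex and q W :: nat
  assumes d: "d \<ge> 1" and \<theta>: "\<theta> ^ d = 2" and q: "q \<ge> 1" "2 * d * W \<le> q"
    and c: "\<And>i. i < d \<Longrightarrow> \<bar>c i\<bar> \<le> int W"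
  defines "\<beta> \<equiv> (\<Sum>i<d. of_int (c i) * \<theta> ^ i) / of_nat q"
  shows "algebraic \<beta>" "alg_degree \<beta> \<le> d" "weil_height \<beta> \<le> ln (real q)" "cmod \<beta> \<le> 1"
proof -
  let ?M = "mult_matrix d c" and ?y = "\<Sum>i<d. of_int (c i) * \<theta> ^ i"
  have M: "?M \<in> carrier_mat d d" by (simp add: mult_matrix_def)
  have MC: "map_mat of_int ?M \<in> carrier_mat d d" for c
    by (simp add: mult_matrix_def)
  have G: "map_poly of_int (char_poly ?M) = char_poly (map_mat of_int ?M :: complex mat)"
    by (rule of_int_hom.char_poly_hom[OF M, symmetric])
  have deg: "degree (char_poly ?M) = d" "lead_coeff (char_poly ?M) = 1"
    using degree_monic_char_poly[OF M] by auto
  have row: "(\<Sum>j<d. cmod (map_mat of_int ?M $$ (i, j))) \<le> real q" if i: "i < d" for i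
  proof -
    have "(\<Sum>j<d. cmod (map_mat of_int ?M $$ (i, j))) \<le> (\<Sum>j<d. 2 * real W)"
    proof (rule sum_mono)
      fix j assume "j \<in> {..<d}"
      then have "\<bar>?M $$ (i, j)\<bar> \<le> 2 * int W"
      proof (cases "i \<le> j")
        case True
        then have "\<bar>c (j - i)\<bar> \<le> int W" using \<open>j \<in> {..<d}\<close> by (intro c) auto
        then show ?thesis using True i \<open>j \<in> {..<d}\<close> by (simp add: mult_matrix_def)
      next
        case False
        then have "\<bar>c (d + j - i)\<bar> \<le> int W" using i by (intro c) auto
        then show ?thesis using False i \<open>j \<in> {..<d}\<close> by (simp add: mult_matrix_def abs_mult)
      qed
      then have "real_of_int \<bar>?M $$ (i, j)\<bar> \<le> real_of_int (2 * int W)" by (simp only: of_int_le_iff)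
      then show "cmod (map_mat of_int ?M $$ (i, j)) \<le> 2 * real W"
        using i \<open>j \<in> {..<d}\<close> M by simp
    qed
    also have "\<dots> = real (2 * d * W)" by simp
    also have "\<dots> \<le> real q" using q(2) by (simp only: of_nat_le_iff)
    finally show ?thesis .
  qed
  have root: "poly (map_poly of_int (char_poly ?M)) z = 0 \<longleftrightarrow> eigenvalue (map_mat of_int ?M) z" for z :: complex
    unfolding G by (rule eigenvalue_root_char_poly[OF MC, symmetric])
  have y: "poly (map_poly of_int (char_poly ?M)) ?y = 0"
    unfolding root by (rule combination_is_eigenvalue[OF d \<theta>])
  have bound: "cmod z \<le> real q" if "poly (map_poly of_int (char_poly ?M)) z = 0" for z :: complex
    using that unfolding root by (rule eigenvalue_norm_le[OF MC _ row])
  note * = weil_height_le_if_conjugates_bounded[OF deg(2) y q(1) bound]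
  show "algebraic \<beta>" "alg_degree \<beta> \<le> d" "weil_height \<beta> \<le> ln (real q)"
    using * deg(1) by (simp_all add: \<beta>_def)
  show "cmod \<beta> \<le> 1" using bound[OF y] q(1) by (simp add: \<beta>_def norm_divide)
qed

text \<open>x^d - 2 satisfies Eisenstein's criterion at 2, so no nonzero integer polynomial of
  smaller degree vanishes at \<open>\<theta>\<close>.\<close>

lemma powers_of_root_independent:
  fixes \<theta> :: complex
  assumes d: "d \<ge> 1" and \<theta>: "\<theta> ^ d = 2" and zero: "(\<Sum>i<d. of_int (c i) * \<theta> ^ i) = 0" and i: "i < d"
  shows "c i = 0"
proof -
  define f :: "int poly" where "f = monom 1 d - [:2:]"
  have coeff_f: "coeff f j = (if j = d then 1 else if j = 0 then -2 else 0)" for j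
    using d by (auto simp: f_def coeff_pCons split: nat.split)
  have degf: "degree f = d"
  proof (rule antisym)
    show "degree f \<le> d" by (rule degree_le) (simp add: coeff_f)
    show "d \<le> degree f" by (rule le_degree) (simp add: coeff_f)
  qed
  define g where "g = (\<Sum>i<d. monom (c i) i)"
  have coeff_g: "coeff g j = (if j < d then c j else 0)" for j
    by (simp add: g_def coeff_sum)
  have f: "poly (map_poly of_int f) \<theta> = 0"
    using \<theta> by (simp add: f_def of_int_poly_hom.hom_minus of_int_hom.map_poly_pCons_hom poly_monom)
  have g: "poly (map_poly of_int g) \<theta> = 0"
    using zero by (simp add: g_def of_int_poly_hom.hom_sum poly_sum poly_monom)
  have "g = 0"
  proof (rule ccontr)
    assume "g \<noteq> 0"
    have "degree f \<le> degree g"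
      by (rule eisenstein_degree[OF _ _ _ _ f g \<open>g \<noteq> 0\<close>]) (use d in \<open>auto simp: degf coeff_f\<close>)
    moreover have "degree g < d"
      using \<open>g \<noteq> 0\<close> by (metis coeff_g leading_coeff_0_iff)
    ultimately show False using degf by simp
  qed
  then show ?thesis using coeff_g[of i] i by simp
qed

text \<open>Numerators between 1 and \<open>W\<close> have differences of modulus at most
  \<open>W\<close>, also against 0. The 0 is included because an exponent may occur in only one of
  the two sums to be subtracted.\<close>

lemma many_coefficients:
  fixes q W :: nat
  assumes d: "d \<ge> 1" and q: "q \<ge> 1" "2 * d * W \<le> q"
  shows "\<exists>T. finite T \<and> card T = W ^ d \<and> (\<forall>\<beta>\<in>T. \<beta> \<noteq> 0 \<and> cmod \<beta> \<le> 1) \<and>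
    (\<forall>\<beta>\<in>insert 0 T. \<forall>\<gamma>\<in>insert 0 T. algebraic (\<beta> - \<gamma>) \<and> alg_degree (\<beta> - \<gamma>) \<le> d \<and>
      weil_height (\<beta> - \<gamma>) \<le> ln (real q))"
proof -
  define \<theta> :: complex where "\<theta> = of_real (root d 2)"
  have \<theta>: "\<theta> ^ d = 2"
    using d by (simp add: \<theta>_def flip: of_real_power)
  define val where "val = (\<lambda>c. (\<Sum>i<d. of_int (c i) * \<theta> ^ i) / of_nat q)"
  define C where "C = Pi\<^sub>E {..<d} (\<lambda>_. {1..int W})"
  have C: "1 \<le> c i" "c i \<le> int W" if "c \<in> C" "i < d" for c i
    using that by (auto simp: C_def PiE_iff)
  have diff: "val b - val c = val (\<lambda>i. b i - c i)" for b c
    by (simp add: val_def sum_subtractf left_diff_distrib diff_divide_distrib)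
  have val0: "c i = 0" if "val c = 0" "i < d" for c i
  proof -
    have "(\<Sum>i<d. of_int (c i) * \<theta> ^ i) = 0" using that(1) q(1) by (simp add: val_def)
    then show ?thesis using powers_of_root_independent[OF d \<theta>] that(2) by blast
  qed
  have inj: "inj_on val C"
  proof (rule inj_onI)
    fix b c assume bc: "b \<in> C" "c \<in> C" "val b = val c"
    have "b i = c i" if "i < d" for i
      using val0[of "\<lambda>i. b i - c i" i] diff[of b c] bc(3) that by simp
    then show "b = c" using bc(1,2) unfolding C_def by (intro PiE_ext) auto
  qed
  have "finite C" by (simp add: C_def finite_PiE)
  show ?thesis
  proof (intro exI[of _ "val ` C"] conjI ballI)
    show "finite (val ` C)" using \<open>finite C\<close> by simp
    have "card (val ` C) = card C" by (rule card_image[OF inj])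
    also have "\<dots> = W ^ d" by (simp add: C_def card_PiE)
    finally show "card (val ` C) = W ^ d" .
  next
    fix \<beta> assume "\<beta> \<in> val ` C"
    then obtain c where c: "c \<in> C" "\<beta> = val c" by blast
    show "\<beta> \<noteq> 0" using val0[of c 0] C(1)[OF c(1), of 0] d c(2) by auto
    show "cmod \<beta> \<le> 1"
      unfolding c(2) val_def using C[OF c(1)] by (intro small_combination(4)[OF d \<theta> q]) fastforce
  next
    fix \<beta> \<gamma> assume "\<beta> \<in> insert 0 (val ` C)" "\<gamma> \<in> insert 0 (val ` C)"
    moreover have "\<exists>c. \<beta> = val c \<and> (\<forall>i<d. 0 \<le> c i \<and> c i \<le> int W)" if "\<beta> \<in> insert 0 (val ` C)" for \<beta>
    proof (cases "\<beta> = 0")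
      case True
      then show ?thesis by (intro exI[of _ "\<lambda>_. 0"]) (simp add: val_def)
    next
      case False
      then obtain c where c: "c \<in> C" "\<beta> = val c" using \<open>\<beta> \<in> insert 0 (val ` C)\<close> by blast
      then show ?thesis using C[OF c(1)] by (intro exI[of _ c]) fastforce
    qed
    ultimately obtain b c where bc: "\<beta> = val b" "\<And>i. i < d \<Longrightarrow> 0 \<le> b i \<and> b i \<le> int W"
      "\<gamma> = val c" "\<And>i. i < d \<Longrightarrow> 0 \<le> c i \<and> c i \<le> int W" by metis
    have eq: "\<beta> - \<gamma> = (\<Sum>i<d. of_int (b i - c i) * \<theta> ^ i) / of_nat q"
      unfolding bc(1,3) diff by (simp only: val_def)
    have le: "\<bar>b i - c i\<bar> \<le> int W" if "i < d" for i using bc(2,4)[OF that] by linarith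
    show "algebraic (\<beta> - \<gamma>)" unfolding eq by (rule small_combination(1)[OF d \<theta> q le])
    show "alg_degree (\<beta> - \<gamma>) \<le> d" unfolding eq by (rule small_combination(2)[OF d \<theta> q le])
    show "weil_height (\<beta> - \<gamma>) \<le> ln (real q)"
      unfolding eq by (rule small_combination(3)[OF d \<theta> q le])
  qed
qed

section \<open>Pigeonhole\<close>

text \<open>The minimum puts the right endpoint \<open>n\<close> into the last cell instead of a
  cell of its own.\<close>

lemma same_cell_close:
  fixes s t :: real and n :: nat
  assumes "n \<ge> 1" "0 \<le> s" "s \<le> n" "0 \<le> t" "t \<le> n"
    and "min \<lfloor>s\<rfloor> (int n - 1) = min \<lfloor>t\<rfloor> (int n - 1)"
  shows "\<bar>s - t\<bar> \<le> 1"
proof -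
  define k where "k = min \<lfloor>s\<rfloor> (int n - 1)"
  have "of_int k \<le> x \<and> x \<le> of_int k + 1" if "x \<le> n" "k = min \<lfloor>x\<rfloor> (int n - 1)" for x :: real
  proof (cases "\<lfloor>x\<rfloor> \<le> int n - 1")
    case True
    then have "k = \<lfloor>x\<rfloor>" using that(2) by simp
    then show ?thesis by linarith
  next
    case False
    then have "k = int n - 1" "int n \<le> \<lfloor>x\<rfloor>" using that(2) by simp_all
    then show ?thesis using that(1) by linarith
  qed
  from this[of s] this[of t] show ?thesis using assms by (auto simp: k_def)
qed

lemma pigeonhole_in_square:
  fixes f :: "'a \<Rightarrow> complex"
  assumes "finite X" "card X \<ge> 2" "R > 0" and f: "\<And>x. x \<in> X \<Longrightarrow> cmod (f x) \<le> R"
  shows "\<exists>x\<in>X. \<exists>y\<in>X. x \<noteq> y \<and> cmod (f x - f y) \<le> 4 * sqrt 2 * R / sqrt (card X)"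
proof -
  define r where "r = sqrt (card X)"
  \<comment> \<open>The largest integer below \<open>r\<close>, so that n^2 cells are fewer than the
    points; \<open>r \<le> n + 1 \<le> 2 * n\<close> turns the cell diagonal into the bound with
    4.\<close>
  define n where "n = nat (\<lceil>r\<rceil> - 1)"
  have "sqrt 1 < r" unfolding r_def using assms(2) by (intro real_sqrt_less_mono) simp
  then have r1: "r > 1" by simp
  then have n: "real n < r" "r \<le> real n + 1" "n \<ge> 1" by (simp_all add: n_def) linarith+
  have "real n ^ 2 < r ^ 2" using n(1) by (intro power_strict_mono) auto
  then have "n * n < card X"
    by (simp add: r_def power2_eq_square flip: of_nat_mult)
  define u where "u = (\<lambda>x. (Re (f x) + R) * (n / (2 * R)))"
  define v where "v = (\<lambda>x. (Im (f x) + R) * (n / (2 * R)))"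
  define cell where "cell = (\<lambda>w. min \<lfloor>w :: real\<rfloor> (int n - 1))"
  have range: "0 \<le> (a + R) * (n / (2 * R)) \<and> (a + R) * (n / (2 * R)) \<le> n" if "\<bar>a\<bar> \<le> R" for a
  proof -
    have "(a + R) * (n / (2 * R)) \<le> (2 * R) * (n / (2 * R))"
      using that \<open>R > 0\<close> by (intro mult_right_mono) auto
    then show ?thesis using that \<open>R > 0\<close> by auto
  qed
  have uv: "0 \<le> u x \<and> u x \<le> n" "0 \<le> v x \<and> v x \<le> n" if "x \<in> X" for x
    unfolding u_def v_def
    using range[of "Re (f x)"] range[of "Im (f x)"] f[OF that] abs_Re_le_cmod[of "f x"] abs_Im_le_cmod[of "f x"]
    by linarith+
  have "(\<lambda>x. (cell (u x), cell (v x))) ` X \<subseteq> {0..<int n} \<times> {0..<int n}"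
    using uv n(3) by (auto simp: cell_def)
  then have "card ((\<lambda>x. (cell (u x), cell (v x))) ` X) \<le> card ({0..<int n} \<times> {0..<int n})"
    by (intro card_mono) auto
  also have "\<dots> = n * n" by (simp add: card_cartesian_product)
  also note \<open>n * n < card X\<close>
  finally have "\<not> inj_on (\<lambda>x. (cell (u x), cell (v x))) X"
    by (rule pigeonhole)
  then obtain x y where xy: "x \<in> X" "y \<in> X" "x \<noteq> y" "cell (u x) = cell (u y)" "cell (v x) = cell (v y)"
    by (auto simp: inj_on_def)
  have "\<bar>u x - u y\<bar> \<le> 1" "\<bar>v x - v y\<bar> \<le> 1"
    using same_cell_close[OF n(3), of "u x" "u y"] same_cell_close[OF n(3), of "v x" "v y"]
      uv[OF xy(1)] uv[OF xy(2)] xy(4,5) by (auto simp: cell_def)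
  moreover have "\<bar>u x - u y\<bar> = \<bar>Re (f x - f y)\<bar> * (n / (2 * R))"
    "\<bar>v x - v y\<bar> = \<bar>Im (f x - f y)\<bar> * (n / (2 * R))"
  proof -
    have "\<bar>(a + R) * k - (b + R) * k\<bar> = \<bar>a - b\<bar> * k" if "k \<ge> 0" for a b k :: real
      using that by (simp add: left_diff_distrib[symmetric] abs_mult)
    from this[of "n / (2 * R)"] show "\<bar>u x - u y\<bar> = \<bar>Re (f x - f y)\<bar> * (n / (2 * R))"
      "\<bar>v x - v y\<bar> = \<bar>Im (f x - f y)\<bar> * (n / (2 * R))"
      using \<open>R > 0\<close> unfolding u_def v_def minus_complex.sel by simp_all
  qed
  moreover have "a \<le> 2 * R / n" if "a * (n / (2 * R)) \<le> 1" for a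
    using that \<open>R > 0\<close> n(3) by (simp add: pos_le_divide_eq pos_divide_le_eq)
  ultimately have "\<bar>Re (f x - f y)\<bar> \<le> 2 * R / n" "\<bar>Im (f x - f y)\<bar> \<le> 2 * R / n"
    by simp_all
  then have "cmod (f x - f y) \<le> sqrt 2 * (2 * R / n)"
  proof -
    assume le: "\<bar>Re (f x - f y)\<bar> \<le> 2 * R / n" "\<bar>Im (f x - f y)\<bar> \<le> 2 * R / n"
    have "(Re (f x - f y))\<^sup>2 \<le> (2 * R / n)\<^sup>2" "(Im (f x - f y))\<^sup>2 \<le> (2 * R / n)\<^sup>2"
      using power_mono[OF le(1), of 2] power_mono[OF le(2), of 2] by simp_all
    then have "cmod (f x - f y) \<le> sqrt (2 * (2 * R / n)\<^sup>2)"
      unfolding cmod_def by (intro real_sqrt_le_mono) linarith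
    also have "\<dots> = sqrt 2 * (2 * R / n)" using \<open>R > 0\<close> by (simp add: real_sqrt_mult)
    finally show ?thesis .
  qed
  also have "2 * R / n \<le> 4 * R / r"
  proof -
    have "r \<le> 2 * n" using n by linarith
    then have "4 * R / (2 * n) \<le> 4 * R / r" using \<open>R > 0\<close> r1 n(3) by (intro divide_left_mono) auto
    then show ?thesis by simp
  qed
  then have "sqrt 2 * (2 * R / n) \<le> sqrt 2 * (4 * R / r)" by (intro mult_left_mono) auto
  finally have "cmod (f x - f y) \<le> 4 * sqrt 2 * R / sqrt (card X)" by (simp add: r_def mult_ac)
  with xy show ?thesis by blast
qed

definition admissible :: "nat \<Rightarrow> real \<Rightarrow> complex \<Rightarrow> bool" where
  "admissible d h x \<longleftrightarrow> algebraic x \<and> alg_degree x \<le> d \<and> weil_height x \<le> h"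

text \<open>The differences between the coefficients of two of the \<open>(card S choose l) * card T ^ l\<close> sums
  of \<open>l\<close> terms; their exponentials are independent by \<open>lindemann_weierstrass\<close>.\<close>

lemma small_form_exists:
  fixes l :: nat
  assumes S: "finite S" "\<And>a. a \<in> S \<Longrightarrow> admissible d h a \<and> cmod a \<le> 1"
    and T: "finite T" "\<And>b. b \<in> T \<Longrightarrow> b \<noteq> 0 \<and> cmod b \<le> 1"
      "\<And>b c. b \<in> insert 0 T \<Longrightarrow> c \<in> insert 0 T \<Longrightarrow> admissible d h (b - c)"
    and l: "l \<ge> 1" and K: "(card S choose l) * card T ^ l \<ge> 2"
  shows "\<exists>A \<beta>. finite A \<and> card A \<le> 2 * l \<and> (\<forall>a\<in>A. admissible d h a \<and> admissible d h (\<beta> a)) \<and>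
    (\<Sum>a\<in>A. \<beta> a * exp a) \<noteq> 0 \<and>
    cmod (\<Sum>a\<in>A. \<beta> a * exp a) \<le>
      4 * sqrt 2 * (real l * exp 1) / sqrt (real ((card S choose l) * card T ^ l))"
proof -
  define X where "X = (SIGMA A:{A. A \<subseteq> S \<and> card A = l}. Pi\<^sub>E A (\<lambda>_. T))"
  have finX: "finite {A. A \<subseteq> S \<and> card A = l}" using S(1) by (auto intro: finite_subset[of _ "Pow S"])
  have finA: "finite A" if "A \<subseteq> S" for A using that S(1) by (rule finite_subset)
  have "card X = (\<Sum>A\<in>{A. A \<subseteq> S \<and> card A = l}. card (Pi\<^sub>E A (\<lambda>_. T)))"
    unfolding X_def using finX finA T(1) by (intro card_SigmaI) (auto intro!: finite_PiE)
  also have "\<dots> = (\<Sum>A\<in>{A. A \<subseteq> S \<and> card A = l}. card T ^ l)"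
    using finA by (intro sum.cong) (auto simp: card_PiE)
  also have "\<dots> = (card S choose l) * card T ^ l"
    by (simp add: n_subsets[OF S(1)])
  finally have cardX: "card X = (card S choose l) * card T ^ l" .
  have fX: "finite X" unfolding X_def using finX finA T(1) by (intro finite_SigmaI finite_PiE) auto
  have X: "fst x \<subseteq> S" "card (fst x) = l" "snd x \<in> Pi\<^sub>E (fst x) (\<lambda>_. T)" if "x \<in> X" for x
    using that unfolding X_def by (cases x, simp)+
  define c where "c = (\<lambda>(x :: complex set \<times> (complex \<Rightarrow> complex)) a. if a \<in> fst x then snd x a else 0)"
  define V where "V = (\<lambda>x. \<Sum>a\<in>S. c x a * exp a)"
  have cT: "c x a \<in> insert 0 T" if "x \<in> X" for x a
    using PiE_mem[OF X(3)[OF that], of a] by (simp add: c_def)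
  have V: "cmod (V x) \<le> real l * exp 1" if "x \<in> X" for x
  proof -
    note x = X[OF that]
    have "V x = (\<Sum>a\<in>fst x. c x a * exp a)"
      unfolding V_def by (rule sum.mono_neutral_right[OF S(1) x(1)]) (simp add: c_def)
    also have "cmod \<dots> \<le> (\<Sum>a\<in>fst x. exp 1)"
    proof (rule sum_norm_le)
      fix a assume "a \<in> fst x"
      then have "a \<in> S" "c x a \<in> T" using x(1) PiE_mem[OF x(3), of a] by (auto simp: c_def)
      then have "cmod (c x a) \<le> 1" "Re a \<le> 1"
        using T(2)[of "c x a"] S(2)[of a] order.trans[OF complex_Re_le_cmod[of a], of 1] by blast+
      then have "cmod (c x a) * exp (Re a) \<le> 1 * exp 1" by (intro mult_mono) auto
      then show "cmod (c x a * exp a) \<le> exp 1" by (simp add: norm_mult)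
    qed
    also have "\<dots> = real l * exp 1" by (simp add: x(2))
    finally show ?thesis .
  qed
  have "\<exists>x\<in>X. \<exists>y\<in>X. x \<noteq> y \<and>
      cmod (V x - V y) \<le> 4 * sqrt 2 * (real l * exp 1) / sqrt (card X)"
    using K l by (intro pigeonhole_in_square[OF fX] V) (auto simp: cardX)
  then obtain x y where xy: "x \<in> X" "y \<in> X" "x \<noteq> y"
    and close: "cmod (V x - V y) \<le> 4 * sqrt 2 * (real l * exp 1) / sqrt (card X)"
    by blast
  define A where "A = {a \<in> S. c x a \<noteq> c y a}"
  define \<beta> where "\<beta> = (\<lambda>a. c x a - c y a)"
  have A: "finite A" "A \<subseteq> S" using S(1) by (auto simp: A_def)
  have "A \<subseteq> fst x \<union> fst y" by (auto simp: A_def c_def)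
  moreover have "card (fst x) = l" "card (fst y) = l" "finite (fst x)" "finite (fst y)"
    using X(2)[OF xy(1)] X(2)[OF xy(2)] finA[OF X(1)[OF xy(1)]] finA[OF X(1)[OF xy(2)]] by blast+
  ultimately have cardA: "card A \<le> 2 * l"
    using card_mono[of "fst x \<union> fst y" A] card_Un_le[of "fst x" "fst y"] by simp
  have form: "(\<Sum>a\<in>A. \<beta> a * exp a) = V x - V y"
  proof -
    have "(\<Sum>a\<in>A. \<beta> a * exp a) = (\<Sum>a\<in>S. \<beta> a * exp a)"
      using S(1) by (intro sum.mono_neutral_left) (auto simp: A_def \<beta>_def)
    then show ?thesis by (simp add: \<beta>_def V_def left_diff_distrib sum_subtractf)
  qed
  \<comment> \<open>\<open>T\<close> omits 0, so the coefficient function extended by zero still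
    determines the set of exponents; hence distinct pairs give distinct functions.\<close>
  have c_support: "fst z = {a. c z a \<noteq> 0}" if "z \<in> X" for z
    using T(2) PiE_mem[OF X(3)[OF that]] by (auto simp: c_def)
  have "A \<noteq> {}"
  proof
    assume "A = {}"
    have "c x a = c y a" for a
    proof (cases "a \<in> S")
      case True
      then show ?thesis using \<open>A = {}\<close> by (auto simp: A_def)
    next
      case False
      then have "a \<notin> fst x" "a \<notin> fst y" using X(1)[OF xy(1)] X(1)[OF xy(2)] by blast+
      then show ?thesis by (simp add: c_def)
    qed
    then have eq: "c x = c y" by blast
    then have fst: "fst x = fst y" using c_support[OF xy(1)] c_support[OF xy(2)] by simp
    have "snd x = snd y"
    proof (rule PiE_ext)
      show "snd x \<in> Pi\<^sub>E (fst x) (\<lambda>_. T)" "snd y \<in> Pi\<^sub>E (fst x) (\<lambda>_. T)"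
        using X(3)[OF xy(1)] X(3)[OF xy(2)] by (simp_all add: fst)
      show "snd x a = snd y a" if "a \<in> fst x" for a
        using fun_cong[OF eq, of a] that fst by (simp add: c_def)
    qed
    with fst xy(3) show False by (simp add: prod_eq_iff)
  qed
  have adm: "admissible d h a" "admissible d h (\<beta> a)" if "a \<in> A" for a
    using that A(2) S(2) T(3)[OF cT[OF xy(1)] cT[OF xy(2)]] by (auto simp: \<beta>_def)
  have "(\<Sum>a\<in>A. \<beta> a * exp a) \<noteq> 0"
    using adm by (intro lindemann_weierstrass A(1) \<open>A \<noteq> {}\<close>) (auto simp: admissible_def A_def \<beta>_def)
  then show ?thesis
    using A(1) cardA adm close by (intro exI[of _ A] exI[of _ \<beta>]) (simp add: form cardX)
qed

text \<open>Missing terms are filled up with 0 * exp 0, which is why \<open>P 0\<close> is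
  required.\<close>

lemma indexed_form_exists:
  fixes \<beta> :: "complex \<Rightarrow> complex" and m :: nat
  assumes "finite A" "card A \<le> m" "P 0" "\<And>a. a \<in> A \<Longrightarrow> P a \<and> P (\<beta> a)"
  shows "\<exists>\<alpha> \<gamma>. (\<forall>i\<in>{1..m}. P (\<alpha> i) \<and> P (\<gamma> i)) \<and> (\<Sum>i=1..m. \<gamma> i * exp (\<alpha> i)) = (\<Sum>a\<in>A. \<beta> a * exp a)"
proof -
  obtain e where e: "bij_betw e {1..card A} A" using ex_bij_betw_nat_finite_1[OF assms(1)] by blast
  define \<alpha> where "\<alpha> = (\<lambda>i. if i \<le> card A then e i else 0)"
  define \<gamma> where "\<gamma> = (\<lambda>i. if i \<le> card A then \<beta> (e i) else 0)"
  have "(\<Sum>i=1..m. \<gamma> i * exp (\<alpha> i)) = (\<Sum>i=1..card A. \<beta> (e i) * exp (e i))"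
    using assms(2) by (intro sum.mono_neutral_cong_right) (auto simp: \<alpha>_def \<gamma>_def)
  also have "\<dots> = (\<Sum>a\<in>A. \<beta> a * exp a)" by (rule sum.reindex_bij_betw[OF e])
  finally show ?thesis
    using assms(3,4) bij_betwE[OF e] by (intro exI[of _ \<alpha>] exI[of _ \<gamma>]) (auto simp: \<alpha>_def \<gamma>_def)
qed

section \<open>The small linear form\<close>

text \<open>\<open>N2\<close> may fall short of \<open>n2\<close> by about (8/d)^d when d > 8, but
  \<open>N1\<close> exceeds \<open>n1\<close> by a factor of order 3^(d^2 + d) / 2^d.\<close>

lemma counts_dominate:
  fixes d :: nat and g N1 N2 n1 n2 :: real
  assumes d: "d \<ge> 2" and g: "g \<ge> 8"
    and N1: "5 / 12 * 8 ^ d * ((g\<^sup>2) ^ d / (16 * 2 ^ d)) ^ (d + 1) \<le> N1"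
    and N2: "(g\<^sup>2 / (8 * real d)) ^ d \<le> N2"
    and n1: "n1 = 1 / 2 * (1 / 6 * g\<^sup>2) ^ (d\<^sup>2 + d)"
    and n2: "0 \<le> n2" "n2 \<le> 1 / 2 * (g / 8) ^ d"
  shows "n1 \<le> N1" "n1 * n2 \<le> N1 * N2"
proof -
  define u where "u = ((g\<^sup>2 / 6) ^ d) ^ (d + 1)"
  \<comment> \<open>The exact quotient of the lower bound for \<open>N1\<close> by
    \<open>n1\<close>.\<close>
  define r where "r = (5 / 96) * (3 ^ (d + 1) / 2 :: real) ^ d"
  have u0: "u \<ge> 0" by (simp add: u_def)
  have n1u: "n1 = u / 2"
    unfolding n1 u_def power_mult[symmetric] by (simp add: power2_eq_square add.commute)
  have N1r: "r * n1 \<le> N1"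
  proof -
    have "(g\<^sup>2) ^ d / (16 * 2 ^ d) = (g\<^sup>2 / 6) ^ d * (3 ^ d / 16)"
    proof -
      have "(6 :: real) ^ d = 2 ^ d * 3 ^ d" by (simp flip: power_mult_distrib)
      then show ?thesis by (simp add: power_divide)
    qed
    then have "5 / 12 * 8 ^ d * ((g\<^sup>2) ^ d / (16 * 2 ^ d)) ^ (d + 1) =
        5 / 12 * 8 ^ d * (u * ((3 ^ d) ^ (d + 1) / 16 ^ (d + 1)))"
      unfolding u_def by (simp only: power_mult_distrib power_divide)
    also have "\<dots> = 5 / 12 * u * (3 ^ d) ^ (d + 1) * (8 ^ d / 16 ^ (d + 1))" by simp
    also have "(8 :: real) ^ d / 16 ^ (d + 1) = 1 / (16 * 2 ^ d)"
    proof -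
      have "(16 :: real) ^ d = 2 ^ d * 8 ^ d" by (simp flip: power_mult_distrib)
      then show ?thesis by simp
    qed
    also have "5 / 12 * u * (3 ^ d) ^ (d + 1) * (1 / (16 * 2 ^ d)) = r * n1"
    proof -
      have "(3 ^ (d + 1) :: real) ^ d = (3 ^ d) ^ (d + 1)"
        by (simp only: power_mult[symmetric] mult.commute)
      then show ?thesis unfolding r_def n1u power_divide by simp
    qed
    finally show ?thesis using N1 by simp
  qed
  have three: "real d \<le> 3 ^ d"
    using of_nat_less_two_power[of d, where 'a = real] power_mono[of 2 "3 :: real" d] by linarith
  have "(27 / 2 :: real) ^ 2 \<le> (3 ^ (d + 1) / 2) ^ d"
  proof -
    have "(3 :: real) ^ 3 \<le> 3 ^ (d + 1)" using d by (intro power_increasing) auto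
    then have "(27 / 2 :: real) ^ d \<le> (3 ^ (d + 1) / 2) ^ d" by (intro power_mono) auto
    moreover have "(27 / 2 :: real) ^ 2 \<le> (27 / 2) ^ d" using d by (intro power_increasing) auto
    ultimately show ?thesis by linarith
  qed
  then have "r \<ge> 1" by (simp add: r_def power2_eq_square)
  have "0 \<le> n1" using u0 by (simp add: n1u)
  with \<open>r \<ge> 1\<close> have "1 * n1 \<le> r * n1" by (intro mult_right_mono)
  then show le1: "n1 \<le> N1" using N1r by linarith
  define s where "s = (8 / real d) ^ d"
  have "2 * n2 * s \<le> N2"
  proof -
    have "2 * n2 * s \<le> (g / 8) ^ d * s" using n2 by (intro mult_right_mono) (simp_all add: s_def)
    also have "\<dots> = (g / d) ^ d" by (simp add: s_def power_mult_distrib[symmetric])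
    also have "\<dots> \<le> (g\<^sup>2 / (8 * real d)) ^ d"
    proof (intro power_mono)
      have "8 * g \<le> g * g" using g by (intro mult_right_mono) auto
      then have "8 * g / (8 * real d) \<le> g\<^sup>2 / (8 * real d)"
        unfolding power2_eq_square by (intro divide_right_mono) auto
      then show "g / d \<le> g\<^sup>2 / (8 * real d)" by simp
    qed (use g in auto)
    also note N2
    finally show ?thesis .
  qed
  then have "(r * n1) * (2 * n2 * s) \<le> N1 * N2"
    using N1r n2 \<open>0 \<le> n1\<close> le1 by (intro mult_mono) (simp_all add: s_def)
  moreover have "1 \<le> r * 2 * s"
  proof -
    have "12 * real d \<le> 3 ^ (d + 1) / 2 * 8" using three by simp
    then have "12 \<le> 3 ^ (d + 1) / 2 * (8 / real d)" using d by (simp add: le_divide_eq)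
    then have "(12 :: real) ^ d \<le> (3 ^ (d + 1) / 2 * (8 / real d)) ^ d" by (intro power_mono) auto
    moreover have "(12 :: real) ^ 2 \<le> 12 ^ d" using d by (intro power_increasing) auto
    ultimately have "144 \<le> (3 ^ (d + 1) / 2) ^ d * s"
      unfolding s_def power_mult_distrib[symmetric] by simp
    then show ?thesis by (simp add: r_def)
  qed
  then have "1 * (n1 * n2) \<le> r * 2 * s * (n1 * n2)"
    using u0 n2 by (intro mult_right_mono) (auto simp: n1u)
  ultimately show "n1 * n2 \<le> N1 * N2" by (simp add: mult_ac)
qed

text \<open>The power has a nonnegative exponent and must be at least 2, so its base exceeds 1 and
  the exponent is not 0. Its base is exp(h/2) / (6 sqrt 2), and 6 sqrt 2 \<ge> 8.\<close>

lemma height_large: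
  fixes d :: nat and h n2 :: real
  assumes d: "d > 0" and n2: "n2 = 1 / 2 * (1 / 6 * exp (1 / 2 * h - 1 / 2 * ln 2)) powr (real d - sqrt (real d))"
    and "n2 \<ge> 1"
  shows "d \<ge> 2" "exp (h / 2) \<ge> 8" "n2 \<le> 1 / 2 * (exp (h / 2) / 8) ^ d"
proof -
  define x where "x = 1 / 6 * exp (1 / 2 * h - 1 / 2 * ln 2)"
  define p where "p = real d - sqrt (real d)"
  have "sqrt (real d) \<le> real d"
    using d by (intro real_le_lsqrt) (auto simp: power2_eq_square)
  then have p: "0 \<le> p" "p \<le> real d" by (simp_all add: p_def)
  have x0: "x > 0" by (simp add: x_def)
  have n2x: "n2 = 1 / 2 * x powr p" by (simp add: n2 x_def p_def)
  have x1: "x \<ge> 1"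
  proof (rule ccontr)
    assume "\<not> x \<ge> 1"
    then have "x powr p \<le> 1 powr p" using x0 p by (intro powr_mono2) auto
    then show False using \<open>n2 \<ge> 1\<close> by (simp add: n2x)
  qed
  show "d \<ge> 2"
  proof (rule ccontr)
    assume "\<not> d \<ge> 2"
    then have "d = 1" using d by simp
    then have "x powr p = 1" using x0 by (simp add: p_def)
    then show False using \<open>n2 \<ge> 1\<close> by (simp add: n2x)
  qed
  have "exp (1 / 2 * ln 2 :: real) = sqrt 2"
    using powr_half_sqrt[of 2] by (simp add: powr_def)
  then have x: "x = exp (h / 2) / (6 * sqrt 2)" by (simp add: x_def exp_diff)
  have s: "8 \<le> 6 * sqrt 2"
  proof -
    have "sqrt ((4 / 3)\<^sup>2) \<le> sqrt 2" by (intro real_sqrt_le_mono) (simp add: power2_eq_square)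
    then show ?thesis by simp
  qed
  show "exp (h / 2) \<ge> 8" using x1 s by (simp add: x le_divide_eq)
  have "x \<le> exp (h / 2) / 8" unfolding x using s by (intro divide_left_mono) auto
  moreover have "x powr p \<le> x powr real d" using x1 p by (intro powr_mono) auto
  moreover have "x powr real d = x ^ d" using x0 by (rule powr_realpow)
  ultimately show "n2 \<le> 1 / 2 * (exp (h / 2) / 8) ^ d"
    using power_mono[of x "exp (h / 2) / 8" d] x0 by (simp add: n2x)
qed

lemma admissible_points_exist:
  fixes d :: nat and h g :: real
  assumes d: "d \<ge> 2" and g: "g = exp (h / 2)" "g \<ge> 8"
  shows "\<exists>S. finite S \<and> 5 / 12 * 8 ^ d * ((g\<^sup>2) ^ d / (16 * 2 ^ d)) ^ (d + 1) \<le> real (card S) \<and>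
    (\<forall>a\<in>S. admissible d h a \<and> cmod a \<le> 1)"
proof -
  define E where "E = (g\<^sup>2) ^ d"
  have E: "exp (real d * h) = E"
    by (simp add: E_def g(1) exp_of_nat_mult flip: exp_double)
  \<comment> \<open>Chosen with sqrt(d+1) \<le> 2^d / 2 in mind: then 16 z times this bound is
    exactly \<open>E\<close>. Rounding down to \<open>Y\<close> loses at most another factor
    2.\<close>
  define z where "z = E / (8 * 2 ^ d)"
  have "8 * 8 \<le> g * g" using g(2) by (intro mult_mono) auto
  then have "64 ^ d \<le> E" unfolding E_def power2_eq_square by (intro power_mono) auto
  moreover have "(64 :: real) ^ d = 32 ^ d * 2 ^ d" by (simp flip: power_mult_distrib)
  moreover have "(32 :: real) ^ 1 \<le> 32 ^ d" using d by (intro power_increasing) auto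
  then have "32 * 2 ^ d \<le> (32 :: real) ^ d * 2 ^ d" by (intro mult_right_mono) auto
  moreover have "(0 :: real) < 2 ^ d" by simp
  ultimately have "8 * 2 ^ d \<le> E" by linarith
  then have z1: "z \<ge> 1" by (simp add: z_def)
  define Y where "Y = nat \<lfloor>z\<rfloor>"
  have Y: "real Y \<le> z" "z / 2 \<le> real Y" 
  proof -
    have "\<lfloor>z\<rfloor> \<ge> 1" using z1 by simp
    then have "real Y = of_int \<lfloor>z\<rfloor>" "real_of_int \<lfloor>z\<rfloor> \<ge> 1" by (simp_all add: Y_def)
    then show "real Y \<le> z" "z / 2 \<le> real Y" by linarith+
  qed
  have "sqrt (real d + 1) \<le> 2 ^ d / 2"
  proof -
    have "real d + 1 \<le> 4 ^ d / 4"
      using d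
    proof (induction d rule: dec_induct)
      case (step n)
      then show ?case by simp
    qed simp
    also have "\<dots> = (2 ^ d / 2)\<^sup>2"
      by (simp add: power_divide power_mult[symmetric] mult.commute[of d 2]) (simp add: power_mult)
    finally show ?thesis by (intro real_le_lsqrt) auto
  qed
  then have "sqrt (real d + 1) * (16 * real Y) \<le> 2 ^ d / 2 * (16 * z)"
    using Y(1) by (intro mult_mono) auto
  also have "\<dots> = exp (real d * h)" unfolding E by (simp add: z_def)
  finally obtain S where S: "finite S" "5 / 12 * 8 ^ d * real Y ^ (d + 1) \<le> real (card S)"
    "\<forall>\<alpha>\<in>S. algebraic \<alpha> \<and> alg_degree \<alpha> \<le> d \<and> weil_height \<alpha> \<le> h \<and> cmod \<alpha> \<le> 1"
    using many_algebraic_numbers[OF d] by blast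
  have "E / (16 * 2 ^ d) = z / 2" by (simp add: z_def)
  then have "5 / 12 * 8 ^ d * (E / (16 * 2 ^ d)) ^ (d + 1) \<le> 5 / 12 * 8 ^ d * real Y ^ (d + 1)"
    using Y z1 by (intro mult_left_mono power_mono) auto
  then have "5 / 12 * 8 ^ d * (E / (16 * 2 ^ d)) ^ (d + 1) \<le> real (card S)"
    using S(2) by (rule order.trans)
  moreover have "\<forall>a\<in>S. admissible d h a \<and> cmod a \<le> 1" using S(3) by (simp add: admissible_def)
  ultimately show ?thesis using S(1) unfolding E_def by blast
qed

lemma admissible_coefficients_exist:
  fixes d :: nat and h g :: real
  assumes d: "d \<ge> 2" and g: "g = exp (h / 2)" "g \<ge> 8"
  shows "\<exists>T. finite T \<and> T \<noteq> {} \<and> (g\<^sup>2 / (8 * real d)) ^ d \<le> real (card T) \<and>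
    (\<forall>b\<in>T. b \<noteq> 0 \<and> cmod b \<le> 1) \<and> (\<forall>b\<in>insert 0 T. \<forall>c\<in>insert 0 T. admissible d h (b - c))"
proof -
  have eh: "exp h = g\<^sup>2" by (simp add: g(1) flip: exp_double)
  have "8 * 8 \<le> g * g" using g(2) by (intro mult_mono) auto
  then have g64: "g\<^sup>2 \<ge> 64" by (simp add: power2_eq_square)
  define q where "q = nat \<lfloor>g\<^sup>2\<rfloor>"
  have q: "real q \<le> g\<^sup>2" "g\<^sup>2 < real q + 1" "q \<ge> 2" using g64 by (simp_all add: q_def) linarith+
  have lnq: "ln (real k) \<le> h" if "1 \<le> k" "k \<le> q" for k
  proof -
    have "real k \<le> exp h" using that q(1) eh by linarith
    then have "ln (real k) \<le> ln (exp h)" using that by (subst ln_le_cancel_iff) auto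
    then show ?thesis by simp
  qed
  define W where "W = q div (2 * d)"
  show ?thesis
  proof (cases "W = 0")
    case True
    then have "q < 2 * d" using d by (simp add: W_def div_eq_0_iff)
    then have "g\<^sup>2 \<le> 2 * real d" using q(2) by linarith
    then have "g\<^sup>2 / (8 * real d) \<le> 1" using d by (simp add: divide_le_eq)
    then have small: "(g\<^sup>2 / (8 * real d)) ^ d \<le> 1" by (intro power_le_one) auto
    \<comment> \<open>Here the required count is at most 1, so a single rational coefficient of
      height at most log 2 suffices.\<close>
    obtain T where T: "finite T" "card T = 1 ^ 1" "\<forall>\<beta>\<in>T. \<beta> \<noteq> 0 \<and> cmod \<beta> \<le> 1"
      "\<forall>\<beta>\<in>insert 0 T. \<forall>\<gamma>\<in>insert 0 T. algebraic (\<beta> - \<gamma>) \<and> alg_degree (\<beta> - \<gamma>) \<le> 1 \<and>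
        weil_height (\<beta> - \<gamma>) \<le> ln (real 2)"
      using many_coefficients[of 1 2 1] by auto
    have "admissible d h (b - c)" if "b \<in> insert 0 T" "c \<in> insert 0 T" for b c
      using T(4) that lnq[of 2] q(3) d unfolding admissible_def by fastforce
    then show ?thesis using T small by (intro exI[of _ T]) auto
  next
    case False
    have dW: "2 * d * W \<le> q" unfolding W_def by simp
    obtain T where T: "finite T" "card T = W ^ d" "\<forall>\<beta>\<in>T. \<beta> \<noteq> 0 \<and> cmod \<beta> \<le> 1"
      "\<forall>\<beta>\<in>insert 0 T. \<forall>\<gamma>\<in>insert 0 T. algebraic (\<beta> - \<gamma>) \<and> alg_degree (\<beta> - \<gamma>) \<le> d \<and>
        weil_height (\<beta> - \<gamma>) \<le> ln (real q)"
      using many_coefficients[of d q W] d q(3) dW by auto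
    have "q < 2 * d * (W + 1)"
      unfolding W_def using d by (simp add: dividend_less_times_div)
    then have "real q + 1 \<le> real (2 * d * (W + 1))" by linarith
    also have "\<dots> = 2 * real d * (real W + 1)" by (simp add: algebra_simps)
    also have "\<dots> \<le> 2 * real d * (4 * real W)"
      using False by (intro mult_left_mono) auto
    also have "\<dots> = 8 * real d * real W" by simp
    finally have "g\<^sup>2 \<le> 8 * real d * real W" using q(2) by linarith
    then have "g\<^sup>2 / (8 * real d) \<le> real W" using d by (simp add: divide_le_eq mult_ac)
    then have "(g\<^sup>2 / (8 * real d)) ^ d \<le> real W ^ d" by (intro power_mono) auto
    moreover have "T \<noteq> {}" using T(2) False by auto
    moreover have "admissible d h (b - c)" if "b \<in> insert 0 T" "c \<in> insert 0 T" for b c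
      using T(4) that lnq[of q] q(3) unfolding admissible_def by fastforce
    ultimately show ?thesis using T by (intro exI[of _ T]) auto
  qed
qed

theorem theorem1p3:
  fixes m d l :: nat and h n1 n2 :: real
  assumes "m > 0" and "d > 0" and "h > 0"
    and "l = nat \<lfloor>real m / 2\<rfloor>"
    and "n1 = 1 / 2 * (1 / 6 * exp h) ^ (d\<^sup>2 + d)"
    and "n2 = 1 / 2 * (1 / 6 * exp (1 / 2 * h - 1 / 2 * ln 2)) powr (real d - sqrt (real d))"
    and "n1 \<ge> real l" and "n2 \<ge> 1"
  shows "\<exists>(\<alpha> :: nat \<Rightarrow> complex) (\<beta> :: nat \<Rightarrow> complex) (\<Lambda> :: complex).
           (\<forall>i\<in>{1..m}. algebraic (\<alpha> i) \<and> alg_degree (\<alpha> i) \<le> d \<and> weil_height (\<alpha> i) \<le> h \<and>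
                        algebraic (\<beta> i) \<and> alg_degree (\<beta> i) \<le> d \<and> weil_height (\<beta> i) \<le> h) \<and>
           \<Lambda> = (\<Sum>i=1..m. \<beta> i * exp (\<alpha> i)) \<and>
           \<Lambda> \<noteq> 0 \<and>
           ln (cmod \<Lambda>) \<le> - (1 / 2) * real l * ln (n1 * n2 / real l) + ln (real m) + ln (sqrt 2) + 2"
proof -
  define g where "g = exp (h / 2)"
  note large = height_large[OF \<open>d > 0\<close> assms(6) \<open>n2 \<ge> 1\<close>, folded g_def]
  have eh: "exp h = g\<^sup>2" by (simp add: g_def flip: exp_double)
  obtain S where S: "finite S" "5 / 12 * 8 ^ d * ((g\<^sup>2) ^ d / (16 * 2 ^ d)) ^ (d + 1) \<le> real (card S)"
    "\<And>a. a \<in> S \<Longrightarrow> admissible d h a \<and> cmod a \<le> 1"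
    using admissible_points_exist[OF large(1) g_def large(2)] by blast
  obtain T where T: "finite T" "T \<noteq> {}" "(g\<^sup>2 / (8 * real d)) ^ d \<le> real (card T)"
    "\<And>b. b \<in> T \<Longrightarrow> b \<noteq> 0 \<and> cmod b \<le> 1"
    "\<And>b c. b \<in> insert 0 T \<Longrightarrow> c \<in> insert 0 T \<Longrightarrow> admissible d h (b - c)"
    using admissible_coefficients_exist[OF large(1) g_def large(2)] by blast
  have n2: "0 \<le> n2" using \<open>n2 \<ge> 1\<close> by simp
  note dom = counts_dominate[OF large(1,2) S(2) T(3) assms(5)[unfolded eh] n2 large(3)]
  have adm0: "admissible d h 0" using T(5)[of 0 0] by simp
  define K where "K = (card S choose l) * card T ^ l"
  define B where "B = - (1 / 2) * real l * ln (n1 * n2 / real l) + ln (real m) + ln (sqrt 2) + 2"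
  have "\<exists>A \<beta>. finite A \<and> card A \<le> m \<and> (\<forall>a\<in>A. admissible d h a \<and> admissible d h (\<beta> a)) \<and>
      (\<Sum>a\<in>A. \<beta> a * exp a) \<noteq> 0 \<and> ln (cmod (\<Sum>a\<in>A. \<beta> a * exp a)) \<le> B"
  \<comment> \<open>In this case, which includes \<open>l = 0\<close>, the bound \<open>B\<close> is
    nonnegative and one term b * exp 0 with \<open>cmod b \<le> 1\<close> will do.\<close>
  proof (cases "real l * ln (n1 * n2 / real l) \<le> 0")
    case True
    have "B \<ge> 0"
    proof -
      have "ln (real m) \<ge> 0" "ln (sqrt 2) \<ge> (0 :: real)" using \<open>m > 0\<close> by simp_all
      then show ?thesis using True unfolding B_def by linarith
    qed
    obtain b where b: "b \<in> T" using T(2) by blast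
    have "ln (cmod b) \<le> 0" using T(4)[OF b] by simp
    then have "ln (cmod b) \<le> B" using \<open>B \<ge> 0\<close> by linarith
    moreover have "admissible d h b" using T(5)[of b 0] b by simp
    ultimately show ?thesis
      using T(4)[OF b] adm0 \<open>m > 0\<close> by (intro exI[of _ "{0}"] exI[of _ "\<lambda>_. b"]) auto
  next
    case False
    then have l: "l \<ge> 1" by (cases "l = 0") auto
    have pos: "n1 * n2 / real l > 0" using l assms(7,8) by simp
    have "ln (n1 * n2 / real l) > 0"
    proof (rule ccontr)
      assume "\<not> ?thesis"
      then have "real l * ln (n1 * n2 / real l) \<le> 0" by (intro mult_nonneg_nonpos) auto
      with False show False by simp
    qed
    then have gt1: "n1 * n2 / real l > 1" using pos by simp
    have lm: "2 * l \<le> m"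
    proof -
      have "real l = of_int \<lfloor>real m / 2\<rfloor>" by (simp add: assms(4))
      then have "real l \<le> real m / 2" using of_int_floor_le[of "real m / 2"] by simp
      then show ?thesis by linarith
    qed
    \<comment> \<open>This is where \<open>n1 \<ge> l\<close> enters: the bound (N/l)^l for the
      binomial coefficient requires \<open>l \<le> N\<close>.\<close>
    have lS: "l \<le> card S" using dom(1) assms(7) by linarith
    have K: "(n1 * n2 / real l) ^ l \<le> real K"
    proof -
      have "(n1 * n2 / real l) ^ l \<le> (real (card S) * real (card T) / real l) ^ l"
        using dom(2) pos by (intro power_mono divide_right_mono) auto
      also have "\<dots> = (real (card S) / real l) ^ l * real (card T) ^ l"
        by (simp add: power_divide power_mult_distrib)
      also have "\<dots> \<le> real (card S choose l) * real (card T) ^ l"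
        using binomial_ge_n_over_k_pow_k[OF lS, where 'a = real] by (intro mult_right_mono) auto
      finally show ?thesis by (simp add: K_def)
    qed
    have "1 < (n1 * n2 / real l) ^ l" using gt1 l by (intro one_less_power) auto
    then have K2: "K \<ge> 2" and Kpos: "0 < (n1 * n2 / real l) ^ l" using K by linarith+
    obtain A \<beta> where A: "finite A" "card A \<le> 2 * l" "\<forall>a\<in>A. admissible d h a \<and> admissible d h (\<beta> a)"
      and nz: "(\<Sum>a\<in>A. \<beta> a * exp a) \<noteq> 0"
      and le: "cmod (\<Sum>a\<in>A. \<beta> a * exp a) \<le> 4 * sqrt 2 * (real l * exp 1) / sqrt (real K)"
      using small_form_exists[OF S(1,3) T(1,4,5) l] K2 unfolding K_def by blast
    have e2: "2 \<le> exp (1 :: real)" using exp_ge_add_one_self[of "1 :: real"] by simp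
    have "4 * sqrt 2 * (real l * exp 1) \<le> sqrt 2 * (real m * exp 2)"
    proof -
      have "(2 * real l) * (2 * exp 1) \<le> real m * (exp 1 * exp 1)"
        using lm e2 by (intro mult_mono) auto
      then have "sqrt 2 * ((2 * real l) * (2 * exp 1)) \<le> sqrt 2 * (real m * (exp 1 * exp 1))"
        by (intro mult_left_mono) auto
      then show ?thesis by (simp add: mult_ac flip: exp_add)
    qed
    then have "4 * sqrt 2 * (real l * exp 1) / sqrt (real K) \<le>
        sqrt 2 * (real m * exp 2) / sqrt ((n1 * n2 / real l) ^ l)"
      using K Kpos by (intro frac_le real_sqrt_le_mono) auto
    with le have le': "cmod (\<Sum>a\<in>A. \<beta> a * exp a) \<le>
        sqrt 2 * (real m * exp 2) / sqrt ((n1 * n2 / real l) ^ l)" by linarith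
    have "0 < cmod (\<Sum>a\<in>A. \<beta> a * exp a)" using nz by simp
    then have "ln (cmod (\<Sum>a\<in>A. \<beta> a * exp a)) \<le> ln (sqrt 2 * (real m * exp 2) / sqrt ((n1 * n2 / real l) ^ l))"
      using le' less_le_trans[OF _ le'] ln_le_cancel_iff by blast
    also have "\<dots> = ln (sqrt 2 * (real m * exp 2)) - ln (sqrt ((n1 * n2 / real l) ^ l))"
      using \<open>m > 0\<close> Kpos by (intro ln_divide_pos) auto
    also have "ln (sqrt 2 * (real m * exp 2)) = ln (sqrt 2) + (ln (real m) + 2)"
      using \<open>m > 0\<close> by (simp add: ln_mult)
    also have "ln (sqrt ((n1 * n2 / real l) ^ l)) = real l * ln (n1 * n2 / real l) / 2"
      using Kpos pos by (simp only: ln_sqrt ln_realpow)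
    finally have "ln (cmod (\<Sum>a\<in>A. \<beta> a * exp a)) \<le> B" by (simp add: B_def)
    then show ?thesis using A nz lm by (intro exI[of _ A] exI[of _ \<beta>]) auto
  qed
  then obtain A \<beta> where A: "finite A" "card A \<le> m" "\<And>a. a \<in> A \<Longrightarrow> admissible d h a \<and> admissible d h (\<beta> a)"
    and nz: "(\<Sum>a\<in>A. \<beta> a * exp a) \<noteq> 0" and B: "ln (cmod (\<Sum>a\<in>A. \<beta> a * exp a)) \<le> B" by blast
  obtain \<alpha> \<gamma> where ag: "\<forall>i\<in>{1..m}. admissible d h (\<alpha> i) \<and> admissible d h (\<gamma> i)"
    "(\<Sum>i=1..m. \<gamma> i * exp (\<alpha> i)) = (\<Sum>a\<in>A. \<beta> a * exp a)"
    using indexed_form_exists[OF A(1,2), of "admissible d h" \<beta>] adm0 A(3) by blast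
  show ?thesis
    using ag nz B unfolding B_def
    by (intro exI[of _ \<alpha>] exI[of _ \<gamma>] exI[of _ "\<Sum>a\<in>A. \<beta> a * exp a"]) (simp add: admissible_def)
qed

end
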